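(* Let $\mu$ be a probability measure on $\mathbb{P}^n$ with no atoms (i.e. $\mu(\{\eta\})=0$ for every $\eta\in\mathbb{P}^n$). Let $$\mathbb{G}_\mu(\zeta)=\int_{\mathbb{P}^n}\log\frac{|\zeta\wedge\eta|}{|\zeta||\eta|}\,d\mu(\eta),\qquad \zeta\in\mathbb{P}^n .$$ Then the Monge–Ampère measure $(\omega+dd^c\mathbb{G}_\mu)^n$ is absolutely continuous with respect to the Fubini–Study volume form on $\mathbb{P}^n$.
   Context: $\mathbb{P}^n$ is the complex projective space of complex dimension $n$, with homogeneous coordinates $\zeta=[\zeta_0,\dots,\zeta_n]$. For representatives $\zeta,\eta\in\mathbb{C}^{n+1}\setminus\{0\}$, $|\cdot|$ is the Euclidean norm and $|\zeta\wedge\eta|^2=\sum_{0\le i<j\le n}|\zeta_i\eta_j-\zeta_j\eta_i|^2$; the quotient $|\zeta\wedge\eta|/(|\zeta||\eta|)$ depends only on the points of $\mathbb{P}^n$, and $\log 0=-\infty$. The operator $dd^c$ is normalized as $dd^c=\frac{i}{\pi}\partial\bar\partial$. The Fubini–Study form $\omega=\omega_{FS}$ is given on each chart $\mathcal{U}_k=\{\zeta_k\neq 0\}$, with affine coordinates $z^k=(\zeta_j/\zeta_k)_{j\ne k}\in\mathbb{C}^n$, by $\omega|_{\mathcal{U}_k}=\frac12 dd^c\log(1+|z^k|^2)$; the Fubini–Study volume form is $\omega^n$ (up to a constant factor). A function $\varphi:\mathbb{P}^n\to[-\infty,\infty)$ is $\omega$-plurisubharmonic if, for every local potential $\rho$ of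 $\omega$ ($dd^c\rho=\omega$, $\rho$ smooth), $\varphi+\rho$ is plurisubharmonic (and not identically $-\infty$) where $\rho$ is defined. Local domain of definition of the complex Monge–Ampère operator. For an open set $\Omega\subset\mathbb{C}^n$, $DMA_{loc}(\Omega)$ is the set of plurisubharmonic functions $\phi$ on $\Omega$ for which there is a positive Borel measure $\sigma$ on $\Omega$ such that for every open $U\subset\subset\Omega$ and every sequence $(\phi_j)$ of $C^\infty$ plurisubharmonic functions on $U$ decreasing to $\phi$ in $U$, the measures $(dd^c\phi_j)^n$ converge weakly to $\sigma$ in $U$; one then sets $(dd^c\phi)^n:=\sigma$. An $\omega$-plurisubharmonic function $\varphi$ on $\mathbb{P}^n$ belongs to $DMA_{loc}(\mathbb{P}^n,\omega)$ if for every local holomorphic chart $(U,z)$ on which $\omega$ has a Kähler potential $\rho$, one has $\varphi+\rho\in DMA_{loc}(U)$; in that case $(\omega+dd^c\varphi)^n$ is the positive measure on $\mathbb{P}^n$ given on each such $U$ by $(dd^c(\varphi+\rho))^n$. For every probability measure $\mu$ on $\mathbb{P}^n$, $\mathbb{G}_\mu$ is $\omega$-plurisubharmonic and belongs to $DMA_{loc}(\mathbb{P}^n,\omega)$, so $(\omega+dd^c\mathbb{G}_\mu)^n$ is well defined.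
   Formalization: The hypothesis n ≥ 2 is added: for n = 1 one has ω + dd^c G_μ = μ, so an atomless singular μ (for example the Cantor measure in an affine chart) is a counterexample to the statement. *)

theory Defs
  imports "HOL-Probability.Probability_Measure"
begin

section \<open>Extended-real integrals and logarithm\<close>

text \<open>Integral with values in the extended reals. The functions integrated below are bounded
  above on spaces of finite measure, so the first term is finite and the value \<open>-\<infinity>\<close> is
  attained exactly when the negative part is not integrable.\<close>

definition ereal_integral :: "'a measure \<Rightarrow> ('a \<Rightarrow> ereal) \<Rightarrow> ereal" where
  "ereal_integral M f =
     enn2ereal (\<integral>\<^sup>+ x. e2ennreal (f x) \<partial>M) - enn2ereal (\<integral>\<^sup>+ x. e2ennreal (- f x) \<partial>M)"

definition log_ereal :: "real \<Rightarrow> ereal" where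
  "log_ereal x = (if x \<le> 0 then -\<infinity> else ereal (ln x))"


section \<open>Smooth functions, plurisubharmonic functions and \<open>dd\<^sup>c\<close> on open sets of complex n-space\<close>

primrec Ck_on ::
  "nat \<Rightarrow> ('a::real_normed_vector \<Rightarrow> 'b::real_normed_vector) \<Rightarrow> 'a set \<Rightarrow> bool" where
  "Ck_on 0 f S \<longleftrightarrow> continuous_on S f"
| "Ck_on (Suc k) f S \<longleftrightarrow>
     (\<forall>x\<in>S. f differentiable (at x)) \<and>
     (\<forall>v. Ck_on k (\<lambda>x. frechet_derivative f (at x) v) S)"

definition smooth_on ::
  "'a::real_normed_vector set \<Rightarrow> ('a \<Rightarrow> 'b::real_normed_vector) \<Rightarrow> bool" where
  "smooth_on S f \<longleftrightarrow> (\<forall>k. Ck_on k f S)"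

definition holomorphic_map_on ::
  "(complex^'n) set \<Rightarrow> (complex^'n \<Rightarrow> complex^'m) \<Rightarrow> bool" where
  "holomorphic_map_on S F \<longleftrightarrow>
     (\<forall>x\<in>S. \<exists>D. (F has_derivative D) (at x) \<and> (\<forall>c v. D (c *s v) = c *s D v))"

definition circle_mean :: "(complex^'n \<Rightarrow> ereal) \<Rightarrow> complex^'n \<Rightarrow> complex^'n \<Rightarrow> ereal" where
  "circle_mean u a b =
     ereal_integral (restrict_space lborel {0..2*pi}) (\<lambda>t. u (a + cis t *s b)) / ereal (2*pi)"

text \<open>Upper semicontinuous, less than \<open>+\<infinity>\<close>, and satisfying the sub-mean-value inequality on every
  closed complex disc contained in \<open>\<Omega>\<close>. The constant \<open>-\<infinity>\<close> is allowed here.\<close>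

definition psh_on :: "(complex^'n) set \<Rightarrow> (complex^'n \<Rightarrow> ereal) \<Rightarrow> bool" where
  "psh_on \<Omega> u \<longleftrightarrow>
     open \<Omega> \<and>
     (\<forall>z\<in>\<Omega>. u z \<noteq> \<infinity>) \<and>
     (\<forall>c. open {z\<in>\<Omega>. u z < c}) \<and>
     (\<forall>a b. (\<forall>t. norm t \<le> 1 \<longrightarrow> a + t *s b \<in> \<Omega>) \<longrightarrow> u a \<le> circle_mean u a b)"

definition partial_z :: "'n \<Rightarrow> (complex^'n \<Rightarrow> complex) \<Rightarrow> complex^'n \<Rightarrow> complex" where
  "partial_z j f z =
     (frechet_derivative f (at z) (axis j 1) - \<i> * frechet_derivative f (at z) (axis j \<i>)) / 2"

definition partial_zbar :: "'n \<Rightarrow> (complex^'n \<Rightarrow> complex) \<Rightarrow> complex^'n \<Rightarrow> complex" where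
  "partial_zbar j f z =
     (frechet_derivative f (at z) (axis j 1) + \<i> * frechet_derivative f (at z) (axis j \<i>)) / 2"

text \<open>A (1,1)-form \<open>\<Sum> a\<^sub>j\<^sub>k dz\<^sub>j \<and> d\<bar>z\<^sub>k\<close> is represented at each point by its coefficient matrix
  \<open>(a\<^sub>j\<^sub>k)\<close>. The normalization is \<open>dd\<^sup>c = (\<i>/\<pi>) \<partial>\<partial>\<bar>\<close>.\<close>

definition ddc :: "(complex^'n \<Rightarrow> real) \<Rightarrow> complex^'n \<Rightarrow> complex^'n^'n" where
  "ddc u z = (\<chi> j k. \<i> / of_real pi * partial_z j (partial_zbar k (\<lambda>w. of_real (u w))) z)"

text \<open>Density with respect to Lebesgue measure of the n-th exterior power of a (1,1)-form with
  coefficient matrix \<open>a\<close>: the power is \<open>n! det(a)\<close> times the product over \<open>j\<close> of the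
  forms \<open>dz\<^sub>j \<and> d\<bar>z\<^sub>j\<close>, each of which is \<open>-2\<i> dx\<^sub>j \<and> dy\<^sub>j\<close>.\<close>

definition top_power_density :: "complex^'n^'n \<Rightarrow> complex" where
  "top_power_density a = fact CARD('n) * (- 2 * \<i>) ^ CARD('n) * det a"

definition smooth_MA :: "(complex^'n) set \<Rightarrow> (complex^'n \<Rightarrow> real) \<Rightarrow> (complex^'n) measure" where
  "smooth_MA U u =
     density (restrict_space lborel U) (\<lambda>z. ennreal (Re (top_power_density (ddc u z))))"


section \<open>The local domain of definition of the complex Monge--Ampere operator\<close>

definition weakly_converges_on ::
  "'a::topological_space set \<Rightarrow> (nat \<Rightarrow> 'a measure) \<Rightarrow> 'a measure \<Rightarrow> bool" where
  "weakly_converges_on U \<mu>s \<sigma> \<longleftrightarrow>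
     (\<forall>h::'a \<Rightarrow> real. continuous_on UNIV h \<and> compact (closure {x. h x \<noteq> 0}) \<and>
         closure {x. h x \<noteq> 0} \<subseteq> U \<longrightarrow>
         (\<lambda>j. integral\<^sup>L (\<mu>s j) h) \<longlonglongrightarrow> integral\<^sup>L \<sigma> h)"

definition smooth_psh_approx ::
  "(complex^'n) set \<Rightarrow> (nat \<Rightarrow> complex^'n \<Rightarrow> real) \<Rightarrow> (complex^'n \<Rightarrow> ereal) \<Rightarrow> bool" where
  "smooth_psh_approx U f \<phi> \<longleftrightarrow>
     (\<forall>j. smooth_on U (f j) \<and> psh_on U (\<lambda>z. ereal (f j z))) \<and>
     (\<forall>z\<in>U. decseq (\<lambda>j. f j z) \<and> (\<lambda>j. ereal (f j z)) \<longlonglongrightarrow> \<phi> z)"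

text \<open>\<open>MA_on \<Omega> \<phi> \<sigma>\<close>: the measure \<open>\<sigma>\<close> on \<open>\<Omega>\<close> is \<open>(dd\<^sup>c \<phi>)\<^sup>n\<close>. Finiteness of \<open>\<sigma>\<close> on compact sets,
  part of being a weak (vague) limit, is explicit because the Bochner integral of a
  non-integrable function is 0 by convention.\<close>

definition MA_on ::
  "(complex^'n) set \<Rightarrow> (complex^'n \<Rightarrow> ereal) \<Rightarrow> (complex^'n) measure \<Rightarrow> bool" where
  "MA_on \<Omega> \<phi> \<sigma> \<longleftrightarrow>
     psh_on \<Omega> \<phi> \<and>
     sets \<sigma> = sets (restrict_space borel \<Omega>) \<and>
     (\<forall>K. compact K \<and> K \<subseteq> \<Omega> \<longrightarrow> emeasure \<sigma> K < \<infinity>) \<and>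
     (\<forall>U f. open U \<and> compact (closure U) \<and> closure U \<subseteq> \<Omega> \<and> smooth_psh_approx U f \<phi> \<longrightarrow>
        weakly_converges_on U (\<lambda>j. smooth_MA U (f j)) \<sigma>)"

definition DMA_loc :: "(complex^'n) set \<Rightarrow> (complex^'n \<Rightarrow> ereal) set" where
  "DMA_loc \<Omega> = {\<phi>. \<exists>\<sigma>. MA_on \<Omega> \<phi> \<sigma>}"


section \<open>Complex projective space\<close>

text \<open>For an index type \<open>'n\<close> with n elements, the homogeneous coordinates are indexed by
  \<open>'n option\<close>, which has n + 1 elements.\<close>

definition proj_rel :: "complex^('n::finite option) \<Rightarrow> complex^('n option) \<Rightarrow> bool" where
  "proj_rel v w \<longleftrightarrow> v \<noteq> 0 \<and> w \<noteq> 0 \<and> (\<exists>c. c \<noteq> 0 \<and> w = c *s v)"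

lemma part_equivp_proj_rel: "part_equivp proj_rel"
proof (rule part_equivpI)
  show "\<exists>x. proj_rel x x"
    by (rule exI[of _ "axis None 1"]) (auto simp: proj_rel_def axis_eq_0_iff intro: exI[of _ 1])
  show "symp proj_rel"
  proof (rule sympI)
    fix v w :: "complex^('n::finite option)"
    assume "proj_rel v w"
    then obtain c where c: "v \<noteq> 0" "w \<noteq> 0" "c \<noteq> 0" "w = c *s v"
      by (auto simp: proj_rel_def)
    then have "v = inverse c *s w"
      by (simp add: vector_smult_assoc)
    with c show "proj_rel w v"
      unfolding proj_rel_def by (metis inverse_nonzero_iff_nonzero)
  qed
  show "transp proj_rel"
  proof (rule transpI)
    fix u v w :: "complex^('n::finite option)"
    assume "proj_rel u v" "proj_rel v w"
    then obtain c d where "u \<noteq> 0" "w \<noteq> 0" "c \<noteq> 0" "d \<noteq> 0" "v = c *s u" "w = d *s v"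
      by (auto simp: proj_rel_def)
    then show "proj_rel u w"
      unfolding proj_rel_def by (metis mult_eq_0_iff vector_smult_assoc)
  qed
qed

quotient_type (overloaded) 'n cproj = "complex^('n::finite option)" / partial: proj_rel
  morphisms hcoords proj_pt
  by (rule part_equivp_proj_rel)

text \<open>\<open>proj_pt v\<close> is the point with homogeneous coordinates \<open>v \<noteq> 0\<close>; \<open>rep p\<close> is some choice of
  homogeneous coordinates of \<open>p\<close>.\<close>

definition rep :: "'n::finite cproj \<Rightarrow> complex^('n option)" where
  "rep p = (SOME v. v \<noteq> 0 \<and> proj_pt v = p)"

instantiation cproj :: (finite) topological_space
begin

definition open_cproj :: "'a cproj set \<Rightarrow> bool" where
  "open_cproj U \<longleftrightarrow> open {v. v \<noteq> 0 \<and> proj_pt v \<in> U}"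

instance
proof
  have "{v. v \<noteq> 0 \<and> proj_pt v \<in> (UNIV :: 'a cproj set)} = - {0}"
    by auto
  then show "open (UNIV :: 'a cproj set)"
    by (simp add: open_cproj_def open_Compl)
next
  fix S T :: "'a cproj set"
  assume "open S" "open T"
  moreover have "{v. v \<noteq> 0 \<and> proj_pt v \<in> S \<inter> T} =
      {v. v \<noteq> 0 \<and> proj_pt v \<in> S} \<inter> {v. v \<noteq> 0 \<and> proj_pt v \<in> T}"
    by auto
  ultimately show "open (S \<inter> T)"
    by (simp only: open_cproj_def) (simp add: open_Int)
next
  fix K :: "'a cproj set set"
  assume "\<forall>S\<in>K. open S"
  moreover have "{v. v \<noteq> 0 \<and> proj_pt v \<in> \<Union>K} = (\<Union>S\<in>K. {v. v \<noteq> 0 \<and> proj_pt v \<in> S})"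
    by auto
  ultimately show "open (\<Union>K)"
    by (simp only: open_cproj_def) (simp add: open_UN)
qed

end

text \<open>The affine chart on \<open>{\<zeta>\<^sub>k \<noteq> 0}\<close> takes \<open>\<zeta>\<close> to \<open>(\<zeta>\<^sub>l / \<zeta>\<^sub>k)\<^bsub>l \<noteq> k\<^esub>\<close>; the bijection \<open>skip_index k\<close> from \<open>'n\<close>
  onto \<open>{l. l \<noteq> k}\<close> labels these n coordinates by \<open>'n\<close>.\<close>

definition skip_index :: "'n option \<Rightarrow> 'n \<Rightarrow> 'n option" where
  "skip_index k j = (if Some j = k then None else Some j)"

definition affine_dom :: "'n::finite option \<Rightarrow> 'n cproj set" where
  "affine_dom k = {p. rep p $ k \<noteq> 0}"

definition affine_chart :: "'n::finite option \<Rightarrow> 'n cproj \<Rightarrow> complex^'n" where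
  "affine_chart k p = (\<chi> j. rep p $ skip_index k j / rep p $ k)"

definition affine_inv :: "'n::finite option \<Rightarrow> complex^'n \<Rightarrow> 'n cproj" where
  "affine_inv k = the_inv_into (affine_dom k) (affine_chart k)"

text \<open>A holomorphic chart: a homeomorphism from an open set of projective space onto an open set of
  complex n-space which is holomorphically compatible with all affine charts.\<close>

definition holomorphic_chart :: "'n::finite cproj set \<Rightarrow> ('n cproj \<Rightarrow> complex^'n) \<Rightarrow> bool" where
  "holomorphic_chart U z \<longleftrightarrow>
     open U \<and> open (z ` U) \<and> inj_on z U \<and> homeomorphism U (z ` U) z (the_inv_into U z) \<and>
     (\<forall>k. holomorphic_map_on (affine_chart k ` (U \<inter> affine_dom k)) (z \<circ> affine_inv k) \<and>
          holomorphic_map_on (z ` (U \<inter> affine_dom k)) (affine_chart k \<circ> the_inv_into U z))"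


section \<open>The Fubini--Study form and \<open>\<omega>\<close>-plurisubharmonic functions\<close>

text \<open>By symmetry of the formula, the coefficients of \<open>\<omega>\<close> are the same function of the affine
  coordinates in every affine chart.\<close>

definition omega_FS :: "complex^'n \<Rightarrow> complex^'n^'n" where
  "omega_FS = ddc (\<lambda>w. ln (1 + (norm w)\<^sup>2) / 2)"

text \<open>The volume form \<open>\<omega>\<^sup>n\<close>, as a measure. It is computed in the affine chart \<open>{\<zeta>\<^sub>0 \<noteq> 0}\<close> (index
  \<open>None\<close>), whose complement is a hyperplane and hence null for a smooth volume form.\<close>

definition FS_volume :: "'n::finite cproj measure" where
  "FS_volume =
     distr (density lborel (\<lambda>w. ennreal (Re (top_power_density (omega_FS w :: complex^'n^'n)))))
       borel (affine_inv None)"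

text \<open>\<open>\<rho>\<close> is a smooth function on the open set \<open>V\<close> with \<open>dd\<^sup>c \<rho> = \<omega>\<close>; smoothness and the equation are
  expressed in the affine charts.\<close>

definition local_potential :: "'n::finite cproj set \<Rightarrow> ('n cproj \<Rightarrow> real) \<Rightarrow> bool" where
  "local_potential V \<rho> \<longleftrightarrow>
     open V \<and>
     (\<forall>k. smooth_on (affine_chart k ` (V \<inter> affine_dom k)) (\<rho> \<circ> affine_inv k) \<and>
          (\<forall>w \<in> affine_chart k ` (V \<inter> affine_dom k). ddc (\<rho> \<circ> affine_inv k) w = omega_FS w))"

definition psh_on_cproj :: "'n::finite cproj set \<Rightarrow> ('n cproj \<Rightarrow> ereal) \<Rightarrow> bool" where
  "psh_on_cproj V u \<longleftrightarrow> (\<forall>k. psh_on (affine_chart k ` (V \<inter> affine_dom k)) (u \<circ> affine_inv k))"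

definition omega_psh :: "('n::finite cproj \<Rightarrow> ereal) \<Rightarrow> bool" where
  "omega_psh \<phi> \<longleftrightarrow>
     (\<forall>p. \<phi> p \<noteq> \<infinity>) \<and>
     (\<forall>V \<rho>. local_potential V \<rho> \<longrightarrow>
        psh_on_cproj V (\<lambda>p. \<phi> p + ereal (\<rho> p)) \<and> (V \<noteq> {} \<longrightarrow> (\<exists>p\<in>V. \<phi> p \<noteq> -\<infinity>)))"

definition DMA_loc_omega :: "('n::finite cproj \<Rightarrow> ereal) set" where
  "DMA_loc_omega =
     {\<phi>. omega_psh \<phi> \<and>
        (\<forall>U z \<rho>. holomorphic_chart U z \<and> local_potential U \<rho> \<longrightarrow>
           (\<lambda>w. \<phi> (the_inv_into U z w) + ereal (\<rho> (the_inv_into U z w))) \<in> DMA_loc (z ` U))}"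

text \<open>\<open>has_MA_omega \<phi> \<sigma>\<close>: the function \<open>\<phi>\<close> belongs to \<open>DMA_loc_omega\<close>, and \<open>\<sigma>\<close> is the measure
  \<open>(\<omega> + dd\<^sup>c \<phi>)\<^sup>n\<close>, that is, in every holomorphic chart \<open>(U, z)\<close> carrying a potential \<open>\<rho>\<close> of \<open>\<omega>\<close> it
  is \<open>(dd\<^sup>c (\<phi> + \<rho>))\<^sup>n\<close>.\<close>

definition has_MA_omega :: "('n::finite cproj \<Rightarrow> ereal) \<Rightarrow> 'n cproj measure \<Rightarrow> bool"
    (infix "has'_MA'_omega" 50) where
  "\<phi> has_MA_omega \<sigma> \<longleftrightarrow>
     \<phi> \<in> DMA_loc_omega \<and> sets \<sigma> = sets borel \<and>
     (\<forall>U z \<rho>. holomorphic_chart U z \<and> local_potential U \<rho> \<longrightarrow>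
        MA_on (z ` U) (\<lambda>w. \<phi> (the_inv_into U z w) + ereal (\<rho> (the_inv_into U z w)))
          (distr (restrict_space \<sigma> U) (restrict_space borel (z ` U)) z))"


section \<open>The projective logarithmic potential\<close>

text \<open>The sum over all index pairs counts each pair \<open>i < j\<close> twice, whence the factor 1/2.\<close>

definition wedge_norm :: "complex^'m \<Rightarrow> complex^'m \<Rightarrow> real" where
  "wedge_norm \<zeta> \<eta> =
     sqrt ((\<Sum>i\<in>UNIV. \<Sum>j\<in>UNIV. (cmod (\<zeta> $ i * \<eta> $ j - \<zeta> $ j * \<eta> $ i))\<^sup>2) / 2)"

definition log_kernel :: "'n::finite cproj \<Rightarrow> 'n cproj \<Rightarrow> ereal" where
  "log_kernel \<zeta> \<eta> =
     log_ereal (wedge_norm (rep \<zeta>) (rep \<eta>) / (norm (rep \<zeta>) * norm (rep \<eta>)))"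

definition log_potential :: "'n::finite cproj measure \<Rightarrow> 'n cproj \<Rightarrow> ereal" where
  "log_potential \<mu> \<zeta> = ereal_integral \<mu> (\<lambda>\<eta>. log_kernel \<zeta> \<eta>)"

end

theory Submission
  imports Defs "HOL-Complex_Analysis.Cauchy_Integral_Formula"
begin

text \<open>Fix an affine chart \<open>\<zeta>\<^sub>k \<noteq> 0\<close> and write \<open>Z = (1, z)\<close> for the homogeneous coordinates of a point. Adding the
potential \<open>log (|\<zeta>| / |\<zeta>\<^sub>k|)\<close> of \<open>\<omega>\<close> to the logarithmic potential of \<open>\<mu>\<close> gives
\<open>u z = 1/2 \<integral> log q(z, \<eta>) d\<mu>(\<eta>)\<close> with \<open>q(z, \<eta>) = |Z \<and> \<eta>|\<^sup>2 / |\<eta>|\<^sup>2 = |(I - P\<^sub>\<eta>) Z|\<^sup>2\<close>, where \<open>P\<^sub>\<eta>\<close> is the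
orthogonal projection onto the line \<open>\<eta>\<close>; so \<open>q\<close> is a Hermitian form in \<open>Z\<close>. The functions
\<open>u\<^sub>\<delta> z = 1/2 \<integral> log (q(z, \<eta>) + \<delta>\<^sup>2) d\<mu>(\<eta>)\<close> are smooth, plurisubharmonic and decrease to \<open>u\<close>. Since the
Monge--Ampere measure of \<open>u\<close> is the weak limit along every such sequence, it is the weak limit of the
measures with density \<open>const * det (\<partial>\<partial>\<bar> u\<^sub>\<delta>)\<close>.

The Hessian of \<open>u\<^sub>\<delta>\<close> is the \<open>\<mu>\<close>-average of the Hessians of \<open>1/2 log (q(z, \<eta>) + \<delta>\<^sup>2)\<close> in \<open>z\<close>. Leibniz's formula
and Fubini turn its determinant into the integral over all tuples \<open>(\<eta>\<^sub>l)\<close> of the determinant whose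
row \<open>l\<close> comes from the pole \<open>\<eta>\<^sub>l\<close> (lemma \<open>det_hess_mean\<close>). Let \<open>r\<^sub>l = q(z, \<eta>\<^sub>l)^(1/2)\<close>, comparable to the
distance of \<open>z\<close> from the pole. Two facts bound this mixed determinant. Row \<open>l\<close> has entries of
size \<open>1 / (r\<^sub>l\<^sup>2 + \<delta>\<^sup>2)\<close>. Moreover \<open>log |z - a|\<close> is plurisubharmonic, and harmonic on the complex lines
through \<open>a\<close>, so that its semidefinite Hessian annihilates \<open>z - a\<close>; if all poles lie within \<open>s\<close> of each other, one vector of
length about \<open>r\<close> is therefore nearly annihilated by all rows, and Cramer's rule gains a factor \<open>s / r\<close>.
With \<open>s = \<delta> + (mutual distance of the poles)\<close> the outcome is
\<open>|det| \<le> K * \<Sum>\<^sub>l s / (r\<^sub>l^(2n-2) * (s + r\<^sub>l)^3)\<close>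
(lemma \<open>det_mixed_bound\<close>). By scaling, the right-hand side has an integral over bounded sets that is
bounded independently of \<open>s\<close> and of the poles (lemma \<open>chord_kernel_integral_bound\<close>).

Tuples with mutual distance at least \<open>\<delta>\<close> are thus dominated by the same expression with \<open>\<delta> = 0\<close>, whose
integral over all non-diagonal tuples is a locally integrable function \<open>\<Psi>\<close> of \<open>z\<close>. The remaining tuples
contribute at most a constant times their \<open>\<mu>\<^sup>n\<close>-measure. That measure tends to the measure of the diagonal,
which is \<open>0\<close> because \<open>\<mu>\<close> has no atoms and \<open>n \<ge> 2\<close>. Hence the Monge--Ampere measure is at most a constant
times \<open>\<Psi>\<close> times Lebesgue measure on bounded sets (lemma \<open>MA_compact_bound\<close>). Finally the density of
\<open>\<omega>\<^sup>n\<close> is positive and chart changes preserve null sets, so null sets for \<open>\<omega>\<^sup>n\<close> are Lebesgue null in every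
affine chart.\<close>

section \<open>Smooth families and differentiation under the integral\<close>

text \<open>Families \<open>f x p\<close> that are smooth in \<open>x\<close> with bounds uniform in the parameter \<open>p\<close>, described by the
  operations that build them rather than by analytic conditions: the class is then visibly closed under
  differentiation in \<open>x\<close>, and all derivatives of a parameter integral are handled by one induction. The lower
  bounds in the last two rules keep \<open>1 / f\<close> and \<open>ln f\<close> bounded on compact sets uniformly in \<open>p\<close>.\<close>

inductive smooth_family ::
  "(complex^'n) set \<Rightarrow> 'p measure \<Rightarrow> (complex^'n \<Rightarrow> 'p \<Rightarrow> complex) \<Rightarrow> bool"
  for X M where
  const: "c \<in> borel_measurable M \<Longrightarrow> (\<And>p. p \<in> space M \<Longrightarrow> cmod (c p) \<le> B) \<Longrightarrow>
    smooth_family X M (\<lambda>x p. c p)"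
| coord: "smooth_family X M (\<lambda>x p. x $ i)"
| cnj: "smooth_family X M f \<Longrightarrow> smooth_family X M (\<lambda>x p. cnj (f x p))"
| add: "smooth_family X M f \<Longrightarrow> smooth_family X M g \<Longrightarrow> smooth_family X M (\<lambda>x p. f x p + g x p)"
| mult: "smooth_family X M f \<Longrightarrow> smooth_family X M g \<Longrightarrow> smooth_family X M (\<lambda>x p. f x p * g x p)"
| inverse: "smooth_family X M f \<Longrightarrow>
    (\<And>C. compact C \<Longrightarrow> C \<subseteq> X \<Longrightarrow> \<exists>m>0. \<forall>x\<in>C. \<forall>p\<in>space M. m \<le> cmod (f x p)) \<Longrightarrow>
    smooth_family X M (\<lambda>x p. inverse (f x p))"
| ln: "smooth_family X M f \<Longrightarrow>
    (\<And>C. compact C \<Longrightarrow> C \<subseteq> X \<Longrightarrow> \<exists>m>0. \<forall>x\<in>C. \<forall>p\<in>space M. m \<le> Re (f x p)) \<Longrightarrow>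
    smooth_family X M (\<lambda>x p. of_real (ln (Re (f x p))))"

lemma smooth_family_const [intro]: "smooth_family X M (\<lambda>x p. c)"
  by (rule smooth_family.const[where B = "cmod c"]) auto

lemma smooth_family_uminus: "smooth_family X M f \<Longrightarrow> smooth_family X M (\<lambda>x p. - f x p)"
  using smooth_family.mult[OF smooth_family_const[of X M "-1"], of f] by simp

lemma smooth_family_diff:
  "smooth_family X M f \<Longrightarrow> smooth_family X M g \<Longrightarrow> smooth_family X M (\<lambda>x p. f x p - g x p)"
  using smooth_family.add[OF _ smooth_family_uminus, of X M f g] by simp

lemma smooth_family_sum:
  assumes "\<And>i. i \<in> I \<Longrightarrow> smooth_family X M (f i)"
  shows "smooth_family X M (\<lambda>x p. \<Sum>i\<in>I. f i x p)"
  using assms by (induction I rule: infinite_finite_induct) (auto intro: smooth_family.add)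

lemma smooth_family_Re:
  assumes "smooth_family X M f"
  shows "smooth_family X M (\<lambda>x p. of_real (Re (f x p)))"
proof -
  have "smooth_family X M (\<lambda>x p. (1/2) * (f x p + cnj (f x p)))"
    by (intro smooth_family.mult smooth_family.add smooth_family.cnj smooth_family_const assms)
  also have "(\<lambda>x p. (1/2) * (f x p + cnj (f x p))) = (\<lambda>x p. of_real (Re (f x p)))"
    by (simp add: complex_add_cnj)
  finally show ?thesis .
qed

lemma smooth_family_measurable:
  fixes X :: "(complex^'n) set"
  assumes "smooth_family X M f"
  shows "(\<lambda>(x, p). f x p) \<in> borel_measurable (borel \<Otimes>\<^sub>M M)"
  using assms
proof induction
  case (coord i)
  have "(\<lambda>x::complex^'n. x $ i) \<in> borel_measurable borel"
    by (intro borel_measurable_continuous_onI continuous_intros)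
  then show ?case by simp
next
  case (cnj f)
  have "cnj \<in> borel_measurable borel"
    by (intro borel_measurable_continuous_onI continuous_intros)
  with cnj show ?case
    by (auto simp: split_beta' intro: measurable_compose)
qed (auto simp: split_beta')

lemma smooth_family_bounded:
  assumes "smooth_family X M f" "compact C" "C \<subseteq> X"
  shows "\<exists>B>0. \<forall>x\<in>C. \<forall>p\<in>space M. cmod (f x p) \<le> B"
  using assms(1)
proof induction
  case (const c B)
  then have "\<forall>x\<in>C. \<forall>p\<in>space M. cmod (c p) \<le> max B 1"
    by fastforce
  then show ?case by (intro exI[of _ "max B 1"]) simp
next
  case (coord i)
  obtain B where "\<forall>x\<in>C. norm x \<le> B" using compact_imp_bounded[OF assms(2)]
    by (auto simp: bounded_iff)
  then have "\<forall>x\<in>C. cmod (x $ i) \<le> max B 1"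
    by (meson Finite_Cartesian_Product.norm_nth_le max.coboundedI1 order_trans)
  then show ?case by (intro exI[of _ "max B 1"]) simp
next
  case (cnj f)
  then show ?case by simp
next
  case (add f g)
  then obtain A B where "A > 0" "B > 0" "\<forall>x\<in>C. \<forall>p\<in>space M. cmod (f x p) \<le> A" 
    "\<forall>x\<in>C. \<forall>p\<in>space M. cmod (g x p) \<le> B" by blast
  then show ?case
    by (intro exI[of _ "A + B"]) (auto intro!: norm_triangle_le add_mono)
next
  case (mult f g)
  then obtain A B where "A > 0" "B > 0" "\<forall>x\<in>C. \<forall>p\<in>space M. cmod (f x p) \<le> A" 
    "\<forall>x\<in>C. \<forall>p\<in>space M. cmod (g x p) \<le> B" by blast
  then show ?case
    by (intro exI[of _ "A * B"]) (auto simp: norm_mult intro!: mult_mono)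
next
  case (inverse f)
  then obtain m where "m > 0" "\<forall>x\<in>C. \<forall>p\<in>space M. m \<le> cmod (f x p)"
    using inverse.hyps(2)[OF assms(2,3)] by blast
  then show ?case
    by (intro exI[of _ "inverse m"]) (auto simp: norm_inverse intro!: le_imp_inverse_le)
next
  case (ln f)
  then obtain m where m: "m > 0" "\<forall>x\<in>C. \<forall>p\<in>space M. m \<le> Re (f x p)"
    using ln.hyps(2)[OF assms(2,3)] by blast
  from ln.IH obtain B where B: "B > 0" "\<forall>x\<in>C. \<forall>p\<in>space M. cmod (f x p) \<le> B" by blast
  have "cmod (of_real (ln (Re (f x p)))) \<le> \<bar>ln m\<bar> + \<bar>ln B\<bar> + 1" if "x \<in> C" "p \<in> space M" for x p
  proof -
    have "m \<le> Re (f x p)" "Re (f x p) \<le> B"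
      using m B that complex_Re_le_cmod[of "f x p"] by (auto intro: order_trans)
    then have "ln m \<le> ln (Re (f x p))" "ln (Re (f x p)) \<le> ln B"
      using m(1) B(1) by auto
    then show ?thesis by simp
  qed
  then show ?case by (intro exI[of _ "\<bar>ln m\<bar> + \<bar>ln B\<bar> + 1"]) simp
qed

text \<open>The derivative of each operation is expressed by operations of the same kind. The family of directional
  derivatives is therefore again a smooth family, and the statement can be iterated.\<close>

lemma smooth_family_derivative:
  fixes X :: "(complex^'n) set"
  assumes "smooth_family X M f"
  shows "\<exists>f'. (\<forall>v. smooth_family X M (f' v)) \<and>
    (\<forall>x\<in>X. \<forall>p\<in>space M. ((\<lambda>x. f x p) has_derivative (\<lambda>v. f' v x p)) (at x))"
  using assms
proof induction
  case (const c B)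
  then show ?case by (intro exI[of _ "\<lambda>v x p. 0"]) auto
next
  case (coord i)
  have "((\<lambda>x. x $ i) has_derivative (\<lambda>v. v $ i)) (at x)" for x :: "complex^'n"
    by (rule bounded_linear_imp_has_derivative[OF bounded_linear_vec_nth])
  then show ?case by (intro exI[of _ "\<lambda>v x p. v $ i"]) auto
next
  case (cnj f)
  then obtain f' where "\<forall>v. smooth_family X M (f' v)"
    "\<forall>x\<in>X. \<forall>p\<in>space M. ((\<lambda>x. f x p) has_derivative (\<lambda>v. f' v x p)) (at x)" by blast
  then show ?case
    by (intro exI[of _ "\<lambda>v x p. cnj (f' v x p)"])
      (auto intro: smooth_family.cnj bounded_linear.has_derivative[OF bounded_linear_cnj])
next
  case (add f g)
  then obtain f' g' where "\<forall>v. smooth_family X M (f' v)"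
    "\<forall>x\<in>X. \<forall>p\<in>space M. ((\<lambda>x. f x p) has_derivative (\<lambda>v. f' v x p)) (at x)"
    "\<forall>v. smooth_family X M (g' v)"
    "\<forall>x\<in>X. \<forall>p\<in>space M. ((\<lambda>x. g x p) has_derivative (\<lambda>v. g' v x p)) (at x)" by blast
  then show ?case
    by (intro exI[of _ "\<lambda>v x p. f' v x p + g' v x p"])
      (auto intro: smooth_family.add has_derivative_add)
next
  case (mult f g)
  then obtain f' g' where "\<forall>v. smooth_family X M (f' v)"
    "\<forall>x\<in>X. \<forall>p\<in>space M. ((\<lambda>x. f x p) has_derivative (\<lambda>v. f' v x p)) (at x)"
    "\<forall>v. smooth_family X M (g' v)"
    "\<forall>x\<in>X. \<forall>p\<in>space M. ((\<lambda>x. g x p) has_derivative (\<lambda>v. g' v x p)) (at x)" by blast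
  with mult show ?case
    by (intro exI[of _ "\<lambda>v x p. f x p * g' v x p + f' v x p * g x p"])
      (auto intro!: smooth_family.add smooth_family.mult has_derivative_mult)
next
  case (inverse f)
  then obtain f' where f': "\<forall>v. smooth_family X M (f' v)"
    "\<forall>x\<in>X. \<forall>p\<in>space M. ((\<lambda>x. f x p) has_derivative (\<lambda>v. f' v x p)) (at x)" by blast
  have nz: "f x p \<noteq> 0" if "x \<in> X" "p \<in> space M" for x p
    using inverse.hyps(2)[of "{x}"] that by force
  have si: "smooth_family X M (\<lambda>x p. inverse (f x p))"
    using inverse.hyps by (rule smooth_family.inverse)
  show ?case
  proof (intro exI[of _ "\<lambda>v x p. - (inverse (f x p) * f' v x p * inverse (f x p))"] conjI allI ballI)
    fix v
    show "smooth_family X M (\<lambda>x p. - (inverse (f x p) * f' v x p * inverse (f x p)))"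
      by (intro smooth_family_uminus smooth_family.mult si) (use f' in auto)
  next
    fix x p assume xp: "x \<in> X" "p \<in> space M"
    show "((\<lambda>x. inverse (f x p)) has_derivative
        (\<lambda>v. - (inverse (f x p) * f' v x p * inverse (f x p)))) (at x)"
      by (rule Deriv.has_derivative_inverse) (use nz[OF xp] f' xp in auto)
  qed
next
  case (ln f)
  then obtain f' where f': "\<forall>v. smooth_family X M (f' v)"
    "\<forall>x\<in>X. \<forall>p\<in>space M. ((\<lambda>x. f x p) has_derivative (\<lambda>v. f' v x p)) (at x)" by blast
  have nz: "Re (f x p) > 0" if "x \<in> X" "p \<in> space M" for x p
    using ln.hyps(2)[of "{x}"] that by force
  have si: "smooth_family X M (\<lambda>x p. inverse (of_real (Re (f x p))))"
  proof (rule smooth_family.inverse)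
    show "smooth_family X M (\<lambda>x p. complex_of_real (Re (f x p)))"
      by (rule smooth_family_Re) (rule ln.hyps)
    fix C assume "compact C" "C \<subseteq> X"
    from ln.hyps(2)[OF this] obtain m where "m > 0" "\<forall>x\<in>C. \<forall>p\<in>space M. m \<le> Re (f x p)" by blast
    then show "\<exists>m>0. \<forall>x\<in>C. \<forall>p\<in>space M. m \<le> cmod (complex_of_real (Re (f x p)))"
      by (intro exI[of _ m]) force
  qed
  show ?case
  proof (intro exI[of _ "\<lambda>v x p. inverse (of_real (Re (f x p))) * of_real (Re (f' v x p))"] conjI allI ballI)
    fix v
    show "smooth_family X M (\<lambda>x p. inverse (of_real (Re (f x p))) * of_real (Re (f' v x p)))"
      by (intro smooth_family.mult si smooth_family_Re) (use f' in auto)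
  next
    fix x p assume xp: "x \<in> X" "p \<in> space M"
    have "((\<lambda>x. Re (f x p)) has_derivative (\<lambda>v. Re (f' v x p))) (at x)"
      by (rule bounded_linear.has_derivative[OF bounded_linear_Re]) (use f' xp in auto)
    then have "((\<lambda>x. ln (Re (f x p))) has_derivative (\<lambda>v. Re (f' v x p) * inverse (Re (f x p)))) (at x)"
      using nz[OF xp] by (intro has_derivative_ln)
    then have "((\<lambda>x. complex_of_real (ln (Re (f x p)))) has_derivative
       (\<lambda>v. of_real (Re (f' v x p) * inverse (Re (f x p))))) (at x)"
      by (rule bounded_linear.has_derivative[OF bounded_linear_of_real])
    then show "((\<lambda>x. complex_of_real (ln (Re (f x p)))) has_derivative
       (\<lambda>v. inverse (of_real (Re (f x p))) * of_real (Re (f' v x p)))) (at x)"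
      by (simp add: mult.commute)
  qed
qed

lemma bounded_linear_expand_norm:
  fixes D :: "complex^'n \<Rightarrow> complex"
  assumes "bounded_linear D" "\<And>b. b \<in> Basis \<Longrightarrow> cmod (D b) \<le> K b"
  shows "cmod (D v) \<le> (\<Sum>b\<in>Basis. K b) * norm v"
proof -
  interpret bounded_linear D by fact
  have "D v = D (\<Sum>b\<in>Basis. (v \<bullet> b) *\<^sub>R b)"
    by (simp add: euclidean_representation)
  also have "\<dots> = (\<Sum>b\<in>Basis. (v \<bullet> b) *\<^sub>R D b)"
    by (simp add: sum scaleR)
  also have "cmod \<dots> \<le> (\<Sum>b\<in>Basis. \<bar>v \<bullet> b\<bar> * cmod (D b))"
    by (rule order_trans[OF norm_sum]) simp
  also have "\<dots> \<le> (\<Sum>b\<in>Basis. norm v * K b)"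
    by (intro sum_mono mult_mono assms) (auto simp: Basis_le_norm)
  finally show ?thesis by (simp add: sum_distrib_left mult.commute)
qed

text \<open>The directional derivatives form smooth families, so they are bounded on the ball uniformly in \<open>p\<close>.\<close>

lemma smooth_family_lipschitz:
  assumes f: "smooth_family X M f" and C: "cball x0 r \<subseteq> X" "r > 0"
  shows "\<exists>K\<ge>0. \<forall>x\<in>cball x0 r. \<forall>p\<in>space M. cmod (f x p - f x0 p) \<le> K * norm (x - x0)"
proof -
  obtain f' where f': "\<And>v. smooth_family X M (f' v)"
    "\<And>x p. x \<in> X \<Longrightarrow> p \<in> space M \<Longrightarrow> ((\<lambda>x. f x p) has_derivative (\<lambda>v. f' v x p)) (at x)"
    using smooth_family_derivative[OF f] by blast
  have "\<forall>b. \<exists>B>0. \<forall>x\<in>cball x0 r. \<forall>p\<in>space M. cmod (f' b x p) \<le> B"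
    using smooth_family_bounded[OF f'(1) compact_cball C(1)] by blast
  then obtain B where B: "\<And>b. B b > 0" "\<And>b x p. x \<in> cball x0 r \<Longrightarrow> p\<in>space M \<Longrightarrow> cmod (f' b x p) \<le> B b"
    by metis
  define K where "K = (\<Sum>b\<in>Basis. B b)"
  have "cmod (f x p - f x0 p) \<le> K * norm (x - x0)" if x: "x \<in> cball x0 r" and p: "p \<in> space M" for x p
  proof (rule differentiable_bound[where f' = "\<lambda>x v. f' v x p" and S = "cball x0 r"])
    fix y assume y: "y \<in> cball x0 r"
    then have y': "y \<in> X" using C by auto
    show "((\<lambda>x. f x p) has_derivative (\<lambda>v. f' v y p)) (at y within cball x0 r)"
      using f'(2)[OF y' p] by (rule has_derivative_at_withinI)
    have bl: "bounded_linear (\<lambda>v. f' v y p)"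
      using f'(2)[OF y' p] by (rule has_derivative_bounded_linear)
    show "onorm (\<lambda>v. f' v y p) \<le> K"
      unfolding K_def by (rule onorm_le) (intro bounded_linear_expand_norm bl B y p)
  qed (use x C in auto)
  moreover have "K \<ge> 0" unfolding K_def using B(1) by (intro sum_nonneg) (auto intro: less_imp_le)
  ultimately show ?thesis by blast
qed

lemma smooth_family_integrable:
  assumes "smooth_family X M f" "finite_measure M" "x \<in> X"
  shows "integrable M (f x)"
proof -
  interpret finite_measure M by fact
  obtain B where B: "\<forall>p\<in>space M. cmod (f x p) \<le> B"
    using smooth_family_bounded[OF assms(1), of "{x}"] assms(3) by auto
  have "f x \<in> borel_measurable M"
    using measurable_compose[OF measurable_Pair1' smooth_family_measurable[OF assms(1)], of x] by simp
  then show ?thesis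
    by (intro integrable_const_bound[where B = B]) (use B in auto)
qed

text \<open>The derivative is Lipschitz uniformly in the parameter, so the first-order Taylor error is at
  most a constant times \<open>|x - x\<^sub>0|\<^sup>2\<close>, with the same constant for all parameters; this bound can be integrated.\<close>

lemma smooth_family_integral_has_derivative:
  assumes f: "smooth_family X M f" and M: "finite_measure M" and X: "open X" "x0 \<in> X"
    and f': "\<And>v. smooth_family X M (f' v)"
    "\<And>x p. x \<in> X \<Longrightarrow> p \<in> space M \<Longrightarrow> ((\<lambda>x. f x p) has_derivative (\<lambda>v. f' v x p)) (at x)"
  shows "((\<lambda>x. \<integral>p. f x p \<partial>M) has_derivative (\<lambda>v. \<integral>p. f' v x0 p \<partial>M)) (at x0)"
proof -
  interpret finite_measure M by fact
  obtain r where r: "r > 0" "cball x0 r \<subseteq> X" using X open_contains_cball by blast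
  have "\<forall>b. \<exists>K\<ge>0. \<forall>x\<in>cball x0 r. \<forall>p\<in>space M. cmod (f' b x p - f' b x0 p) \<le> K * norm (x - x0)"
    using smooth_family_lipschitz[OF f'(1) r(2,1)] by blast
  then obtain B where B: "\<And>b. B b \<ge> 0"
    "\<And>b x p. x \<in> cball x0 r \<Longrightarrow> p\<in>space M \<Longrightarrow> cmod (f' b x p - f' b x0 p) \<le> B b * norm (x - x0)"
    by metis
  define K where "K = (\<Sum>b\<in>Basis. B b)"
  have K: "K \<ge> 0" unfolding K_def using B(1) by (intro sum_nonneg) auto
  have bl: "bounded_linear (\<lambda>v. f' v x p)" if "x \<in> X" "p \<in> space M" for x p
    using f'(2)[OF that] by (rule has_derivative_bounded_linear)
  \<comment> \<open>Mean value theorem for \<open>f\<close> minus its linear part, on the ball of radius \<open>|x - x0|\<close>.\<close>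
  have second: "cmod (f x p - f x0 p - f' (x - x0) x0 p) \<le> K * norm (x - x0) * norm (x - x0)"
    if x: "x \<in> cball x0 r" and p: "p \<in> space M" for x p
  proof -
    have "cmod ((f x p - f' (x - x0) x0 p) - (f x0 p - f' (x0 - x0) x0 p)) \<le> K * norm (x - x0) * norm (x - x0)"
    proof (rule differentiable_bound[where f' = "\<lambda>y v. f' v y p - f' v x0 p" and S = "cball x0 (norm (x - x0))"])
      fix y assume y: "y \<in> cball x0 (norm (x - x0))"
      then have yr: "y \<in> cball x0 r" using x by (auto simp: dist_norm norm_minus_commute)
      then have y': "y \<in> X" using r by auto
      interpret b0: bounded_linear "\<lambda>v. f' v x0 p" using bl X(2) p by auto
      have "((\<lambda>y. f' (y - x0) x0 p) has_derivative (\<lambda>v. f' v x0 p)) (at y)"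
        by (rule b0.has_derivative) (auto intro!: derivative_eq_intros)
      then show "((\<lambda>x. f x p - f' (x - x0) x0 p) has_derivative (\<lambda>v. f' v y p - f' v x0 p))
          (at y within cball x0 (norm (x - x0)))"
        by (intro has_derivative_at_withinI[OF has_derivative_diff[OF f'(2)[OF y' p]]])
      have "bounded_linear (\<lambda>v. f' v y p - f' v x0 p)"
        by (intro bounded_linear_sub bl y' X(2) p)
      then have 1: "cmod (f' v y p - f' v x0 p) \<le> (\<Sum>b\<in>Basis. B b * norm (y - x0)) * norm v" for v
        by (rule bounded_linear_expand_norm) (rule B(2)[OF yr p])
      have 2: "(\<Sum>b\<in>Basis. B b * norm (y - x0)) = K * norm (y - x0)"
        unfolding K_def by (rule sum_distrib_right[symmetric])
      have 3: "K * norm (y - x0) \<le> K * norm (x - x0)"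
        using y K by (intro mult_left_mono) (auto simp: dist_norm norm_minus_commute)
      have "cmod (f' v y p - f' v x0 p) \<le> K * norm (x - x0) * norm v" for v
        using 1[of v] mult_right_mono[OF 3 norm_ge_zero[of v]] unfolding 2 by linarith
      then show "onorm (\<lambda>v. f' v y p - f' v x0 p) \<le> K * norm (x - x0)"
        by (rule onorm_le)
    qed (auto simp: dist_norm norm_minus_commute)
    moreover have "f' 0 x0 p = 0"
      by (rule linear_0[OF bounded_linear.linear[OF bl[OF X(2) p]]])
    ultimately show ?thesis by (simp add: diff_diff_eq add.commute)
  qed
  have int: "integrable M (\<lambda>p. f x p)" "integrable M (\<lambda>p. f' v x p)" if "x \<in> X" for x v
    using smooth_family_integrable[OF f M that] smooth_family_integrable[OF f'(1) M that] by auto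
  have D: "bounded_linear (\<lambda>v. \<integral>p. f' v x0 p \<partial>M)"
  proof (intro linear_conv_bounded_linear[THEN iffD1] linearI)
    fix u v
    have "(\<integral>p. f' (u + v) x0 p \<partial>M) = (\<integral>p. f' u x0 p + f' v x0 p \<partial>M)"
      by (intro Bochner_Integration.integral_cong) (auto simp: linear_add[OF bounded_linear.linear[OF bl[OF X(2)]]])
    then show "(\<integral>p. f' (u + v) x0 p \<partial>M) = (\<integral>p. f' u x0 p \<partial>M) + (\<integral>p. f' v x0 p \<partial>M)"
      using int X(2) by simp
  next
    fix c :: real and v
    have "(\<integral>p. f' (c *\<^sub>R v) x0 p \<partial>M) = (\<integral>p. c *\<^sub>R f' v x0 p \<partial>M)"
      by (intro Bochner_Integration.integral_cong) (auto simp: linear_cmul[OF bounded_linear.linear[OF bl[OF X(2)]]])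
    then show "(\<integral>p. f' (c *\<^sub>R v) x0 p \<partial>M) = c *\<^sub>R (\<integral>p. f' v x0 p \<partial>M)" by simp
  qed
  show ?thesis
  proof (rule has_derivativeI_sandwich[where H = "\<lambda>x. K * measure M (space M) * norm (x - x0)" and e = r])
    fix x assume "x \<noteq> x0" "dist x x0 < r"
    then have x: "x \<in> cball x0 r" "x \<in> X" using r by (auto simp: dist_commute)
    have "norm ((\<integral>p. f x p \<partial>M) - (\<integral>p. f x0 p \<partial>M) - (\<integral>p. f' (x - x0) x0 p \<partial>M))
        = norm (\<integral>p. f x p - f x0 p - f' (x - x0) x0 p \<partial>M)"
      using int x X by simp
    also have "\<dots> \<le> (\<integral>p. K * norm (x - x0) * norm (x - x0) \<partial>M)"
      by (rule order_trans[OF integral_norm_bound], rule integral_mono)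
        (use int x X second[OF x(1)] in auto)
    also have "\<dots> = K * measure M (space M) * norm (x - x0) * norm (x - x0)" by simp
    finally show "norm ((\<integral>p. f x p \<partial>M) - (\<integral>p. f x0 p \<partial>M) - (\<integral>p. f' (x - x0) x0 p \<partial>M)) / norm (x - x0)
      \<le> K * measure M (space M) * norm (x - x0)"
      using \<open>x \<noteq> x0\<close> by (simp add: divide_le_eq)
  next
    show "(\<lambda>x. K * measure M (space M) * norm (x - x0)) \<midarrow>x0\<rightarrow> 0"
      by (auto intro!: tendsto_eq_intros)
  qed (use r D in auto)
qed

lemma Ck_on_cong:
  assumes "open S" "\<And>x. x \<in> S \<Longrightarrow> f x = g x" "Ck_on k f S"
  shows "Ck_on k g S"
  using assms(2,3)
proof (induction k arbitrary: f g)
  case 0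
  then show ?case using continuous_on_cong[of S S f g] by simp
next
  case (Suc k)
  have der: "(g has_derivative D) (at x)" if "x \<in> S" "(f has_derivative D) (at x)" for x D
    using has_derivative_transform_within_open[OF that(2) assms(1) that(1)] Suc.prems(1) by simp
  have d: "f differentiable (at x)" if "x \<in> S" for x
    using Suc.prems that by simp
  have eq: "frechet_derivative f (at x) v = frechet_derivative g (at x) v" if "x \<in> S" for x v
    using der[OF that d[OF that, unfolded frechet_derivative_works]]
    by (metis frechet_derivative_at)
  have "Ck_on k (\<lambda>x. frechet_derivative g (at x) v) S" for v
    by (rule Suc.IH[of "\<lambda>x. frechet_derivative f (at x) v"]) (use eq Suc.prems in auto)
  moreover have "g differentiable (at x)" if "x \<in> S" for x
    using der[OF that] d[OF that] by (meson differentiable_def)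
  ultimately show ?case by simp
qed

lemma Ck_on_Re:
  assumes "open S" "Ck_on k f S"
  shows "Ck_on k (\<lambda>x. Re (f x)) S"
  using assms(2)
proof (induction k arbitrary: f)
  case 0
  then show ?case by (simp add: continuous_on_Re)
next
  case (Suc k)
  have d: "f differentiable (at x)" if "x \<in> S" for x
    using Suc.prems that by simp
  have der: "((\<lambda>x. Re (f x)) has_derivative (\<lambda>v. Re (frechet_derivative f (at x) v))) (at x)" if "x \<in> S" for x
    using d[OF that, unfolded frechet_derivative_works]
    by (rule bounded_linear.has_derivative[OF bounded_linear_Re])
  have "Ck_on k (\<lambda>x. frechet_derivative (\<lambda>x. Re (f x)) (at x) v) S" for v
    by (rule Ck_on_cong[OF assms(1), of "\<lambda>x. Re (frechet_derivative f (at x) v)"])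
      (use Suc in \<open>auto simp flip: frechet_derivative_at[OF der]\<close>)
  with der show ?case by (auto simp: differentiable_def)
qed

lemma smooth_family_integral_Ck:
  assumes "open X" "finite_measure M" "smooth_family X M f"
  shows "Ck_on k (\<lambda>x. \<integral>p. f x p \<partial>M) X"
  using assms(3)
proof (induction k arbitrary: f)
  case (0 f)
  obtain f' where f': "\<And>v. smooth_family X M (f' v)"
    "\<And>x p. x \<in> X \<Longrightarrow> p \<in> space M \<Longrightarrow> ((\<lambda>x. f x p) has_derivative (\<lambda>v. f' v x p)) (at x)"
    using smooth_family_derivative[OF 0] by blast
  then show ?case
    using smooth_family_integral_has_derivative[OF 0 assms(2,1)]
    by (force intro!: continuous_at_imp_continuous_on has_derivative_continuous)
next
  case (Suc k f)
  obtain f' where f': "\<And>v. smooth_family X M (f' v)"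
    "\<And>x p. x \<in> X \<Longrightarrow> p \<in> space M \<Longrightarrow> ((\<lambda>x. f x p) has_derivative (\<lambda>v. f' v x p)) (at x)"
    using smooth_family_derivative[OF Suc.prems] by blast
  have der: "((\<lambda>x. \<integral>p. f x p \<partial>M) has_derivative (\<lambda>v. \<integral>p. f' v x p \<partial>M)) (at x)" if "x \<in> X" for x
    by (rule smooth_family_integral_has_derivative[OF Suc.prems assms(2,1) that f'])
  have "Ck_on k (\<lambda>x. frechet_derivative (\<lambda>x. \<integral>p. f x p \<partial>M) (at x) v) X" for v
    by (rule Ck_on_cong[OF assms(1) _ Suc.IH[OF f'(1)[of v]]])
      (use frechet_derivative_at[OF der] in metis)
  with der show ?case by (auto simp: differentiable_def)
qed

lemma smooth_family_integral_smooth_on: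
  assumes "open X" "finite_measure M" "smooth_family X M f"
  shows "smooth_on X (\<lambda>x. Re (\<integral>p. f x p \<partial>M))"
  unfolding smooth_on_def
  by (intro allI Ck_on_Re smooth_family_integral_Ck assms)

section \<open>Complex Hessians of logarithms of Hermitian forms\<close>

text \<open>When the real derivative is written in terms of \<open>v\<^sub>j\<close> and their conjugates, the coefficients are the
  Wirtinger derivatives.\<close>

lemma partial_of_has_derivative:
  assumes "(f has_derivative (\<lambda>v. \<Sum>j\<in>UNIV. a j * v $ j + b j * cnj (v $ j))) (at (z::complex^'n))"
  shows "partial_z j f z = a j" "partial_zbar j f z = b j"
proof -
  have "frechet_derivative f (at z) = (\<lambda>v. \<Sum>j\<in>UNIV. a j * v $ j + b j * cnj (v $ j))"
    using frechet_derivative_at[OF assms] by simp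
  moreover have "(\<Sum>i\<in>UNIV. a i * axis j c $ i + b i * cnj (axis j c $ i)) = a j * c + b j * cnj c" for c
  proof -
    have "(\<Sum>i\<in>UNIV. a i * axis j c $ i + b i * cnj (axis j c $ i)) =
        (\<Sum>i\<in>UNIV. if i = j then a j * c + b j * cnj c else 0)"
      by (intro sum.cong) (auto simp: axis_def)
    then show ?thesis by simp
  qed
  ultimately show "partial_z j f z = a j" "partial_zbar j f z = b j"
    unfolding partial_z_def partial_zbar_def by (auto simp: algebra_simps)
qed

lemma smooth_family_integral_wirtinger:
  fixes X :: "(complex^'n) set"
  assumes f: "smooth_family X M f" and M: "finite_measure M" and X: "open X" "x \<in> X"
    and ab: "\<And>j. smooth_family X M (a j)" "\<And>j. smooth_family X M (b j)"
    and der: "\<And>x p. x \<in> X \<Longrightarrow> p \<in> space M \<Longrightarrow> ((\<lambda>x. f x p) has_derivative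
      (\<lambda>v. \<Sum>j\<in>UNIV. a j x p * v $ j + b j x p * cnj (v $ j))) (at x)"
  shows "((\<lambda>x. \<integral>p. f x p \<partial>M) has_derivative
      (\<lambda>v. \<Sum>j\<in>UNIV. (\<integral>p. a j x p \<partial>M) * v $ j + (\<integral>p. b j x p \<partial>M) * cnj (v $ j))) (at x)"
proof -
  have "((\<lambda>x. \<integral>p. f x p \<partial>M) has_derivative
      (\<lambda>v. \<integral>p. (\<Sum>j\<in>UNIV. a j x p * v $ j + b j x p * cnj (v $ j)) \<partial>M)) (at x)"
    by (rule smooth_family_integral_has_derivative[OF f M X _ der])
      (intro smooth_family_sum smooth_family.add smooth_family.mult ab smooth_family_const)
  moreover have "integrable M (a j x)" "integrable M (b j x)" for j
    using ab smooth_family_integrable[OF _ M X(2)] by auto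
  ultimately show ?thesis by simp
qed

text \<open>The inverse of \<open>skip_index k\<close> on the indices other than \<open>k\<close>; its value at \<open>k\<close> carries no meaning.\<close>

definition drop_index :: "'n option \<Rightarrow> 'n option \<Rightarrow> 'n" where
  "drop_index k i = (case i of None \<Rightarrow> the k | Some j \<Rightarrow> j)"

lemma skip_index_neq: "skip_index k j \<noteq> k"
  by (auto simp: skip_index_def)

lemma drop_skip_index [simp]: "drop_index k (skip_index k j) = j"
  by (auto simp: skip_index_def drop_index_def)

lemma skip_drop_index: "i \<noteq> k \<Longrightarrow> skip_index k (drop_index k i) = i"
  by (auto simp: skip_index_def drop_index_def split: option.splits)

lemma sum_skip_index:
  fixes f :: "'n::finite option \<Rightarrow> 'a::comm_monoid_add"
  shows "(\<Sum>i\<in>UNIV. f i) = f k + (\<Sum>j\<in>UNIV. f (skip_index k j))"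
proof -
  have "(\<Sum>i\<in>UNIV. f i) = f k + (\<Sum>i\<in>UNIV - {k}. f i)"
    by (rule sum.remove) auto
  also have "(\<Sum>i\<in>UNIV - {k}. f i) = (\<Sum>j\<in>UNIV. f (skip_index k j))"
    by (rule sum.reindex_bij_witness[of _ "skip_index k" "drop_index k"])
      (auto simp: skip_drop_index skip_index_neq)
  finally show ?thesis .
qed

text \<open>Homogeneous coordinates of the point with affine coordinates \<open>z\<close>, normalised to \<open>1\<close> in position \<open>k\<close>.\<close>

definition affine_lift :: "'n::finite option \<Rightarrow> complex^'n \<Rightarrow> complex^('n option)" where
  "affine_lift k z = (\<chi> i. if i = k then 1 else z $ drop_index k i)"

definition linear_lift :: "'n::finite option \<Rightarrow> complex^'n \<Rightarrow> complex^('n option)" where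
  "linear_lift k v = (\<chi> i. if i = k then 0 else v $ drop_index k i)"

lemma affine_lift_same [simp]: "affine_lift k z $ k = 1"
  and affine_lift_skip [simp]: "affine_lift k z $ skip_index k j = z $ j"
  and linear_lift_same [simp]: "linear_lift k z $ k = 0"
  and linear_lift_skip [simp]: "linear_lift k z $ skip_index k j = z $ j"
  by (auto simp: affine_lift_def linear_lift_def skip_index_neq)

lemma affine_lift_has_derivative:
  "((\<lambda>z. affine_lift k z $ i) has_derivative (\<lambda>v. linear_lift k v $ i)) (at z)"
proof (cases "i = k")
  case False
  have "((\<lambda>z. z $ drop_index k i) has_derivative (\<lambda>v. v $ drop_index k i)) (at z)"
    by (rule bounded_linear_imp_has_derivative[OF bounded_linear_vec_nth])
  with False show ?thesis by (simp add: affine_lift_def linear_lift_def)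
qed simp

lemma norm_affine_lift: "(norm (affine_lift k z))\<^sup>2 = 1 + (norm z)\<^sup>2"
proof -
  have n: "(norm x)\<^sup>2 = (\<Sum>i\<in>UNIV. (cmod (x $ i))\<^sup>2)" for x :: "complex^'m"
    unfolding norm_vec_def L2_set_def by (simp add: sum_nonneg)
  show ?thesis unfolding n by (subst sum_skip_index[of _ k]) simp
qed

lemma affine_lift_nonzero: "affine_lift k z \<noteq> 0"
  using affine_lift_same[of k z] by (metis zero_index zero_neq_one)

lemma smooth_family_affine_lift: "smooth_family X M (\<lambda>z p. affine_lift k z $ i)"
  by (cases "i = k") (auto simp: affine_lift_def intro: smooth_family.coord smooth_family_const)

text \<open>With \<open>Z = affine_lift k z\<close>, this is \<open>R Z\<close>, and \<open>herm_form\<close> below is \<open>Z\<^sup>* R Z\<close>.\<close>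

definition herm_row :: "'n::finite option \<Rightarrow> ('n option \<Rightarrow> 'n option \<Rightarrow> complex) \<Rightarrow> complex^'n \<Rightarrow> 'n option \<Rightarrow> complex" where
  "herm_row k R z a = (\<Sum>b\<in>UNIV. R a b * affine_lift k z $ b)"

definition herm_form :: "'n::finite option \<Rightarrow> ('n option \<Rightarrow> 'n option \<Rightarrow> complex) \<Rightarrow> complex^'n \<Rightarrow> complex" where
  "herm_form k R z = (\<Sum>a\<in>UNIV. cnj (affine_lift k z $ a) * herm_row k R z a)"

text \<open>The coefficient \<open>\<partial>\<^sub>j \<partial>\<bar>\<^sub>l\<close> of \<open>1/2 log (Z\<^sup>* R Z + \<epsilon>)\<close> for a Hermitian matrix \<open>R\<close>.\<close>

definition log_hessian ::
  "'n::finite option \<Rightarrow> ('n option \<Rightarrow> 'n option \<Rightarrow> complex) \<Rightarrow> real \<Rightarrow> complex^'n \<Rightarrow> 'n \<Rightarrow> 'n \<Rightarrow> complex" where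
  "log_hessian k R \<epsilon> z j l =
     (1/2) * (R (skip_index k l) (skip_index k j) / (herm_form k R z + of_real \<epsilon>)
       - cnj (herm_row k R z (skip_index k j)) * herm_row k R z (skip_index k l)
           / (herm_form k R z + of_real \<epsilon>)\<^sup>2)"

lemma log_hessian_inverse:
  "log_hessian k R \<epsilon> z j l =
     (1/2) * (R (skip_index k l) (skip_index k j) * inverse (herm_form k R z + of_real \<epsilon>)
       - cnj (herm_row k R z (skip_index k j)) * herm_row k R z (skip_index k l)
         * (inverse (herm_form k R z + of_real \<epsilon>) * inverse (herm_form k R z + of_real \<epsilon>)))"
  by (simp only: log_hessian_def divide_inverse power2_eq_square inverse_mult_distrib)

lemma cnj_herm_row:
  assumes "\<And>a b. R a b = cnj (R b a)"
  shows "cnj (herm_row k R z a) = (\<Sum>b\<in>UNIV. cnj (affine_lift k z $ b) * R b a)"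
  unfolding herm_row_def by (subst cnj_sum, rule sum.cong) (auto simp: assms[of _ a] mult.commute)

lemma herm_form_real:
  assumes "\<And>a b. R a b = cnj (R b a)"
  shows "of_real (Re (herm_form k R z)) = herm_form k R z"
proof -
  have "cnj (herm_form k R z) = (\<Sum>a\<in>UNIV. affine_lift k z $ a * (\<Sum>b\<in>UNIV. cnj (affine_lift k z $ b) * R b a))"
    unfolding herm_form_def by (simp add: cnj_herm_row[OF assms])
  also have "\<dots> = (\<Sum>a\<in>UNIV. \<Sum>b\<in>UNIV. cnj (affine_lift k z $ b) * (R b a * affine_lift k z $ a))"
    by (simp add: sum_distrib_left mult_ac)
  also have "\<dots> = herm_form k R z"
    unfolding herm_form_def herm_row_def by (subst sum.swap) (simp add: sum_distrib_left)
  finally show ?thesis by (metis complex_cnj_cancel_iff complex_cnj_complex_of_real complex_is_Real_iff 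
     Reals_cnj_iff of_real_Re)
qed

lemma herm_row_has_derivative:
  "((\<lambda>z. herm_row k R z a) has_derivative (\<lambda>v. \<Sum>j\<in>UNIV. R a (skip_index k j) * v $ j)) (at z)"
proof -
  have "((\<lambda>z. herm_row k R z a) has_derivative (\<lambda>v. \<Sum>b\<in>UNIV. R a b * linear_lift k v $ b)) (at z)"
    unfolding herm_row_def
    by (intro has_derivative_sum has_derivative_mult_right affine_lift_has_derivative)
  then show ?thesis by (subst (asm) sum_skip_index[of _ k]) simp
qed

lemma herm_form_has_derivative:
  fixes R :: "'n::finite option \<Rightarrow> 'n option \<Rightarrow> complex"
  assumes "\<And>a b. R a b = cnj (R b a)"
  shows "(herm_form k R has_derivative (\<lambda>v. \<Sum>j\<in>UNIV.
     cnj (herm_row k R z (skip_index k j)) * v $ j + herm_row k R z (skip_index k j) * cnj (v $ j))) (at z)"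
proof -
  have "(herm_form k R has_derivative (\<lambda>v. \<Sum>a\<in>UNIV. cnj (affine_lift k z $ a) * (\<Sum>j\<in>UNIV. R a (skip_index k j) * v $ j)
      + cnj (linear_lift k v $ a) * herm_row k R z a)) (at z)"
    unfolding herm_form_def
    by (intro has_derivative_sum has_derivative_mult herm_row_has_derivative
      bounded_linear.has_derivative[OF bounded_linear_cnj] affine_lift_has_derivative)
  also have "(\<lambda>v. \<Sum>a\<in>UNIV. cnj (affine_lift k z $ a) * (\<Sum>j\<in>UNIV. R a (skip_index k j) * v $ j)
      + cnj (linear_lift k v $ a) * herm_row k R z a) =
    (\<lambda>v. (\<Sum>j\<in>UNIV. (\<Sum>a\<in>UNIV. cnj (affine_lift k z $ a) * R a (skip_index k j)) * v $ j)
      + (\<Sum>a\<in>UNIV. cnj (linear_lift k v $ a) * herm_row k R z a))"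
  proof (rule ext)
    fix v :: "complex^'n"
    have "(\<Sum>a\<in>UNIV. cnj (affine_lift k z $ a) * (\<Sum>j\<in>UNIV. R a (skip_index k j) * v $ j)) =
      (\<Sum>a\<in>UNIV. \<Sum>j\<in>UNIV. cnj (affine_lift k z $ a) * R a (skip_index k j) * v $ j)"
      by (simp add: sum_distrib_left mult.assoc)
    also have "\<dots> = (\<Sum>j\<in>UNIV. (\<Sum>a\<in>UNIV. cnj (affine_lift k z $ a) * R a (skip_index k j)) * v $ j)"
      by (subst sum.swap) (simp add: sum_distrib_right)
    finally show "(\<Sum>a\<in>UNIV. cnj (affine_lift k z $ a) * (\<Sum>j\<in>UNIV. R a (skip_index k j) * v $ j)
      + cnj (linear_lift k v $ a) * herm_row k R z a) =
      (\<Sum>j\<in>UNIV. (\<Sum>a\<in>UNIV. cnj (affine_lift k z $ a) * R a (skip_index k j)) * v $ j)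
      + (\<Sum>a\<in>UNIV. cnj (linear_lift k v $ a) * herm_row k R z a)"
      by (simp add: sum.distrib)
  qed
  also have "\<dots> = (\<lambda>v. \<Sum>j\<in>UNIV.
     cnj (herm_row k R z (skip_index k j)) * v $ j + herm_row k R z (skip_index k j) * cnj (v $ j))"
  proof (rule ext)
    fix v :: "complex^'n"
    have "(\<Sum>a\<in>UNIV. cnj (linear_lift k v $ a) * herm_row k R z a) =
      (\<Sum>j\<in>UNIV. cnj (v $ j) * herm_row k R z (skip_index k j))"
      by (subst sum_skip_index[of _ k]) simp
    then show "(\<Sum>j\<in>UNIV. (\<Sum>a\<in>UNIV. cnj (affine_lift k z $ a) * R a (skip_index k j)) * v $ j)
      + (\<Sum>a\<in>UNIV. cnj (linear_lift k v $ a) * herm_row k R z a) = (\<Sum>j\<in>UNIV.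
     cnj (herm_row k R z (skip_index k j)) * v $ j + herm_row k R z (skip_index k j) * cnj (v $ j))"
      by (simp add: cnj_herm_row[OF assms] sum.distrib mult.commute)
  qed
  finally show ?thesis .
qed

text \<open>The functions \<open>1/2 log (Z\<^sup>* R\<^sub>p Z + \<epsilon>)\<close> depending on a parameter \<open>p\<close>. Different choices of \<open>R\<close> give the
  regularised projective kernel, the Fubini--Study potential \<open>1/2 log (1 + |z|\<^sup>2)\<close>, and \<open>log |Z\<^sub>i|\<close>.\<close>

locale log_form_family =
  fixes X :: "(complex^'n::finite) set" and M :: "'p measure"
    and R :: "'p \<Rightarrow> 'n option \<Rightarrow> 'n option \<Rightarrow> complex" and k :: "'n option" and \<epsilon> :: real
  assumes open_X: "open X" and finite_M: "finite_measure M"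
    and R_measurable: "\<And>a b. (\<lambda>p. R p a b) \<in> borel_measurable M"
    and R_bounded: "\<And>p a b. p \<in> space M \<Longrightarrow> cmod (R p a b) \<le> 2"
    and R_hermitian: "\<And>p a b. R p a b = cnj (R p b a)"
    and form_pos: "\<And>C. compact C \<Longrightarrow> C \<subseteq> X \<Longrightarrow>
      \<exists>m>0. \<forall>x\<in>C. \<forall>p\<in>space M. m \<le> Re (herm_form k (R p) x) + \<epsilon>"
begin

lemma family_R: "smooth_family X M (\<lambda>z p. R p a b)"
  using R_measurable R_bounded by (rule smooth_family.const)

lemma family_row: "smooth_family X M (\<lambda>z p. herm_row k (R p) z a)"
  unfolding herm_row_def
  by (intro smooth_family_sum smooth_family.mult family_R smooth_family_affine_lift)

lemma family_form: "smooth_family X M (\<lambda>z p. herm_form k (R p) z + of_real \<epsilon>)"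
  unfolding herm_form_def
  by (intro smooth_family_sum smooth_family.mult smooth_family.add smooth_family_const
    smooth_family.cnj family_row smooth_family_affine_lift)

lemma family_inverse: "smooth_family X M (\<lambda>z p. inverse (herm_form k (R p) z + of_real \<epsilon>))"
proof (rule smooth_family.inverse[OF family_form])
  fix C assume "compact C" "C \<subseteq> X"
  from form_pos[OF this] obtain m where m: "m > 0" "\<forall>x\<in>C. \<forall>p\<in>space M. m \<le> Re (herm_form k (R p) x) + \<epsilon>"
    by blast
  have "m \<le> cmod (herm_form k (R p) x + of_real \<epsilon>)" if "x \<in> C" "p \<in> space M" for x p
    using m(2) that complex_Re_le_cmod[of "herm_form k (R p) x + of_real \<epsilon>"] by force
  with m(1) show "\<exists>m>0. \<forall>x\<in>C. \<forall>p\<in>space M. m \<le> cmod (herm_form k (R p) x + of_real \<epsilon>)" by blast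
qed

lemma family_ln: "smooth_family X M (\<lambda>z p. of_real (ln (Re (herm_form k (R p) z) + \<epsilon>) / 2))"
proof -
  have "smooth_family X M (\<lambda>z p. (1/2) * of_real (ln (Re (herm_form k (R p) z + of_real \<epsilon>))))"
    by (intro smooth_family.mult smooth_family_const smooth_family.ln family_form) (use form_pos in simp)
  then show ?thesis by simp
qed

lemma pos: "x \<in> X \<Longrightarrow> p \<in> space M \<Longrightarrow> Re (herm_form k (R p) x) + \<epsilon> > 0"
  using form_pos[of "{x}"] by force

lemma family_hessian: "smooth_family X M (\<lambda>z p. log_hessian k (R p) \<epsilon> z j l)"
  unfolding log_hessian_inverse
  by (intro smooth_family.mult smooth_family_diff smooth_family_const family_R smooth_family.cnj
    family_row family_inverse)

definition potential :: "complex^'n \<Rightarrow> real" where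
  "potential z = Re (\<integral>p. of_real (ln (Re (herm_form k (R p) z) + \<epsilon>) / 2) \<partial>M)"

lemma of_real_potential:
  "complex_of_real (potential z) = (\<integral>p. of_real (ln (Re (herm_form k (R p) z) + \<epsilon>) / 2) \<partial>M)"
  unfolding potential_def integral_complex_of_real Re_complex_of_real ..

lemma potential_eq: "potential z = (\<integral>p. ln (Re (herm_form k (R p) z) + \<epsilon>) / 2 \<partial>M)"
  unfolding potential_def integral_complex_of_real by simp

lemma smooth_potential: "smooth_on X potential"
  unfolding potential_def by (rule smooth_family_integral_smooth_on[OF open_X finite_M family_ln])

lemma potential_has_derivative:
  assumes "x \<in> X"
  shows "((\<lambda>x. of_real (potential x)) has_derivative (\<lambda>v. \<Sum>j\<in>UNIV.
      (\<integral>p. (1/2) * cnj (herm_row k (R p) x (skip_index k j)) * inverse (herm_form k (R p) x + of_real \<epsilon>) \<partial>M) * v $ j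
    + (\<integral>p. (1/2) * herm_row k (R p) x (skip_index k j) * inverse (herm_form k (R p) x + of_real \<epsilon>) \<partial>M) * cnj (v $ j)))
    (at x)"
  unfolding of_real_potential
proof (rule smooth_family_integral_wirtinger[OF family_ln finite_M open_X assms])
  fix y p assume y: "y \<in> X" "p \<in> space M"
  let ?D = "\<lambda>v. \<Sum>j\<in>UNIV. cnj (herm_row k (R p) y (skip_index k j)) * v $ j + herm_row k (R p) y (skip_index k j) * cnj (v $ j)"
  have "((\<lambda>x. Re (herm_form k (R p) x)) has_derivative (\<lambda>v. Re (?D v))) (at y)"
    by (intro bounded_linear.has_derivative[OF bounded_linear_Re] herm_form_has_derivative R_hermitian)
  then have "((\<lambda>x. Re (herm_form k (R p) x) + \<epsilon>) has_derivative (\<lambda>v. Re (?D v))) (at y)"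
    by (rule has_derivative_add_const)
  then have "((\<lambda>x. ln (Re (herm_form k (R p) x) + \<epsilon>)) has_derivative
      (\<lambda>v. Re (?D v) * inverse (Re (herm_form k (R p) y) + \<epsilon>))) (at y)"
    using pos[OF y] by (intro has_derivative_ln)
  then have "((\<lambda>x. complex_of_real (ln (Re (herm_form k (R p) x) + \<epsilon>) / 2)) has_derivative
      (\<lambda>v. of_real (Re (?D v) * inverse (Re (herm_form k (R p) y) + \<epsilon>) / 2))) (at y)"
    by (intro bounded_linear.has_derivative[OF bounded_linear_of_real]
      bounded_linear.has_derivative[OF bounded_linear_divide])
  moreover have "complex_of_real (Re (?D v) * inverse (Re (herm_form k (R p) y) + \<epsilon>) / 2) =
    (\<Sum>j\<in>UNIV. (1/2) * cnj (herm_row k (R p) y (skip_index k j)) * inverse (herm_form k (R p) y + of_real \<epsilon>) * v $ j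
      + (1/2) * herm_row k (R p) y (skip_index k j) * inverse (herm_form k (R p) y + of_real \<epsilon>) * cnj (v $ j))" for v
  proof -
    have "cnj (?D v) = ?D v"
      by (simp only: cnj_sum complex_cnj_add complex_cnj_mult complex_cnj_cnj add.commute)
    then have "of_real (Re (?D v)) = ?D v" by (intro of_real_Re) (simp only: Reals_cnj_iff)
    then have "complex_of_real (Re (?D v) * inverse (Re (herm_form k (R p) y) + \<epsilon>) / 2) =
      ?D v * inverse (herm_form k (R p) y + of_real \<epsilon>) / 2"
      unfolding of_real_mult of_real_divide of_real_inverse of_real_add herm_form_real[OF R_hermitian] by simp
    also have "\<dots> = (\<Sum>j\<in>UNIV. (cnj (herm_row k (R p) y (skip_index k j)) * v $ j + herm_row k (R p) y (skip_index k j) * cnj (v $ j))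
        * inverse (herm_form k (R p) y + of_real \<epsilon>) / 2)"
      by (simp only: sum_distrib_right sum_divide_distrib)
    also have "\<dots> = (\<Sum>j\<in>UNIV. (1/2) * cnj (herm_row k (R p) y (skip_index k j)) * inverse (herm_form k (R p) y + of_real \<epsilon>) * v $ j
      + (1/2) * herm_row k (R p) y (skip_index k j) * inverse (herm_form k (R p) y + of_real \<epsilon>) * cnj (v $ j))"
    proof -
      have "(a * v + b * w) * i / 2 = (1/2) * a * i * v + (1/2) * b * i * w" for a b v w i :: complex
        by (simp add: algebra_simps add_divide_distrib)
      then show ?thesis by (simp only:)
    qed
    finally show ?thesis .
  qed
  ultimately show "((\<lambda>x. complex_of_real (ln (Re (herm_form k (R p) x) + \<epsilon>) / 2)) has_derivative
    (\<lambda>v. \<Sum>j\<in>UNIV. (1/2) * cnj (herm_row k (R p) y (skip_index k j)) * inverse (herm_form k (R p) y + of_real \<epsilon>) * v $ j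
      + (1/2) * herm_row k (R p) y (skip_index k j) * inverse (herm_form k (R p) y + of_real \<epsilon>) * cnj (v $ j))) (at y)"
    by (simp only:)
qed (intro smooth_family.mult smooth_family_const smooth_family.cnj family_row family_inverse)+

lemma partial_zbar_potential:
  assumes "x \<in> X"
  shows "partial_zbar l (\<lambda>x. of_real (potential x)) x =
    (\<integral>p. (1/2) * herm_row k (R p) x (skip_index k l) * inverse (herm_form k (R p) x + of_real \<epsilon>) \<partial>M)"
  by (rule partial_of_has_derivative(2)[OF potential_has_derivative[OF assms]])

lemma partial_zbar_potential_has_derivative:
  assumes x: "x \<in> X"
  shows "(partial_zbar l (\<lambda>x. of_real (potential x)) has_derivative (\<lambda>v. \<Sum>j\<in>UNIV.
      (\<integral>p. log_hessian k (R p) \<epsilon> x j l \<partial>M) * v $ j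
    + (\<integral>p. - (1/2) * herm_row k (R p) x (skip_index k l) * herm_row k (R p) x (skip_index k j)
         * inverse (herm_form k (R p) x + of_real \<epsilon>) * inverse (herm_form k (R p) x + of_real \<epsilon>) \<partial>M) * cnj (v $ j)))
    (at x)"
proof (rule has_derivative_transform_within_open[OF _ open_X x partial_zbar_potential[symmetric]])
  show "((\<lambda>x. \<integral>p. (1/2) * herm_row k (R p) x (skip_index k l) * inverse (herm_form k (R p) x + of_real \<epsilon>) \<partial>M)
    has_derivative (\<lambda>v. \<Sum>j\<in>UNIV.
      (\<integral>p. log_hessian k (R p) \<epsilon> x j l \<partial>M) * v $ j
    + (\<integral>p. - (1/2) * herm_row k (R p) x (skip_index k l) * herm_row k (R p) x (skip_index k j)
         * inverse (herm_form k (R p) x + of_real \<epsilon>) * inverse (herm_form k (R p) x + of_real \<epsilon>) \<partial>M) * cnj (v $ j)))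
    (at x)"
  proof (rule smooth_family_integral_wirtinger[OF _ finite_M open_X x family_hessian])
    fix y p assume y: "y \<in> X" "p \<in> space M"
    let ?D = "\<lambda>v. \<Sum>j\<in>UNIV. cnj (herm_row k (R p) y (skip_index k j)) * v $ j + herm_row k (R p) y (skip_index k j) * cnj (v $ j)"
    let ?i = "inverse (herm_form k (R p) y + of_real \<epsilon>)"
    have nz: "herm_form k (R p) y + of_real \<epsilon> \<noteq> 0"
      using pos[OF y] by (metis add.commute less_irrefl plus_complex.sel(1) Re_complex_of_real zero_complex.sel(1))
    have "((\<lambda>x. herm_form k (R p) x + of_real \<epsilon>) has_derivative ?D) (at y)"
      by (intro has_derivative_add_const herm_form_has_derivative R_hermitian)
    then have "((\<lambda>x. (1/2) * herm_row k (R p) x (skip_index k l) * inverse (herm_form k (R p) x + of_real \<epsilon>))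
       has_derivative (\<lambda>v. (1/2) * herm_row k (R p) y (skip_index k l) * (- (?i * ?D v * ?i))
         + (1/2) * (\<Sum>j\<in>UNIV. R p (skip_index k l) (skip_index k j) * v $ j) * ?i)) (at y)"
      by (intro has_derivative_mult has_derivative_mult_right herm_row_has_derivative Deriv.has_derivative_inverse nz)
    also have "(\<lambda>v. (1/2) * herm_row k (R p) y (skip_index k l) * (- (?i * ?D v * ?i))
         + (1/2) * (\<Sum>j\<in>UNIV. R p (skip_index k l) (skip_index k j) * v $ j) * ?i) =
       (\<lambda>v. \<Sum>j\<in>UNIV. log_hessian k (R p) \<epsilon> y j l * v $ j
         + - (1/2) * herm_row k (R p) y (skip_index k l) * herm_row k (R p) y (skip_index k j) * ?i * ?i * cnj (v $ j))"
    proof (rule ext)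
      fix v :: "complex^'n"
      have "(1/2) * herm_row k (R p) y (skip_index k l) * (- (?i * ?D v * ?i))
         + (1/2) * (\<Sum>j\<in>UNIV. R p (skip_index k l) (skip_index k j) * v $ j) * ?i =
        (\<Sum>j\<in>UNIV. (1/2) * herm_row k (R p) y (skip_index k l) * (- (?i * (cnj (herm_row k (R p) y (skip_index k j)) * v $ j + herm_row k (R p) y (skip_index k j) * cnj (v $ j)) * ?i))
         + (1/2) * (R p (skip_index k l) (skip_index k j) * v $ j) * ?i)"
        by (simp only: sum_distrib_left sum_distrib_right sum_negf[symmetric] sum.distrib[symmetric])
      also have "\<dots> = (\<Sum>j\<in>UNIV. log_hessian k (R p) \<epsilon> y j l * v $ j
         + - (1/2) * herm_row k (R p) y (skip_index k l) * herm_row k (R p) y (skip_index k j) * ?i * ?i * cnj (v $ j))"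
      proof -
        have "(1/2) * l * (- (i * (c * v + b * w) * i)) + (1/2) * (r * v) * i =
          (1/2) * (r * i - c * l * (i * i)) * v + - (1/2) * l * b * i * i * w" for l i c v b w r :: complex
          by (simp add: algebra_simps)
        then show ?thesis
          by (simp only: log_hessian_inverse)
      qed
      finally show "(1/2) * herm_row k (R p) y (skip_index k l) * (- (?i * ?D v * ?i))
         + (1/2) * (\<Sum>j\<in>UNIV. R p (skip_index k l) (skip_index k j) * v $ j) * ?i =
        (\<Sum>j\<in>UNIV. log_hessian k (R p) \<epsilon> y j l * v $ j
         + - (1/2) * herm_row k (R p) y (skip_index k l) * herm_row k (R p) y (skip_index k j) * ?i * ?i * cnj (v $ j))" .
    qed
    finally show "((\<lambda>x. (1/2) * herm_row k (R p) x (skip_index k l) * inverse (herm_form k (R p) x + of_real \<epsilon>))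
       has_derivative (\<lambda>v. \<Sum>j\<in>UNIV. log_hessian k (R p) \<epsilon> y j l * v $ j
         + - (1/2) * herm_row k (R p) y (skip_index k l) * herm_row k (R p) y (skip_index k j) * ?i * ?i * cnj (v $ j))) (at y)" .
  qed (intro smooth_family.mult smooth_family_const smooth_family.cnj family_row family_inverse)+
qed

lemma ddc_potential:
  assumes "x \<in> X"
  shows "ddc potential x = (\<chi> j l. \<i> / of_real pi * (\<integral>p. log_hessian k (R p) \<epsilon> x j l \<partial>M))"
  unfolding ddc_def partial_of_has_derivative(1)[OF partial_zbar_potential_has_derivative[OF assms]] ..

end

section \<open>Averages of plurisubharmonic logarithms\<close>

text \<open>The real part of Cauchy's formula at the centre for \<open>Ln (1 + c z)\<close>, which is holomorphic on the closed
  unit disc because \<open>|c| < 1\<close> keeps \<open>1 + c z\<close> in the right half-plane.\<close>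

lemma circle_integral_ln_affine:
  fixes c :: complex
  assumes c: "cmod c < 1"
  shows "((\<lambda>t. ln (cmod (1 + c * cis t))) has_integral 0) {0..2*pi}"
proof -
  have nn: "1 + c * z \<notin> \<real>\<^sub>\<le>\<^sub>0" if "cmod z \<le> 1" for z
  proof
    assume "1 + c * z \<in> \<real>\<^sub>\<le>\<^sub>0"
    then have "Re (1 + c * z) \<le> 0" by (auto simp: complex_nonpos_Reals_iff)
    moreover have "cmod (c * z) \<le> cmod c"
      using that by (simp add: norm_mult mult_left_le)
    ultimately show False using c abs_Re_le_cmod[of "c * z"] by simp
  qed
  have "(\<lambda>z. Ln (1 + c * z)) holomorphic_on cball 0 1"
    by (intro holomorphic_intros) (use nn in auto)
  from Cauchy_integral_circlepath_simple[OF this, of 0]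
  have "((\<lambda>z. Ln (1 + c * z) / z) has_contour_integral 0) (circlepath 0 1)" by simp
  then have "((\<lambda>t. Ln (1 + c * cis t) / cis t * (\<i> * cis t)) has_integral 0) {0..2*pi}"
    unfolding circlepath_def
    by (subst (asm) has_contour_integral_part_circlepath_iff) (auto simp: mult_ac)
  then have "((\<lambda>t. \<i> * Ln (1 + c * cis t)) has_integral 0) {0..2*pi}"
    by (simp add: mult_ac)
  then have "((\<lambda>t. Im (\<i> * Ln (1 + c * cis t))) has_integral Im 0) {0..2*pi}"
    by (rule has_integral_Im)
  moreover have "Im (\<i> * Ln (1 + c * cis t)) = ln (cmod (1 + c * cis t))" for t
  proof -
    have "1 + c * cis t \<noteq> 0" using nn[of "cis t"] by auto
    then show ?thesis by simp
  qed
  ultimately show ?thesis by simp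
qed

text \<open>On the unit circle \<open>A + B + 2 Re (\<beta> t) = K |1 + c t|\<^sup>2\<close> with \<open>c = \<beta> / K\<close>, where \<open>K\<close> is the larger root of
  \<open>K\<^sup>2 - (A + B) K + |\<beta>|\<^sup>2 = 0\<close>. The hypothesis \<open>2 |\<beta>| < A + B\<close> gives \<open>|c| < 1\<close>, so that the mean of the
  logarithm is \<open>ln K\<close>, and \<open>|\<beta>|\<^sup>2 \<le> A B\<close> gives \<open>K \<ge> A\<close>. For \<open>|M\<^sub>0 + t M\<^sub>1|\<^sup>2\<close> this is the sub-mean value
  inequality of its logarithm at \<open>t = 0\<close>.\<close>

lemma ln_hermitian_circle_submean:
  fixes \<beta> :: complex and \<alpha> A B :: real
  assumes \<beta>: "(cmod \<beta>)\<^sup>2 \<le> A * B" and pos: "A > 0" "B \<ge> 0"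
    and gt: "2 * cmod \<beta> < A + B"
  shows "\<exists>I \<ge> 2 * pi * ln A. ((\<lambda>t. ln (A + B + 2 * Re (\<beta> * cis t))) has_integral I) {0..2*pi}"
proof -
  define S where "S = sqrt ((A + B)\<^sup>2 - 4 * (cmod \<beta>)\<^sup>2)"
  define K where "K = (A + B + S) / 2"
  define c where "c = \<beta> / of_real K"
  have S: "S\<^sup>2 = (A + B)\<^sup>2 - 4 * (cmod \<beta>)\<^sup>2"
  proof -
    have "(2 * cmod \<beta>)\<^sup>2 \<le> (A + B)\<^sup>2" using gt by (intro power_mono) auto
    then show ?thesis unfolding S_def by (simp add: power_mult_distrib)
  qed
  have "\<bar>A - B\<bar> \<le> S"
    unfolding S_def using \<beta> by (intro real_le_rsqrt) (simp add: power2_eq_square algebra_simps)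
  then have KA: "A \<le> K" unfolding K_def using abs_le_D1[of "A - B" S] by (simp add: field_simps)
  then have K: "K > 0" using pos by simp
  have "S > 0"
  proof -
    have "(2 * cmod \<beta>)\<^sup>2 < (A + B)\<^sup>2" using gt by (intro power_strict_mono) auto
    then show ?thesis unfolding S_def by (simp add: power_mult_distrib)
  qed
  then have "cmod \<beta> < K" unfolding K_def using gt by (simp add: field_simps)
  then have c: "cmod c < 1" unfolding c_def using K by (simp add: norm_divide)
  have KK: "K + (cmod \<beta>)\<^sup>2 / K = A + B"
  proof -
    have "K * K + (cmod \<beta>)\<^sup>2 = (A + B) * K"
      unfolding K_def using S by (simp add: power2_eq_square field_simps)
    then show ?thesis using K by (simp add: field_simps)
  qed
  \<comment> \<open>The constant terms agree by the quadratic equation for \<open>K\<close>, the linear ones because \<open>K c = \<beta>\<close>.\<close>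
  have eq: "A + B + 2 * Re (\<beta> * cis t) = K * (cmod (1 + c * cis t))\<^sup>2" for t
  proof -
    have "(cmod (1 + c * cis t))\<^sup>2 = 1 + 2 * Re (c * cis t) + (cmod (c * cis t))\<^sup>2"
      unfolding cmod_power2 by (simp add: power2_eq_square algebra_simps)
    also have "cmod (c * cis t) = cmod \<beta> / K"
      unfolding c_def using K by (simp add: norm_mult norm_divide)
    also have "Re (c * cis t) = Re (\<beta> * cis t) / K"
      unfolding c_def by (simp add: diff_divide_distrib)
    also have "K * (1 + 2 * (Re (\<beta> * cis t) / K) + (cmod \<beta> / K)\<^sup>2) = A + B + 2 * Re (\<beta> * cis t)"
    proof -
      have "K * (1 + 2 * (r / K) + (b / K)\<^sup>2) = K + b\<^sup>2 / K + 2 * r" for r b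
        using K by (simp add: field_simps power2_eq_square)
      then show ?thesis unfolding KK[symmetric] by blast
    qed
    finally show ?thesis by simp
  qed
  have nz: "1 + c * cis t \<noteq> 0" for t
  proof
    assume "1 + c * cis t = 0"
    then have "c * cis t = -1" by (simp add: add_eq_0_iff)
    then have "cmod (c * cis t) = 1" by simp
    then show False using c by (simp add: norm_mult)
  qed
  have "ln (A + B + 2 * Re (\<beta> * cis t)) = ln K + 2 * ln (cmod (1 + c * cis t))" for t
    unfolding eq using K nz by (simp add: ln_mult ln_realpow)
  moreover have "((\<lambda>t. ln K + 2 * ln (cmod (1 + c * cis t))) has_integral (2 * pi * ln K + 2 * 0)) {0..2*pi}"
    by (intro has_integral_add has_integral_mult_right circle_integral_ln_affine c)
      (use has_integral_const_real[of "ln K" 0 "2*pi"] in \<open>simp add: mult_ac\<close>)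
  ultimately have "((\<lambda>t. ln (A + B + 2 * Re (\<beta> * cis t))) has_integral (2 * pi * ln K)) {0..2*pi}"
    by simp
  moreover have "2 * pi * ln A \<le> 2 * pi * ln K" using KA pos by simp
  ultimately show ?thesis by blast
qed

lemma ereal_integral_real:
  fixes f :: "'a \<Rightarrow> real"
  assumes "integrable M f"
  shows "ereal_integral M (\<lambda>x. ereal (f x)) = ereal (integral\<^sup>L M f)"
proof -
  have fin: "(\<integral>\<^sup>+x. ennreal (f x) \<partial>M) < \<infinity>" "(\<integral>\<^sup>+x. ennreal (- f x) \<partial>M) < \<infinity>"
    using assms by (auto simp: real_integrable_def top.not_eq_extremum)
  then obtain a b where ab: "a \<ge> 0" "b \<ge> 0" "(\<integral>\<^sup>+x. ennreal (f x) \<partial>M) = ennreal a" "(\<integral>\<^sup>+x. ennreal (- f x) \<partial>M) = ennreal b"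
    by (metis ennreal_cases infinity_ennreal_def less_irrefl)
  then show ?thesis
    using real_lebesgue_integral_def[OF assms]
    unfolding ereal_integral_def by (simp add: enn2ereal_ennreal)
qed

text \<open>By Fubini, the sub-mean value inequality passes from the members of the family to the average.\<close>

lemma psh_on_integral:
  fixes X :: "(complex^'n) set"
  assumes X: "open X" and M: "finite_measure M" and f: "smooth_family X M f"
    and submean: "\<And>a b p. (\<And>t. norm t \<le> 1 \<Longrightarrow> a + t *s b \<in> X) \<Longrightarrow> p \<in> space M \<Longrightarrow>
      \<exists>I \<ge> 2 * pi * Re (f a p). ((\<lambda>t. Re (f (a + cis t *s b) p)) has_integral I) {0..2*pi}"
  shows "psh_on X (\<lambda>x. ereal (Re (\<integral>p. f x p \<partial>M)))"
proof -
  interpret M: finite_measure M by fact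
  define u where "u x = Re (\<integral>p. f x p \<partial>M)" for x
  define C where "C = restrict_space lborel {0..2*pi}"
  have C: "finite_measure C"
    unfolding C_def by (rule finite_measureI) (simp add: emeasure_restrict_space space_restrict_space)
  interpret C: finite_measure C by fact
  interpret MC: pair_sigma_finite M C ..
  have cont: "continuous_on X u"
    unfolding u_def using smooth_family_integral_Ck[OF X M f, of 0]
    by (auto intro: continuous_intros)
  have int: "integrable M (\<lambda>p. f x p)" if "x \<in> X" for x
    by (rule smooth_family_integrable[OF f M that])
  have "open {z \<in> X. ereal (u z) < c}" for c
  proof (cases c)
    case (real r)
    then show ?thesis using continuous_open_preimage[OF cont X, of "{..<r}"]
      by (simp add: vimage_def Int_def Collect_conj_eq[symmetric])
  next
    case PInf
    then show ?thesis using X by simp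
  next
    case MInf
    then have "{z \<in> X. ereal (u z) < c} = {}" by auto
    then show ?thesis by (simp only: open_empty)
  qed
  moreover have "ereal (u a) \<le> circle_mean (\<lambda>x. ereal (u x)) a b"
    if disc: "\<forall>t. norm t \<le> 1 \<longrightarrow> a + t *s b \<in> X" for a b
  proof -
    define g where "g p t = Re (f (a + cis t *s b) p)" for p t
    have circ: "a + cis t *s b \<in> X" for t using disc by simp
    have aX: "a \<in> X" using disc[rule_format, of 0] by simp
    have contc: "continuous_on UNIV (\<lambda>t. a + cis t *s b)"
      unfolding vector_scalar_mult_def
      by (intro continuous_intros continuous_on_vec_lambda) 
    have mg: "(\<lambda>(p, t). g p t) \<in> borel_measurable (M \<Otimes>\<^sub>M C)"
    proof -
      have "(\<lambda>t. a + cis t *s b) \<in> measurable borel borel"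
        using contc by (rule borel_measurable_continuous_onI)
      then have m1: "(\<lambda>t. a + cis t *s b) \<in> measurable C borel"
        unfolding C_def by (simp add: measurable_restrict_space1)
      have "(\<lambda>(p, t). (a + cis t *s b, p)) \<in> measurable (M \<Otimes>\<^sub>M C) (borel \<Otimes>\<^sub>M M)"
        using m1 by measurable
      from measurable_compose[OF this smooth_family_measurable[OF f]]
      show ?thesis unfolding g_def by (simp add: split_beta')
    qed
    have "compact ((\<lambda>t. a + cis t *s b) ` {0..2*pi})"
      by (intro compact_continuous_image continuous_on_subset[OF contc]) auto
    then obtain B where B: "\<And>t p. t \<in> {0..2*pi} \<Longrightarrow> p \<in> space M \<Longrightarrow> cmod (f (a + cis t *s b) p) \<le> B"
      using smooth_family_bounded[OF f, of "(\<lambda>t. a + cis t *s b) ` {0..2*pi}"] circ by (force simp: image_iff)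
    have intg: "integrable (M \<Otimes>\<^sub>M C) (\<lambda>(p, t). g p t)"
    proof (rule finite_measure.integrable_const_bound[where B = B])
      show "finite_measure (M \<Otimes>\<^sub>M C)" by (rule finite_measure_pair_measure) (rule C, rule M)
      show "AE x in M \<Otimes>\<^sub>M C. norm ((\<lambda>(p, t). g p t) x) \<le> B"
        by (rule AE_I2) (auto simp: space_pair_measure g_def C_def space_restrict_space
            intro!: order_trans[OF abs_Re_le_cmod] B)
    qed (rule mg)
    have sub: "2 * pi * Re (f a p) \<le> (\<integral>t. g p t \<partial>C)" if p: "p \<in> space M" for p
    proof -
      from submean[of a b p] disc p obtain I where I: "I \<ge> 2 * pi * Re (f a p)"
        "((\<lambda>t. Re (f (a + cis t *s b) p)) has_integral I) {0..2*pi}" by blast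
      have mt: "(\<lambda>t. g p t) \<in> borel_measurable C"
        using measurable_compose[OF measurable_Pair1'[OF p] mg] by simp
      have "integrable C (g p)"
      proof (rule C.integrable_const_bound[OF _ mt])
        show "AE t in C. norm (g p t) \<le> B"
          by (rule AE_I2) (auto simp: g_def C_def space_restrict_space p
            intro!: order_trans[OF abs_Re_le_cmod] B)
      qed
      then have si: "set_integrable lborel {0..2*pi} (g p)"
        unfolding C_def by (subst (asm) integrable_restrict_space) (auto simp: set_integrable_def)
      have "(\<integral>t. g p t \<partial>C) = (LINT t:{0..2*pi}|lborel. g p t)"
        unfolding C_def set_lebesgue_integral_def by (subst integral_restrict_space) auto
      also have "\<dots> = integral {0..2*pi} (g p)"
        by (rule set_borel_integral_eq_integral[OF si])
      also have "\<dots> = I" using I(2) unfolding g_def by (rule integral_unique)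
      finally show ?thesis using I by simp
    qed
    have intm: "integrable M (\<lambda>p. \<integral>t. g p t \<partial>C)" using MC.integrable_fst[OF intg] .
    have "2 * pi * u a = (\<integral>p. 2 * pi * Re (f a p) \<partial>M)"
      unfolding u_def using int[OF aX] by simp
    also have "\<dots> \<le> (\<integral>p. (\<integral>t. g p t \<partial>C) \<partial>M)"
      using int[OF aX] by (intro integral_mono intm sub) auto
    also have "\<dots> = (\<integral>t. (\<integral>p. g p t \<partial>M) \<partial>C)"
      using MC.Fubini_integral[OF intg] by simp
    also have "\<dots> = (\<integral>t. u (a + cis t *s b) \<partial>C)"
      unfolding u_def g_def using int circ by simp
    finally have le: "2 * pi * u a \<le> (\<integral>t. u (a + cis t *s b) \<partial>C)" .
    have "integrable C (\<lambda>t. \<integral>p. g p t \<partial>M)" using MC.integrable_snd[OF intg] .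
    then have "integrable C (\<lambda>t. u (a + cis t *s b))"
      unfolding u_def g_def using int circ by simp
    from ereal_integral_real[OF this]
    show ?thesis unfolding circle_mean_def C_def[symmetric] using le by (simp add: field_simps)
  qed
  ultimately show ?thesis
    using X unfolding psh_on_def u_def by auto
qed

section \<open>The projective kernel in an affine chart\<close>

lemma norm_vec_sq: "(norm (x :: complex^'m))\<^sup>2 = (\<Sum>i\<in>UNIV. (cmod (x $ i))\<^sup>2)"
  unfolding norm_vec_def L2_set_def by (simp add: sum_nonneg)

lemma of_real_cmod_sq: "(complex_of_real (cmod z))\<^sup>2 = z * cnj z"
  by (simp add: complex_norm_square flip: of_real_power)

lemma proj_rel_refl: "v \<noteq> 0 \<Longrightarrow> proj_rel v v"
  unfolding proj_rel_def by (auto intro: exI[of _ 1])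

lemma rep_nonzero: "rep p \<noteq> 0" and proj_pt_rep: "proj_pt (rep p) = p"
proof -
  have "\<exists>v. v \<noteq> 0 \<and> proj_pt v = p"
    by (induction p rule: cproj.abs_induct) (auto simp: proj_rel_def)
  from someI_ex[OF this] show "rep p \<noteq> 0" "proj_pt (rep p) = p"
    unfolding rep_def by auto
qed

lemma proj_pt_eq_iff:
  assumes "v \<noteq> 0" "w \<noteq> 0"
  shows "proj_pt v = proj_pt w \<longleftrightarrow> proj_rel v w"
  using Quotient3_rel[OF Quotient3_cproj, of v w] proj_rel_refl assms by blast

lemma rep_proj_pt:
  assumes "v \<noteq> 0"
  obtains c where "c \<noteq> 0" "rep (proj_pt v) = c *s v"
  using proj_pt_eq_iff[OF assms rep_nonzero[of "proj_pt v"]] proj_pt_rep[of "proj_pt v"]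
  unfolding proj_rel_def by metis

text \<open>Projective space carries the quotient topology of the punctured coordinate space.\<close>

lemma continuous_on_cproj:
  fixes g :: "'n::finite cproj \<Rightarrow> 'a::topological_space"
  assumes "continuous_on (- {0}) (\<lambda>v. g (proj_pt v))"
  shows "continuous_on UNIV g"
proof (rule continuous_on_open_vimage[THEN iffD2], simp, intro allI impI)
  fix B :: "'a set" assume "open B"
  moreover have "open (- {0 :: complex^('n option)})" by (simp add: open_Compl)
  ultimately have "open ((\<lambda>v. g (proj_pt v)) -` B \<inter> - {0})"
    using assms continuous_on_open_vimage[of "- {0 :: complex^('n option)}"] by blast
  moreover have "(\<lambda>v. g (proj_pt v)) -` B \<inter> - {0} = {v. v \<noteq> 0 \<and> proj_pt v \<in> g -` B}" by auto
  ultimately show "open (g -` B \<inter> UNIV)"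
    unfolding open_cproj_def by simp
qed

text \<open>The orthogonal projection onto the line \<open>p\<close>. Unlike the chosen representative \<open>rep p\<close> it depends continuously
  on \<open>p\<close>, so all quantities that must be measurable in the pole are expressed through it.\<close>

definition proj_mat :: "'n::finite cproj \<Rightarrow> 'n option \<Rightarrow> 'n option \<Rightarrow> complex" where
  "proj_mat p a b = rep p $ a * cnj (rep p $ b) / of_real ((norm (rep p))\<^sup>2)"

lemma norm_vscale: "norm (c *s (v :: complex^'m)) = cmod c * norm v"
proof -
  have "(norm (c *s v))\<^sup>2 = (cmod c * norm v)\<^sup>2"
    unfolding norm_vec_sq power_mult_distrib by (simp add: norm_mult power_mult_distrib sum_distrib_left)
  then show ?thesis by (simp add: power2_eq_iff_nonneg)
qed

lemma proj_mat_proj_pt: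
  assumes "v \<noteq> 0"
  shows "proj_mat (proj_pt v) a b = v $ a * cnj (v $ b) / of_real ((norm v)\<^sup>2)"
proof -
  obtain c where c: "c \<noteq> 0" "rep (proj_pt v) = c *s v" using rep_proj_pt[OF assms] .
  have "complex_of_real ((norm (c *s v))\<^sup>2) = c * cnj c * of_real ((norm v)\<^sup>2)"
    by (simp add: norm_vscale power_mult_distrib of_real_cmod_sq)
  then show ?thesis
    unfolding proj_mat_def c using c(1) assms by (simp add: field_simps)
qed

lemma continuous_proj_mat: "continuous_on UNIV (\<lambda>p :: 'n::finite cproj. proj_mat p a b)"
proof (rule continuous_on_cproj)
  have "continuous_on (- {0}) (\<lambda>v::complex^('n option). v $ a * cnj (v $ b) / of_real ((norm v)\<^sup>2))"
    by (intro continuous_intros) auto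
  then show "continuous_on (- {0}) (\<lambda>v. proj_mat (proj_pt v :: 'n cproj) a b)"
    by (rule continuous_on_eq) (auto simp: proj_mat_proj_pt)
qed

lemma measurable_proj_mat: "(\<lambda>p. proj_mat p a b) \<in> borel_measurable borel"
  by (rule borel_measurable_continuous_onI[OF continuous_proj_mat])

definition unit_rep :: "'n::finite cproj \<Rightarrow> 'n option \<Rightarrow> complex" where
  "unit_rep p a = rep p $ a / of_real (norm (rep p))"

lemma proj_mat_unit_rep: "proj_mat p a b = unit_rep p a * cnj (unit_rep p b)"
  unfolding proj_mat_def unit_rep_def by (simp add: power2_eq_square)

lemma unit_rep_sum: "(\<Sum>a\<in>UNIV. (cmod (unit_rep p a))\<^sup>2) = 1"
proof -
  have "(\<Sum>a\<in>UNIV. (cmod (unit_rep p a))\<^sup>2) = (\<Sum>a\<in>UNIV. (cmod (rep p $ a))\<^sup>2) / (norm (rep p))\<^sup>2"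
    unfolding unit_rep_def by (simp add: norm_divide power_divide sum_divide_distrib)
  then show ?thesis using rep_nonzero[of p] by (simp add: norm_vec_sq[symmetric])
qed

lemma unit_rep_sum_cnj: "(\<Sum>a\<in>UNIV. cnj (unit_rep p a) * unit_rep p a) = 1"
proof -
  have "(\<Sum>a\<in>UNIV. cnj (unit_rep p a) * unit_rep p a) = of_real (\<Sum>a\<in>UNIV. (cmod (unit_rep p a))\<^sup>2)"
    by (simp add: of_real_cmod_sq mult.commute)
  then show ?thesis by (simp add: unit_rep_sum)
qed

lemma unit_rep_le_1: "cmod (unit_rep p a) \<le> 1"
proof -
  have "(cmod (unit_rep p a))\<^sup>2 \<le> (\<Sum>a\<in>UNIV. (cmod (unit_rep p a))\<^sup>2)"
    by (rule member_le_sum) auto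
  then show ?thesis unfolding unit_rep_sum by (simp add: power_le_one_iff)
qed

lemma proj_mat_le_1: "cmod (proj_mat p a b) \<le> 1"
  unfolding proj_mat_unit_rep using unit_rep_le_1[of p a] unit_rep_le_1[of p b]
  by (simp add: norm_mult mult_le_one)

text \<open>The orthogonal projection onto the complement of the line \<open>p\<close>.\<close>

definition resid :: "'n::finite cproj \<Rightarrow> 'n option \<Rightarrow> 'n option \<Rightarrow> complex" where
  "resid p a b = (if a = b then 1 else 0) - proj_mat p a b"

lemma resid_hermitian: "resid p a b = cnj (resid p b a)"
  unfolding resid_def proj_mat_unit_rep by (simp add: mult.commute)

lemma resid_le_2: "cmod (resid p a b) \<le> 2"
  unfolding resid_def using norm_triangle_ineq4[of "if a = b then 1 else 0" "proj_mat p a b"] proj_mat_le_1[of p a b]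
  by (auto split: if_splits)

lemma measurable_resid: "(\<lambda>p. resid p a b) \<in> borel_measurable borel"
  unfolding resid_def by (intro borel_measurable_diff measurable_proj_mat) auto

text \<open>With \<open>P\<close> the projection onto \<open>p\<close>, this is \<open>|(I - P) Z| = |Z \<and> \<eta>| / |\<eta>|\<close>: on bounded sets of \<open>z\<close> it is
  comparable to the distance in projective space between the pole \<open>p\<close> and the point \<open>z\<close>.\<close>

definition chord :: "'n::finite option \<Rightarrow> 'n cproj \<Rightarrow> complex^'n \<Rightarrow> real" where
  "chord k p z = sqrt (Re (herm_form k (resid p) z))"

context
  fixes k :: "'n::finite option" and p :: "'n cproj" and z :: "complex^'n"
begin

definition inner_rep where "inner_rep = (\<Sum>b\<in>UNIV. cnj (unit_rep p b) * affine_lift k z $ b)"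

lemma herm_row_resid: "herm_row k (resid p) z a = affine_lift k z $ a - unit_rep p a * inner_rep"
proof -
  have "herm_row k (resid p) z a = (\<Sum>b\<in>UNIV. (if a = b then affine_lift k z $ a else 0)
      - unit_rep p a * (cnj (unit_rep p b) * affine_lift k z $ b))"
    unfolding herm_row_def resid_def proj_mat_unit_rep by (intro sum.cong) (auto simp: algebra_simps)
  then show ?thesis by (simp add: sum_subtractf sum_distrib_left inner_rep_def)
qed

lemma herm_row_orth: "(\<Sum>a\<in>UNIV. cnj (unit_rep p a) * herm_row k (resid p) z a) = 0"
proof -
  have "(\<Sum>a\<in>UNIV. cnj (unit_rep p a) * herm_row k (resid p) z a) =
    inner_rep - (\<Sum>a\<in>UNIV. cnj (unit_rep p a) * unit_rep p a) * inner_rep"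
    unfolding herm_row_resid
    by (simp add: right_diff_distrib sum_subtractf sum_distrib_right mult.assoc)
      (simp add: inner_rep_def)
  then show ?thesis by (simp add: unit_rep_sum_cnj)
qed

text \<open>\<open>I - P\<close> is an orthogonal projection, hence \<open>Z\<^sup>* (I - P) Z = |(I - P) Z|\<^sup>2\<close>.\<close>

lemma herm_form_resid_sum: "herm_form k (resid p) z = of_real (\<Sum>a\<in>UNIV. (cmod (herm_row k (resid p) z a))\<^sup>2)"
proof -
  have "herm_form k (resid p) z = (\<Sum>a\<in>UNIV. cnj (herm_row k (resid p) z a + unit_rep p a * inner_rep) * herm_row k (resid p) z a)"
    unfolding herm_form_def by (simp add: herm_row_resid)
  also have "\<dots> = (\<Sum>a\<in>UNIV. cnj (herm_row k (resid p) z a) * herm_row k (resid p) z a)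
      + cnj inner_rep * (\<Sum>a\<in>UNIV. cnj (unit_rep p a) * herm_row k (resid p) z a)"
    by (simp add: algebra_simps sum.distrib sum_distrib_left)
  also have "\<dots> = (\<Sum>a\<in>UNIV. cnj (herm_row k (resid p) z a) * herm_row k (resid p) z a)"
    by (simp add: herm_row_orth)
  finally show ?thesis by (simp add: of_real_cmod_sq mult.commute)
qed

lemma chord_sq: "(chord k p z)\<^sup>2 = (\<Sum>a\<in>UNIV. (cmod (herm_row k (resid p) z a))\<^sup>2)"
  and chord_nonneg: "chord k p z \<ge> 0"
  and herm_form_chord: "herm_form k (resid p) z = of_real ((chord k p z)\<^sup>2)"
  unfolding chord_def herm_form_resid_sum by (auto simp: sum_nonneg simp del: of_real_sum)

lemma chord_eq_norm: "chord k p z = norm (\<chi> a. herm_row k (resid p) z a)"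
  by (rule power2_eq_imp_eq) (simp_all add: chord_sq norm_vec_sq chord_nonneg)

lemma herm_row_le_chord: "cmod (herm_row k (resid p) z a) \<le> chord k p z"
  using Finite_Cartesian_Product.norm_nth_le[of "\<chi> a. herm_row k (resid p) z a" a]
  unfolding chord_eq_norm by simp

lemma chord_inner_rep: "(chord k p z)\<^sup>2 + (cmod (inner_rep))\<^sup>2 = (norm (affine_lift k z))\<^sup>2"
proof -
  have "herm_form k (resid p) z = (\<Sum>a\<in>UNIV. affine_lift k z $ a * cnj (affine_lift k z $ a))
    - (\<Sum>a\<in>UNIV. cnj (affine_lift k z $ a) * unit_rep p a) * inner_rep"
    unfolding herm_form_def herm_row_resid by (simp add: algebra_simps sum_subtractf sum_distrib_left)
  also have "(\<Sum>a\<in>UNIV. cnj (affine_lift k z $ a) * unit_rep p a) = cnj (inner_rep)"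
    unfolding inner_rep_def by (simp add: mult.commute)
  also have "(\<Sum>a\<in>UNIV. affine_lift k z $ a * cnj (affine_lift k z $ a)) = of_real ((norm (affine_lift k z))\<^sup>2)"
    by (simp only: norm_vec_sq of_real_sum of_real_power of_real_cmod_sq)
  finally have "complex_of_real ((chord k p z)\<^sup>2) + (complex_of_real (cmod (inner_rep)))\<^sup>2 = of_real ((norm (affine_lift k z))\<^sup>2)"
    by (simp add: herm_form_chord of_real_cmod_sq mult.commute)
  then show ?thesis by (simp only: of_real_power[symmetric] of_real_add[symmetric] of_real_eq_iff)
qed

lemma chord_le_norm: "chord k p z \<le> norm (affine_lift k z)"
  and inner_rep_le_norm: "cmod inner_rep \<le> norm (affine_lift k z)"
proof -
  have "(chord k p z)\<^sup>2 \<le> (norm (affine_lift k z))\<^sup>2" "(cmod inner_rep)\<^sup>2 \<le> (norm (affine_lift k z))\<^sup>2"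
    unfolding chord_inner_rep[symmetric] by simp_all
  then show "chord k p z \<le> norm (affine_lift k z)" "cmod inner_rep \<le> norm (affine_lift k z)"
    by (auto intro: power2_le_imp_le)
qed

text \<open>For a unit vector \<open>e\<close> on the line \<open>p\<close> this is \<open>e\<^sub>k Z - e\<close>, which is \<open>e\<^sub>k\<close> times the vector from the pole to \<open>z\<close>.
  In this form it also makes sense for poles at infinity of the chart.\<close>

definition kernel_vec :: "'n option \<Rightarrow> complex" where
  "kernel_vec b = unit_rep p k * affine_lift k z $ b - unit_rep p b"

lemma kernel_vec_same: "kernel_vec k = 0"
  unfolding kernel_vec_def by simp

lemma kernel_vec_le: "cmod (kernel_vec b) \<le> 2 * chord k p z"
proof -
  have "kernel_vec b = unit_rep p k * herm_row k (resid p) z b - unit_rep p b * herm_row k (resid p) z k"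
    unfolding kernel_vec_def herm_row_resid by (simp add: algebra_simps)
  also have "cmod \<dots> \<le> 1 * cmod (herm_row k (resid p) z b) + 1 * cmod (herm_row k (resid p) z k)"
    by (rule order_trans[OF norm_triangle_ineq4], unfold norm_mult, intro add_mono mult_right_mono)
      (auto simp: unit_rep_le_1)
  finally show ?thesis using herm_row_le_chord[of b] herm_row_le_chord[of k] by simp
qed

lemma resid_kernel: "(\<Sum>b\<in>UNIV. resid p a b * kernel_vec b) = unit_rep p k * herm_row k (resid p) z a"
proof -
  have "(\<Sum>b\<in>UNIV. resid p a b * unit_rep p b) = (\<Sum>b\<in>UNIV. (if a = b then unit_rep p a else 0)
      - unit_rep p a * (cnj (unit_rep p b) * unit_rep p b))"
    unfolding resid_def proj_mat_unit_rep by (intro sum.cong) (auto simp: algebra_simps)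
  also have "\<dots> = unit_rep p a - unit_rep p a * (\<Sum>b\<in>UNIV. cnj (unit_rep p b) * unit_rep p b)"
    by (simp add: sum_subtractf sum_distrib_left)
  finally have "(\<Sum>b\<in>UNIV. resid p a b * unit_rep p b) = 0"
    by (simp add: unit_rep_sum_cnj)
  then show ?thesis
    unfolding kernel_vec_def herm_row_def by (simp add: algebra_simps sum_subtractf sum_distrib_left)
qed

lemma row_kernel: "(\<Sum>b\<in>UNIV. cnj (herm_row k (resid p) z b) * kernel_vec b) = unit_rep p k * of_real ((chord k p z)\<^sup>2)"
proof -
  have "(\<Sum>b\<in>UNIV. cnj (herm_row k (resid p) z b) * unit_rep p b) = cnj (\<Sum>b\<in>UNIV. cnj (unit_rep p b) * herm_row k (resid p) z b)"
    by (simp add: mult.commute)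
  then have 1: "(\<Sum>b\<in>UNIV. cnj (herm_row k (resid p) z b) * unit_rep p b) = 0"
    by (simp only: herm_row_orth complex_cnj_zero)
  have "(\<Sum>b\<in>UNIV. cnj (herm_row k (resid p) z b) * affine_lift k z $ b) = cnj (herm_form k (resid p) z)"
    unfolding herm_form_def by (simp add: mult.commute)
  also have "\<dots> = of_real ((chord k p z)\<^sup>2)" by (simp only: herm_form_chord complex_cnj_complex_of_real)
  finally have 2: "(\<Sum>b\<in>UNIV. cnj (herm_row k (resid p) z b) * affine_lift k z $ b) = of_real ((chord k p z)\<^sup>2)" .
  have "(\<Sum>b\<in>UNIV. cnj (herm_row k (resid p) z b) * kernel_vec b) =
     unit_rep p k * (\<Sum>b\<in>UNIV. cnj (herm_row k (resid p) z b) * affine_lift k z $ b)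
      - (\<Sum>b\<in>UNIV. cnj (herm_row k (resid p) z b) * unit_rep p b)"
    unfolding kernel_vec_def by (simp add: algebra_simps sum_subtractf sum_distrib_left)
  then show ?thesis by (simp only: 1 2 diff_zero)
qed

text \<open>The kernel \<open>log |(I - P) Z|\<close> is plurisubharmonic, and harmonic along complex lines through its pole, so its
  semidefinite Hessian annihilates the direction of the pole. Both terms of the regularised Hessian are multiples of \<open>(I - P) Z\<close> in that direction and
  cancel up to the last factor, which is \<open>\<epsilon> / (r\<^sup>2 + \<epsilon>)\<^sup>2\<close>.\<close>

lemma hessian_kernel:
  "(\<Sum>j\<in>UNIV. log_hessian k (resid p) \<epsilon> z j l * kernel_vec (skip_index k j)) =
    (1/2) * unit_rep p k * herm_row k (resid p) z (skip_index k l)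
      * (inverse (of_real ((chord k p z)\<^sup>2 + \<epsilon>)) - of_real ((chord k p z)\<^sup>2) * (inverse (of_real ((chord k p z)\<^sup>2 + \<epsilon>)))\<^sup>2)"
proof -
  let ?i = "inverse (of_real ((chord k p z)\<^sup>2 + \<epsilon>)) :: complex" and ?L = "herm_row k (resid p) z (skip_index k l)"
  have 1: "(\<Sum>j\<in>UNIV. resid p (skip_index k l) (skip_index k j) * kernel_vec (skip_index k j)) = unit_rep p k * ?L"
    using resid_kernel[of "skip_index k l"] by (subst (asm) sum_skip_index[of _ k]) (simp add: kernel_vec_same)
  have 2: "(\<Sum>j\<in>UNIV. cnj (herm_row k (resid p) z (skip_index k j)) * kernel_vec (skip_index k j)) = unit_rep p k * of_real ((chord k p z)\<^sup>2)"
    using row_kernel by (subst (asm) sum_skip_index[of _ k]) (simp add: kernel_vec_same)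
  have e: "herm_form k (resid p) z + of_real \<epsilon> = of_real ((chord k p z)\<^sup>2 + \<epsilon>)"
    by (simp only: herm_form_chord of_real_add)
  have "(1/2) * (r * i - c * l * (i * i)) * v = (1/2) * i * (r * v) - (1/2) * l * (i * i) * (c * v)" for r i c l v :: complex
    by (simp add: algebra_simps)
  then have "(\<Sum>j\<in>UNIV. log_hessian k (resid p) \<epsilon> z j l * kernel_vec (skip_index k j)) =
    (1/2) * ?i * (\<Sum>j\<in>UNIV. resid p (skip_index k l) (skip_index k j) * kernel_vec (skip_index k j))
      - (1/2) * ?L * (?i * ?i) * (\<Sum>j\<in>UNIV. cnj (herm_row k (resid p) z (skip_index k j)) * kernel_vec (skip_index k j))"
    unfolding log_hessian_inverse e sum_distrib_left sum_subtractf[symmetric] by (simp only:)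
  also have "\<dots> = (1/2) * ?i * (unit_rep p k * ?L) - (1/2) * ?L * (?i * ?i) * (unit_rep p k * of_real ((chord k p z)\<^sup>2))"
    unfolding 1 2 ..
  finally show ?thesis by (simp only: power2_eq_square) (simp only: algebra_simps)
qed

text \<open>The factor left over by the cancellation is absorbed by \<open>2 r \<delta> \<le> r\<^sup>2 + \<delta>\<^sup>2\<close>.\<close>

lemma norm_hessian_kernel_le:
  assumes "\<delta> > 0"
  shows "cmod (\<Sum>j\<in>UNIV. log_hessian k (resid p) (\<delta>\<^sup>2) z j l * kernel_vec (skip_index k j)) \<le> \<delta> / ((chord k p z)\<^sup>2 + \<delta>\<^sup>2)"
proof -
  let ?x = "chord k p z"
  define Q where "Q = ?x\<^sup>2 + \<delta>\<^sup>2"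
  have Q: "Q > 0" unfolding Q_def using assms by (simp add: add_nonneg_pos)
  have "inverse (of_real Q) - of_real (?x\<^sup>2) * (inverse (of_real Q))\<^sup>2 = (of_real (\<delta>\<^sup>2 / Q\<^sup>2) :: complex)"
  proof -
    have "inverse Q - ?x\<^sup>2 * (inverse Q)\<^sup>2 = \<delta>\<^sup>2 / Q\<^sup>2"
    proof -
      have x: "?x\<^sup>2 = Q - \<delta>\<^sup>2" unfolding Q_def by simp
      show ?thesis unfolding x using Q by (simp add: field_simps power2_eq_square)
    qed
    then have "complex_of_real (inverse Q - ?x\<^sup>2 * (inverse Q)\<^sup>2) = of_real (\<delta>\<^sup>2 / Q\<^sup>2)" by (simp only:)
    then show ?thesis by (simp only: of_real_diff of_real_inverse of_real_mult of_real_power)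
  qed
  then have "cmod (\<Sum>j\<in>UNIV. log_hessian k (resid p) (\<delta>\<^sup>2) z j l * kernel_vec (skip_index k j)) =
     (1/2) * cmod (unit_rep p k) * cmod (herm_row k (resid p) z (skip_index k l)) * (\<delta>\<^sup>2 / Q\<^sup>2)"
    unfolding hessian_kernel Q_def[symmetric] by (simp add: norm_mult norm_divide norm_power)
  also have "\<dots> \<le> (1/2) * 1 * ?x * (\<delta>\<^sup>2 / Q\<^sup>2)"
    using unit_rep_le_1 herm_row_le_chord Q chord_nonneg by (intro mult_mono) auto
  also have "\<dots> = (?x * \<delta> / 2) * (\<delta> / Q\<^sup>2)" by (simp add: power2_eq_square)
  also have "\<dots> \<le> Q * (\<delta> / Q\<^sup>2)"
  proof (rule mult_right_mono)
    have "2 * (?x * \<delta>) \<le> Q" unfolding Q_def using sum_squares_bound[of ?x \<delta>] by (simp add: mult.assoc)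
    then show "?x * \<delta> / 2 \<le> Q" using Q chord_nonneg assms by simp
  qed (use assms in auto)
  also have "\<dots> = \<delta> / Q" using Q by (simp add: power2_eq_square)
  finally show ?thesis unfolding Q_def .
qed

lemma norm_log_hessian_le:
  assumes "\<delta> > 0"
  shows "cmod (log_hessian k (resid p) (\<delta>\<^sup>2) z j l) \<le> 2 / ((chord k p z)\<^sup>2 + \<delta>\<^sup>2)"
proof -
  let ?x = "chord k p z"
  define Q where "Q = ?x\<^sup>2 + \<delta>\<^sup>2"
  have Q: "Q > 0" "?x\<^sup>2 \<le> Q" unfolding Q_def using assms by (simp_all add: add_nonneg_pos)
  have e: "herm_form k (resid p) z + of_real (\<delta>\<^sup>2) = of_real Q"
    by (simp only: herm_form_chord of_real_add Q_def)
  have "cmod (log_hessian k (resid p) (\<delta>\<^sup>2) z j l) =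
    (1/2) * cmod (resid p (skip_index k l) (skip_index k j) / of_real Q
       - cnj (herm_row k (resid p) z (skip_index k j)) * herm_row k (resid p) z (skip_index k l) / (of_real Q)\<^sup>2)"
    unfolding log_hessian_def e by (simp add: norm_mult)
  also have "\<dots> \<le> (1/2) * (cmod (resid p (skip_index k l) (skip_index k j)) / Q
       + cmod (herm_row k (resid p) z (skip_index k j)) * cmod (herm_row k (resid p) z (skip_index k l)) / Q\<^sup>2)"
    using Q by (intro mult_left_mono order_trans[OF norm_triangle_ineq4]) (auto simp: norm_divide norm_mult norm_power)
  also have "\<dots> \<le> (1/2) * (2 / Q + ?x * ?x / Q\<^sup>2)"
    using Q chord_nonneg by (intro mult_left_mono add_mono divide_right_mono mult_mono resid_le_2 herm_row_le_chord) auto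
  also have "?x * ?x / Q\<^sup>2 \<le> Q / Q\<^sup>2"
    using Q by (intro divide_right_mono) (auto simp: power2_eq_square)
  also have "Q / Q\<^sup>2 = 1 / Q" using Q by (simp add: power2_eq_square)
  finally have "cmod (log_hessian k (resid p) (\<delta>\<^sup>2) z j l) \<le> (1/2) * (2 / Q + 1 / Q)" by simp
  also have "\<dots> \<le> 2 / Q" using Q by (simp add: field_simps)
  finally show ?thesis unfolding Q_def .
qed

end

section \<open>Mixed determinants of the Hessians\<close>

lemma norm_affine_lift_ge_1: "1 \<le> norm (affine_lift k z)"
  using Finite_Cartesian_Product.norm_nth_le[of "affine_lift k z" k] by simp

lemma norm_affine_lift_le: "norm (affine_lift k z) \<le> 1 + norm z"
proof (rule power2_le_imp_le)
  show "(norm (affine_lift k z))\<^sup>2 \<le> (1 + norm z)\<^sup>2"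
    unfolding norm_affine_lift by (simp add: power2_eq_square algebra_simps)
qed simp

lemma norm_vec_le_sum: "norm (x :: complex^'m) \<le> (\<Sum>i\<in>UNIV. cmod (x $ i))"
  unfolding norm_vec_def by (rule L2_set_le_sum) simp

definition proj_dist :: "'n::finite cproj \<Rightarrow> 'n cproj \<Rightarrow> real" where
  "proj_dist p p' = (\<Sum>a\<in>UNIV. \<Sum>b\<in>UNIV. cmod (proj_mat p a b - proj_mat p' a b))"

lemma proj_dist_nonneg: "proj_dist p p' \<ge> 0"
  unfolding proj_dist_def by (intro sum_nonneg) auto

lemma proj_dist_entry: "cmod (proj_mat p a b - proj_mat p' a b) \<le> proj_dist p p'"
proof -
  have "cmod (proj_mat p a b - proj_mat p' a b) \<le> (\<Sum>b\<in>UNIV. cmod (proj_mat p a b - proj_mat p' a b))"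
    by (rule member_le_sum) auto
  also have "\<dots> \<le> proj_dist p p'"
    unfolding proj_dist_def by (rule member_le_sum[of a UNIV]) (auto intro!: sum_nonneg)
  finally show ?thesis .
qed

text \<open>A line is recovered from the projection onto it: any nonzero column spans the line.\<close>

lemma proj_dist_eq_0_iff:
  fixes p p' :: "'n::finite cproj"
  shows "proj_dist p p' = 0 \<longleftrightarrow> p = p'"
proof
  assume 0: "proj_dist p p' = 0"
  have eq: "proj_mat p a b = proj_mat p' a b" for a b
    using proj_dist_entry[of p a b p'] 0 by simp
  obtain b where b: "unit_rep p b \<noteq> 0"
  proof (rule ccontr)
    assume "\<not> thesis"
    then have "unit_rep p b = 0" for b using that by blast
    then show False using unit_rep_sum_cnj[of p] by simp
  qed
  have nz: "norm (rep p) \<noteq> 0" "norm (rep p') \<noteq> 0" using rep_nonzero by auto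
  have e: "unit_rep p a * cnj (unit_rep p b) = unit_rep p' a * cnj (unit_rep p' b)" for a
    using eq[of a b] unfolding proj_mat_unit_rep .
  have rep_eq: "rep q $ a = unit_rep q a * of_real (norm (rep q))" for q :: "'n cproj" and a
    unfolding unit_rep_def using rep_nonzero[of q] by simp
  define r where "r = cnj (unit_rep p' b) / cnj (unit_rep p b)"
  define c where "c = r * of_real (norm (rep p)) / of_real (norm (rep p'))"
  have "rep p = c *s rep p'"
  proof (rule vec_eq_iff[THEN iffD2], rule allI)
    fix a
    have r: "unit_rep p a = unit_rep p' a * r"
      using e[of a] b by (simp add: r_def field_simps)
    have "u * r * N = r * N / N' * (u * N')" if "N' \<noteq> 0" for u N N' :: complex
      using that by simp
    then show "rep p $ a = (c *s rep p') $ a"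
      unfolding c_def vector_smult_component rep_eq[of p a] rep_eq[of p' a] r using nz by simp
  qed
  moreover have "c \<noteq> 0" using \<open>rep p = c *s rep p'\<close> rep_nonzero[of p] by auto
  ultimately have "proj_rel (rep p') (rep p)"
    unfolding proj_rel_def using rep_nonzero by blast
  then have "proj_pt (rep p') = proj_pt (rep p)" using proj_pt_eq_iff rep_nonzero by blast
  then show "p = p'" by (simp add: proj_pt_rep)
qed (simp add: proj_dist_def)

lemma chord_lipschitz: "\<bar>chord k p z - chord k p' z\<bar> \<le> norm (affine_lift k z) * proj_dist p p'"
proof -
  let ?Z = "affine_lift k z"
  have row: "herm_row k (resid p) z a - herm_row k (resid p') z a = (\<Sum>b\<in>UNIV. (proj_mat p' a b - proj_mat p a b) * ?Z $ b)" for a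
    unfolding herm_row_def sum_subtractf[symmetric] resid_def by (intro sum.cong) (auto simp: algebra_simps)
  have "\<bar>chord k p z - chord k p' z\<bar> \<le> norm ((\<chi> a. herm_row k (resid p) z a) - (\<chi> a. herm_row k (resid p') z a))"
    unfolding chord_eq_norm by (rule norm_triangle_ineq3)
  also have "\<dots> \<le> (\<Sum>a\<in>UNIV. cmod (herm_row k (resid p) z a - herm_row k (resid p') z a))"
    by (rule order_trans[OF norm_vec_le_sum]) simp
  also have "\<dots> \<le> (\<Sum>a\<in>UNIV. \<Sum>b\<in>UNIV. norm ?Z * cmod (proj_mat p a b - proj_mat p' a b))"
  proof (rule sum_mono)
    fix a
    show "cmod (herm_row k (resid p) z a - herm_row k (resid p') z a) \<le> (\<Sum>b\<in>UNIV. norm ?Z * cmod (proj_mat p a b - proj_mat p' a b))"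
      unfolding row
      by (rule order_trans[OF norm_sum], rule sum_mono)
        (auto simp: norm_mult norm_minus_commute mult.commute intro!: mult_right_mono Finite_Cartesian_Product.norm_nth_le)
  qed
  also have "\<dots> = norm ?Z * proj_dist p p'"
    unfolding proj_dist_def by (simp add: sum_distrib_left)
  finally show ?thesis .
qed

lemma mult_mono3:
  fixes u v w U V W :: real
  assumes "0 \<le> u" "0 \<le> v" "0 \<le> w" "u \<le> U" "v \<le> V" "w \<le> W"
  shows "u * v * w \<le> U * V * W"
proof -
  have "0 \<le> U" "0 \<le> V" using assms by auto
  then show ?thesis using assms by (metis mult_mono mult_nonneg_nonneg)
qed

text \<open>Write \<open>Z = L + s e\<close> with \<open>e\<close> a unit vector on \<open>p\<close> and \<open>L\<close> orthogonal to \<open>e\<close>, so that \<open>|L|\<close> is the chord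
  and \<open>|L|\<^sup>2 + |s|\<^sup>2 = |Z|\<^sup>2\<close>. Then \<open>|Z|\<^sup>2 e e\<^sup>* - Z Z\<^sup>*\<close> is a sum of four terms of size at most \<open>|L| |Z|\<close>.\<close>

lemma proj_mat_near:
  "cmod (of_real ((norm (affine_lift k z))\<^sup>2) * proj_mat p a b - affine_lift k z $ a * cnj (affine_lift k z $ b))
    \<le> 4 * chord k p z * norm (affine_lift k z)"
proof -
  let ?Z = "affine_lift k z" and ?x = "chord k p z" and ?s = "inner_rep k p z"
  let ?e = "unit_rep p" and ?L = "herm_row k (resid p) z"
  have Z: "?Z $ a = ?L a + ?e a * ?s" for a by (simp add: herm_row_resid)
  have n: "complex_of_real ((norm ?Z)\<^sup>2) = of_real (?x\<^sup>2) + ?s * cnj ?s"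
  proof -
    have "complex_of_real ((norm ?Z)\<^sup>2) = of_real (?x\<^sup>2 + (cmod ?s)\<^sup>2)"
      by (simp only: chord_inner_rep)
    then show ?thesis by (simp only: of_real_add of_real_power of_real_cmod_sq)
  qed
  have bx: "cmod (?L a) \<le> ?x" "cmod (?e a) \<le> 1" "?x \<ge> 0" for a
    by (auto simp: herm_row_le_chord unit_rep_le_1 chord_nonneg)
  note le = chord_le_norm[of k p z] inner_rep_le_norm[of k p z]
  have eq: "of_real ((norm ?Z)\<^sup>2) * proj_mat p a b - ?Z $ a * cnj (?Z $ b) =
     of_real (?x\<^sup>2) * ?e a * cnj (?e b) - ?L a * cnj (?L b) - ?L a * cnj (?e b) * cnj ?s - ?e a * ?s * cnj (?L b)"
    unfolding n Z proj_mat_unit_rep by (simp add: algebra_simps)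
  have tri: "cmod (t - u - v - w) \<le> cmod t + cmod u + cmod v + cmod w" for t u v w
    using norm_triangle_ineq4[of "t - u - v" w] norm_triangle_ineq4[of "t - u" v] norm_triangle_ineq4[of t u]
    by linarith
  have x2: "?x\<^sup>2 \<le> norm ?Z * ?x"
    unfolding power2_eq_square by (rule mult_right_mono[OF le(1) bx(3)])
  have 1: "cmod (of_real (?x\<^sup>2) * ?e a * cnj (?e b)) \<le> norm ?Z * ?x * 1 * 1"
    unfolding norm_mult complex_mod_cnj norm_of_real abs_power2
    by (rule mult_mono3) (simp_all only: x2 bx zero_le_power2 norm_ge_zero mult_1_right)
  have "cmod (?L a) \<le> norm ?Z" using bx(1)[of a] le(1) by (rule order_trans)
  then have 2: "cmod (?L a * cnj (?L b)) \<le> norm ?Z * ?x"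
    unfolding norm_mult complex_mod_cnj
    by (rule mult_mono) (simp_all only: bx norm_ge_zero)
  have 3: "cmod (?L a * cnj (?e b) * cnj ?s) \<le> ?x * 1 * norm ?Z"
    unfolding norm_mult complex_mod_cnj
    by (rule mult_mono3) (simp_all only: bx le norm_ge_zero)
  have 4: "cmod (?e a * ?s * cnj (?L b)) \<le> 1 * norm ?Z * ?x"
    unfolding norm_mult complex_mod_cnj
    by (rule mult_mono3) (simp_all only: bx le norm_ge_zero)
  show ?thesis
    unfolding eq using order_trans[OF tri add_mono[OF add_mono[OF add_mono[OF 1 2] 3] 4]] by (simp add: mult_ac)
qed

text \<open>Both projections are compared with the projection onto \<open>Z\<close>.\<close>

lemma proj_dist_le_chords:
  fixes p p' :: "'n::finite cproj"
  shows "proj_dist p p' \<le> 4 * (real CARD('n option))\<^sup>2 * (chord k p z + chord k p' z)"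
proof -
  let ?Z = "affine_lift k z" and ?x = "chord k p z" and ?x' = "chord k p' z"
  have "cmod (proj_mat p a b - proj_mat p' a b) \<le> 4 * (?x + ?x')" for a b
  proof -
    let ?N = "norm ?Z"
    have "?N\<^sup>2 * cmod (proj_mat p a b - proj_mat p' a b) = cmod (of_real (?N\<^sup>2) * (proj_mat p a b - proj_mat p' a b))"
      by (simp only: norm_mult norm_of_real) simp
    also have "of_real (?N\<^sup>2) * (proj_mat p a b - proj_mat p' a b) =
      (of_real (?N\<^sup>2) * proj_mat p a b - ?Z $ a * cnj (?Z $ b)) - (of_real (?N\<^sup>2) * proj_mat p' a b - ?Z $ a * cnj (?Z $ b))"
      by (simp add: algebra_simps)
    also have "cmod \<dots> \<le> 4 * ?x * ?N + 4 * ?x' * ?N"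
      by (rule order_trans[OF norm_triangle_ineq4 add_mono]) (rule proj_mat_near)+
    also have "\<dots> \<le> (4 * (?x + ?x')) * ?N\<^sup>2"
    proof -
      have "?N * 1 \<le> ?N * ?N" using norm_affine_lift_ge_1[of k z] by (intro mult_left_mono) auto
      then have "(4 * (?x + ?x')) * ?N \<le> (4 * (?x + ?x')) * ?N\<^sup>2"
        using chord_nonneg[of k p z] chord_nonneg[of k p' z] by (intro mult_left_mono) (auto simp: power2_eq_square)
      then show ?thesis by (simp add: algebra_simps)
    qed
    finally have "?N\<^sup>2 * cmod (proj_mat p a b - proj_mat p' a b) \<le> ?N\<^sup>2 * (4 * (?x + ?x'))"
      by (simp only: mult.commute)
    moreover have "?N\<^sup>2 > 0" using norm_affine_lift_ge_1[of k z] by (intro zero_less_power) linarith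
    ultimately show ?thesis by (rule mult_left_le_imp_le)
  qed
  then have "proj_dist p p' \<le> (\<Sum>a\<in>(UNIV::'n option set). \<Sum>b\<in>(UNIV::'n option set). 4 * (?x + ?x'))"
    unfolding proj_dist_def by (intro sum_mono)
  moreover have "(\<Sum>a\<in>(UNIV::'n option set). \<Sum>b\<in>(UNIV::'n option set). c) = (real CARD('n option))\<^sup>2 * c" for c :: real
    by (simp add: power2_eq_square)
  ultimately show ?thesis by (simp only: mult_ac)
qed

text \<open>The product of \<open>kernel_vec\<close> with \<open>e\<^sup>*\<close>. It is the same for all unit vectors \<open>e\<close> on the line \<open>p\<close>, and
  linear in the projection onto \<open>p\<close>; kernel matrices of nearby poles are therefore close, with no choice of
  phases.\<close>

definition kernel_mat :: "'n::finite option \<Rightarrow> 'n cproj \<Rightarrow> complex^'n \<Rightarrow> 'n \<Rightarrow> 'n option \<Rightarrow> complex" where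
  "kernel_mat k p z j a = proj_mat p k a * z $ j - proj_mat p (skip_index k j) a"

lemma kernel_mat_eq: "kernel_mat k p z j a = kernel_vec k p z (skip_index k j) * cnj (unit_rep p a)"
  unfolding kernel_mat_def kernel_vec_def proj_mat_unit_rep by (simp add: algebra_simps)

lemma kernel_mat_diff: "cmod (kernel_mat k p z j a - kernel_mat k p' z j a) \<le> (1 + norm z) * proj_dist p p'"
proof -
  have "kernel_mat k p z j a - kernel_mat k p' z j a = (proj_mat p k a - proj_mat p' k a) * z $ j
      - (proj_mat p (skip_index k j) a - proj_mat p' (skip_index k j) a)"
    unfolding kernel_mat_def by (simp add: algebra_simps)
  also have "cmod \<dots> \<le> proj_dist p p' * norm z + proj_dist p p'"
  proof (rule order_trans[OF norm_triangle_ineq4], rule add_mono)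
    show "cmod ((proj_mat p k a - proj_mat p' k a) * z $ j) \<le> proj_dist p p' * norm z"
      unfolding norm_mult
      by (rule mult_mono[OF proj_dist_entry Finite_Cartesian_Product.norm_nth_le]) (auto simp: proj_dist_nonneg)
  qed (rule proj_dist_entry)
  finally show ?thesis by (simp add: algebra_simps)
qed

text \<open>Since \<open>kernel_vec\<close> and \<open>-e\<close> differ by a multiple of \<open>Z\<close>, the vector \<open>Z \<and> e\<close> does not change, up to sign, when
  \<open>e\<close> is replaced by \<open>kernel_vec\<close>. So \<open>|(I - P) Z|\<close> is controlled by \<open>|Z|\<close> times the kernel vector.\<close>

lemma chord_le_kernel_mat:
  fixes p :: "'n::finite cproj"
  shows "chord k p z \<le> 2 * real CARD('n option) * norm (affine_lift k z) * (\<Sum>j\<in>UNIV. \<Sum>a\<in>UNIV. cmod (kernel_mat k p z j a))"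
proof -
  let ?Z = "affine_lift k z" and ?e = "unit_rep p" and ?V = "kernel_vec k p z" and ?N = "real CARD('n option)"
  define S where "S = (\<Sum>b\<in>UNIV. cmod (?V b))"
  have S: "S \<ge> 0" unfolding S_def by (intro sum_nonneg) auto
  have row: "cmod (herm_row k (resid p) z a) \<le> norm ?Z * (?N * cmod (?V a) + S)" for a
  proof -
    have "herm_row k (resid p) z a = (\<Sum>b\<in>UNIV. cnj (?e b) * ?e b) * ?Z $ a - ?e a * (\<Sum>b\<in>UNIV. cnj (?e b) * ?Z $ b)"
      by (simp only: herm_row_resid inner_rep_def unit_rep_sum_cnj mult_1_left)
    also have "\<dots> = (\<Sum>b\<in>UNIV. cnj (?e b) * (?Z $ b * ?V a - ?Z $ a * ?V b))"
      unfolding sum_distrib_left sum_distrib_right sum_subtractf[symmetric] kernel_vec_def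
      by (intro sum.cong) (simp_all add: algebra_simps)
    also have "cmod \<dots> \<le> (\<Sum>b\<in>UNIV. norm ?Z * cmod (?V a) + norm ?Z * cmod (?V b))"
    proof (rule order_trans[OF norm_sum], rule sum_mono)
      fix b
      have "cmod (cnj (?e b) * (?Z $ b * ?V a - ?Z $ a * ?V b)) \<le> 1 * cmod (?Z $ b * ?V a - ?Z $ a * ?V b)"
        unfolding norm_mult complex_mod_cnj by (intro mult_right_mono unit_rep_le_1) auto
      also have "\<dots> \<le> norm ?Z * cmod (?V a) + norm ?Z * cmod (?V b)"
        unfolding mult_1_left
        by (rule order_trans[OF norm_triangle_ineq4])
          (auto simp: norm_mult intro!: add_mono mult_right_mono Finite_Cartesian_Product.norm_nth_le)
      finally show "cmod (cnj (?e b) * (?Z $ b * ?V a - ?Z $ a * ?V b)) \<le> norm ?Z * cmod (?V a) + norm ?Z * cmod (?V b)" .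
    qed
    also have "\<dots> = norm ?Z * (?N * cmod (?V a) + S)"
      unfolding S_def by (simp add: sum.distrib sum_distrib_left algebra_simps)
    finally show ?thesis .
  qed
  have "chord k p z \<le> (\<Sum>a\<in>UNIV. cmod (herm_row k (resid p) z a))"
    unfolding chord_eq_norm by (rule order_trans[OF norm_vec_le_sum]) simp
  also have "\<dots> \<le> (\<Sum>a\<in>UNIV. norm ?Z * (?N * cmod (?V a) + S))"
    by (intro sum_mono row)
  also have "\<dots> = 2 * ?N * norm ?Z * S"
    unfolding sum_distrib_left[symmetric] sum.distrib S_def by (simp add: algebra_simps)
  finally have 1: "chord k p z \<le> 2 * ?N * norm ?Z * S" .
  have "1 = (\<Sum>a\<in>UNIV. (cmod (?e a))\<^sup>2)" by (simp add: unit_rep_sum)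
  also have "\<dots> \<le> (\<Sum>a\<in>UNIV. cmod (?e a))"
    by (intro sum_mono) (auto simp: power2_eq_square unit_rep_le_1 mult_left_le)
  finally have "S * 1 \<le> S * (\<Sum>a\<in>UNIV. cmod (?e a))" by (intro mult_left_mono S)
  also have "S = (\<Sum>j\<in>UNIV. cmod (?V (skip_index k j)))"
    unfolding S_def by (subst sum_skip_index[of _ k]) (simp add: kernel_vec_same)
  also have "\<dots> * (\<Sum>a\<in>UNIV. cmod (?e a)) = (\<Sum>j\<in>UNIV. \<Sum>a\<in>UNIV. cmod (kernel_mat k p z j a))"
    unfolding kernel_mat_eq by (simp add: sum_product norm_mult)
  finally have 2: "S \<le> (\<Sum>j\<in>UNIV. \<Sum>a\<in>UNIV. cmod (kernel_mat k p z j a))"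
    unfolding S_def by (subst sum_skip_index[of _ k]) (simp add: kernel_vec_same)
  show ?thesis by (rule order_trans[OF 1 mult_left_mono[OF 2]]) auto
qed

text \<open>Each product in Leibniz's formula contains every row factor and every column factor exactly once.\<close>

lemma norm_det_le:
  fixes A :: "complex^'n^'n"
  assumes "\<And>i j. cmod (A $ i $ j) \<le> r i * c j"
  shows "cmod (det A) \<le> fact CARD('n) * ((\<Prod>i\<in>UNIV. r i) * (\<Prod>j\<in>UNIV. c j))"
proof -
  have "cmod (det A) \<le> (\<Sum>q | q permutes (UNIV::'n set). (\<Prod>i\<in>UNIV. r i) * (\<Prod>j\<in>UNIV. c j))"
    unfolding det_def
  proof (rule order_trans[OF norm_sum], rule sum_mono)
    fix q assume "q \<in> {q. q permutes (UNIV::'n set)}"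
    then have q: "q permutes UNIV" by simp
    have "cmod (of_int (sign q) * (\<Prod>i\<in>UNIV. A $ i $ q i)) = (\<Prod>i\<in>UNIV. cmod (A $ i $ q i))"
      by (simp add: norm_mult prod_norm sign_def)
    also have "\<dots> \<le> (\<Prod>i\<in>UNIV. r i * c (q i))"
      by (intro prod_mono) (auto simp: assms)
    also have "\<dots> = (\<Prod>i\<in>UNIV. r i) * (\<Prod>i\<in>UNIV. c (q i))" by (rule prod.distrib)
    also have "(\<Prod>i\<in>UNIV. c (q i)) = (\<Prod>j\<in>UNIV. c j)"
      using prod.permute[OF q, of c] by (simp add: o_def)
    finally show "cmod (of_int (sign q) * (\<Prod>i\<in>UNIV. A $ i $ q i)) \<le> (\<Prod>i\<in>UNIV. r i) * (\<Prod>j\<in>UNIV. c j)" .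
  qed
  also have "\<dots> = fact CARD('n) * ((\<Prod>i\<in>UNIV. r i) * (\<Prod>j\<in>UNIV. c j))"
    by (simp add: card_permutations[OF refl])
  finally show ?thesis .
qed

text \<open>Row \<open>l\<close> is taken from the Hessian of the kernel with pole \<open>\<omega> l\<close>. For constant \<open>\<omega>\<close> this is the transposed
  Hessian of one kernel.\<close>

definition mixed_matrix :: "'n::finite option \<Rightarrow> real \<Rightarrow> ('n \<Rightarrow> 'n cproj) \<Rightarrow> complex^'n \<Rightarrow> complex^'n^'n" where
  "mixed_matrix k \<delta> \<omega> z = (\<chi> l j. log_hessian k (resid (\<omega> l)) (\<delta>\<^sup>2) z j l)"

lemma norm_det_mixed_le:
  fixes \<omega> :: "'n::finite \<Rightarrow> 'n cproj"
  assumes \<delta>: "\<delta> > 0"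
  shows "cmod (det (mixed_matrix k \<delta> \<omega> z)) \<le> fact CARD('n) * 2 ^ CARD('n) * (\<Prod>l\<in>UNIV. 1 / ((chord k (\<omega> l) z)\<^sup>2 + \<delta>\<^sup>2))"
proof -
  have "cmod (det (mixed_matrix k \<delta> \<omega> z)) \<le> fact CARD('n) * ((\<Prod>l\<in>UNIV. 1 / ((chord k (\<omega> l) z)\<^sup>2 + \<delta>\<^sup>2)) * (\<Prod>j\<in>(UNIV::'n set). 2))"
    by (rule norm_det_le) (use norm_log_hessian_le[OF \<delta>] in \<open>auto simp: mixed_matrix_def\<close>)
  then show ?thesis by (simp add: mult_ac)
qed

text \<open>Row \<open>l\<close> nearly annihilates the kernel matrix of its own pole; replacing it by that of the base pole costs the
  distance between the two poles.\<close>

lemma mixed_matrix_kernel_le: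
  fixes \<omega> :: "'n::finite \<Rightarrow> 'n cproj"
  assumes \<delta>: "\<delta> > 0"
  shows "cmod (\<Sum>j\<in>UNIV. mixed_matrix k \<delta> \<omega> z $ l $ j * kernel_mat k (\<omega> base) z j a) \<le>
    (2 * real CARD('n) * (1 + norm z) + 1) * (\<delta> + (\<Sum>l\<in>UNIV. proj_dist (\<omega> l) (\<omega> base))) / ((chord k (\<omega> l) z)\<^sup>2 + \<delta>\<^sup>2)"
proof -
  let ?h = "\<lambda>j. log_hessian k (resid (\<omega> l)) (\<delta>\<^sup>2) z j l" and ?Q = "(chord k (\<omega> l) z)\<^sup>2 + \<delta>\<^sup>2"
  let ?d = "\<Sum>l\<in>UNIV. proj_dist (\<omega> l) (\<omega> base)" and ?n = "real CARD('n)"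
  have Q: "?Q > 0" using \<delta> by (simp add: add_nonneg_pos)
  have "(\<Sum>j\<in>UNIV. mixed_matrix k \<delta> \<omega> z $ l $ j * kernel_mat k (\<omega> base) z j a) =
    (\<Sum>j\<in>UNIV. ?h j * kernel_vec k (\<omega> l) z (skip_index k j)) * cnj (unit_rep (\<omega> l) a)
    - (\<Sum>j\<in>UNIV. ?h j * (kernel_mat k (\<omega> l) z j a - kernel_mat k (\<omega> base) z j a))"
    unfolding mixed_matrix_def sum_distrib_right sum_subtractf[symmetric] kernel_mat_eq[of k "\<omega> l"]
    by (intro sum.cong) (simp_all add: algebra_simps)
  also have "cmod \<dots> \<le> \<delta> / ?Q * 1 + (\<Sum>j\<in>(UNIV::'n set). 2 / ?Q * ((1 + norm z) * ?d))"
  proof (rule order_trans[OF norm_triangle_ineq4], rule add_mono)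
    show "cmod ((\<Sum>j\<in>UNIV. ?h j * kernel_vec k (\<omega> l) z (skip_index k j)) * cnj (unit_rep (\<omega> l) a)) \<le> \<delta> / ?Q * 1"
      unfolding norm_mult complex_mod_cnj using Q \<delta>
      by (intro mult_mono norm_hessian_kernel_le unit_rep_le_1) auto
    have "proj_dist (\<omega> l) (\<omega> base) \<le> ?d"
      by (rule member_le_sum) (auto simp: proj_dist_nonneg)
    then have "(1 + norm z) * proj_dist (\<omega> l) (\<omega> base) \<le> (1 + norm z) * ?d" by (intro mult_left_mono) auto
    then have "cmod (kernel_mat k (\<omega> l) z j a - kernel_mat k (\<omega> base) z j a) \<le> (1 + norm z) * ?d" for j
      by (rule order_trans[OF kernel_mat_diff])
    then have "cmod (?h j * (kernel_mat k (\<omega> l) z j a - kernel_mat k (\<omega> base) z j a)) \<le> 2 / ?Q * ((1 + norm z) * ?d)" for j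
      unfolding norm_mult using Q by (intro mult_mono norm_log_hessian_le[OF \<delta>]) auto
    then show "cmod (\<Sum>j\<in>UNIV. ?h j * (kernel_mat k (\<omega> l) z j a - kernel_mat k (\<omega> base) z j a)) \<le> (\<Sum>j\<in>(UNIV::'n set). 2 / ?Q * ((1 + norm z) * ?d))"
      by (intro order_trans[OF norm_sum] sum_mono)
  qed
  also have "\<dots> = (\<delta> + 2 * ?n * (1 + norm z) * ?d) / ?Q"
    using Q by (simp add: add_divide_distrib algebra_simps)
  also have "\<dots> \<le> (2 * ?n * (1 + norm z) + 1) * (\<delta> + ?d) / ?Q"
  proof (rule divide_right_mono)
    have d: "?d \<ge> 0" by (intro sum_nonneg proj_dist_nonneg)
    have "0 \<le> 2 * ?n * (1 + norm z) * \<delta>" using \<delta> by (intro mult_nonneg_nonneg) auto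
    then show "\<delta> + 2 * ?n * (1 + norm z) * ?d \<le> (2 * ?n * (1 + norm z) + 1) * (\<delta> + ?d)"
      using d by (simp add: distrib_left distrib_right)
  qed (use Q in simp)
  finally show ?thesis .
qed

text \<open>By Cramer's rule a coordinate of a vector \<open>w\<close> times the determinant of \<open>A\<close> is the determinant of \<open>A\<close> with one column
  replaced by \<open>A w\<close>. For \<open>w\<close> a column of the kernel matrix of the base pole, \<open>A w\<close> is small, and the
  coordinates of these columns together control the chord.\<close>

lemma chord_norm_det_mixed_le:
  fixes \<omega> :: "'n::finite \<Rightarrow> 'n cproj"
  assumes \<delta>: "\<delta> > 0"
  defines "n \<equiv> real CARD('n)" and "m \<equiv> real CARD('n option)"
  shows "chord k (\<omega> base) z * cmod (det (mixed_matrix k \<delta> \<omega> z)) \<le>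
    (2 * m * (1 + norm z) * n * m * fact CARD('n) * 2 ^ CARD('n) * (2 * n * (1 + norm z) + 1))
      * (\<delta> + (\<Sum>l\<in>UNIV. proj_dist (\<omega> l) (\<omega> base))) * (\<Prod>l\<in>UNIV. 1 / ((chord k (\<omega> l) z)\<^sup>2 + \<delta>\<^sup>2))"
proof -
  let ?A = "mixed_matrix k \<delta> \<omega> z" and ?P = "\<Prod>l\<in>UNIV. 1 / ((chord k (\<omega> l) z)\<^sup>2 + \<delta>\<^sup>2)"
  define s where "s = \<delta> + (\<Sum>l\<in>UNIV. proj_dist (\<omega> l) (\<omega> base))"
  define K where "K = 2 * n * (1 + norm z) + 1"
  have s: "s > 0" unfolding s_def using \<delta> by (intro add_pos_nonneg sum_nonneg proj_dist_nonneg)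
  have K: "K \<ge> 0" unfolding K_def n_def by simp
  have P: "?P \<ge> 0" by (intro prod_nonneg) simp
  have entry: "cmod (kernel_mat k (\<omega> base) z j0 a) * cmod (det ?A) \<le> fact CARD('n) * 2 ^ CARD('n) * K * s * ?P" for j0 a
  proof -
    define w where "w = (\<chi> j. kernel_mat k (\<omega> base) z j a)"
    \<comment> \<open>Column factors for \<open>norm_det_le\<close>: only the replaced column is small.\<close>
    define c where "c j = (if j = j0 then K * s else 2)" for j :: 'n
    have "kernel_mat k (\<omega> base) z j0 a * det ?A = det (\<chi> i j. if j = j0 then (?A *v w) $ i else ?A $ i $ j)"
      using cramer_lemma[where A = ?A and x = w and k = j0] by (simp add: w_def)
    then have "cmod (kernel_mat k (\<omega> base) z j0 a) * cmod (det ?A) =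
        cmod (det (\<chi> i j. if j = j0 then (?A *v w) $ i else ?A $ i $ j))"
      by (simp flip: norm_mult)
    also have "\<dots> \<le> fact CARD('n) * (?P * (\<Prod>j\<in>UNIV. c j))"
    proof (rule norm_det_le)
      fix i j
      show "cmod ((\<chi> i j. if j = j0 then (?A *v w) $ i else ?A $ i $ j) $ i $ j) \<le> 1 / ((chord k (\<omega> i) z)\<^sup>2 + \<delta>\<^sup>2) * c j"
        using mixed_matrix_kernel_le[OF \<delta>, of k \<omega> z i base a] norm_log_hessian_le[OF \<delta>, of k "\<omega> i" z j i]
        unfolding w_def c_def K_def s_def n_def
        by (simp add: matrix_vector_mult_def) (simp add: mixed_matrix_def)
    qed
    also have "(\<Prod>j\<in>UNIV. c j) = K * s * 2 ^ (CARD('n) - 1)"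
    proof -
      have "(\<Prod>j\<in>UNIV. c j) = c j0 * (\<Prod>j\<in>UNIV - {j0}. c j)" by (rule prod.remove) auto
      also have "(\<Prod>j\<in>UNIV - {j0}. c j) = (\<Prod>j\<in>UNIV - {j0}. 2)" by (rule prod.cong) (auto simp: c_def)
      finally show ?thesis by (simp add: c_def)
    qed
    also have "fact CARD('n) * (?P * (K * s * 2 ^ (CARD('n) - 1))) \<le> fact CARD('n) * (?P * (K * s * 2 ^ CARD('n)))"
      using K s P by (intro mult_left_mono power_increasing mult_nonneg_nonneg) auto
    finally show ?thesis by (simp add: mult_ac)
  qed
  let ?D = "cmod (det ?A)" and ?E = "fact CARD('n) * 2 ^ CARD('n) * K * s * ?P"
  have "chord k (\<omega> base) z * ?D \<le> (2 * m * norm (affine_lift k z) * (\<Sum>j\<in>UNIV. \<Sum>a\<in>UNIV. cmod (kernel_mat k (\<omega> base) z j a))) * ?D"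
    unfolding m_def by (intro mult_right_mono chord_le_kernel_mat) auto
  also have "\<dots> = 2 * m * norm (affine_lift k z) * (\<Sum>j\<in>UNIV. \<Sum>a\<in>UNIV. cmod (kernel_mat k (\<omega> base) z j a) * ?D)"
    by (simp add: sum_distrib_right)
  also have "\<dots> \<le> 2 * m * (1 + norm z) * (\<Sum>j\<in>(UNIV::'n set). \<Sum>a\<in>(UNIV::'n option set). ?E)"
  proof (rule mult_mono)
    show "(\<Sum>j\<in>UNIV. \<Sum>a\<in>UNIV. cmod (kernel_mat k (\<omega> base) z j a) * ?D) \<le> (\<Sum>j\<in>(UNIV::'n set). \<Sum>a\<in>(UNIV::'n option set). ?E)"
      by (intro sum_mono entry)
    show "2 * m * norm (affine_lift k z) \<le> 2 * m * (1 + norm z)"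
      unfolding m_def by (intro mult_left_mono norm_affine_lift_le) auto
  qed (auto intro!: sum_nonneg mult_nonneg_nonneg simp: m_def)
  also have "\<dots> = (2 * m * (1 + norm z) * n * m * fact CARD('n) * 2 ^ CARD('n) * K) * s * ?P"
    by (simp add: n_def m_def)
  finally show ?thesis unfolding K_def s_def .
qed

section \<open>Combining the two determinant bounds\<close>

text \<open>At distance \<open>r\<close> from the pole below the scale \<open>s\<close> this behaves like \<open>s\<^sup>-\<^sup>2 r^-(2n-2)\<close>, above it like \<open>s r^-(2n+1)\<close>. In real
  dimension \<open>2 n\<close> both ends are integrable, and homogeneity makes the integral independent of \<open>s\<close>.\<close>

definition polar_kernel :: "nat \<Rightarrow> real \<Rightarrow> real \<Rightarrow> real" where
  "polar_kernel n s r = s / (r ^ (2 * n - 2) * (s + r) ^ 3)"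

text \<open>Seen from far away all the distances \<open>x l\<close> are comparable, and the gain of Cramer's rule gives the
  power \<open>2 n + 1\<close>.\<close>

lemma far_estimate:
  fixes x :: "'n::finite \<Rightarrow> real"
  assumes C: "C \<ge> 1" and \<delta>: "\<delta> > 0" and d: "d \<ge> 0"
    and lip: "\<And>l. \<bar>x l - x c\<bar> \<le> C * d"
    and F: "x c * F \<le> C * (\<delta> + d) * (\<Prod>l\<in>UNIV. 1 / ((x l)\<^sup>2 + \<delta>\<^sup>2))"
    and far: "2 * C * (\<delta> + d) \<le> x c"
  shows "F \<le> 8 * C * 4 ^ CARD('n) * polar_kernel CARD('n) (\<delta> + d) (x c)"
proof -
  define s r n where "s = \<delta> + d" and "r = x c" and "n = CARD('n)"
  have n: "n \<ge> 1" unfolding n_def by (simp add: Suc_leI)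
  have s: "s > 0" unfolding s_def using \<delta> d by simp
  have "C * d \<le> C * s" unfolding s_def using C \<delta> by (intro mult_left_mono) auto
  have far': "2 * (C * s) \<le> r" using far unfolding s_def r_def by (simp add: mult.assoc)
  have xl: "r / 2 \<le> x l" for l
    using lip[of l] far' \<open>C * d \<le> C * s\<close> unfolding r_def[symmetric] abs_le_iff by linarith
  have "1 * s \<le> C * s" using C s by (intro mult_right_mono) auto
  then have r: "r > 0" "s \<le> r" using far' s by linarith+
  have "(\<Prod>l\<in>UNIV. 1 / ((x l)\<^sup>2 + \<delta>\<^sup>2)) \<le> (\<Prod>l\<in>(UNIV::'n set). 4 / r\<^sup>2)"
  proof (intro prod_mono conjI)
    fix l
    have "(r / 2)\<^sup>2 \<le> (x l)\<^sup>2" using xl[of l] r by (intro power_mono) auto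
    then have "r\<^sup>2 / 4 \<le> (x l)\<^sup>2 + \<delta>\<^sup>2"
      by (intro add_increasing2) (auto simp: power_divide)
    moreover have "0 < r\<^sup>2 / 4" using r by simp
    ultimately have "1 / ((x l)\<^sup>2 + \<delta>\<^sup>2) \<le> 1 / (r\<^sup>2 / 4)"
      by (intro divide_left_mono mult_pos_pos) linarith+
    then show "1 / ((x l)\<^sup>2 + \<delta>\<^sup>2) \<le> 4 / r\<^sup>2" by simp
  qed simp
  then have P: "(\<Prod>l\<in>UNIV. 1 / ((x l)\<^sup>2 + \<delta>\<^sup>2)) \<le> 4 ^ n / r ^ (2 * n)"
    by (simp add: n_def power_divide power_mult)
  have "r * F \<le> C * s * (4 ^ n / r ^ (2 * n))"
    using F unfolding r_def[symmetric] s_def[symmetric]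
    by (rule order_trans) (intro mult_left_mono P mult_nonneg_nonneg; use C s in simp)
  also have "\<dots> = r * (C * 4 ^ n * (s / (r * r ^ (2 * n))))" using r by (simp add: field_simps)
  finally have "F \<le> C * 4 ^ n * (s / (r * r ^ (2 * n)))" using r(1) by (rule mult_left_le_imp_le)
  also have "s / (r * r ^ (2 * n)) \<le> 8 * polar_kernel n s r"
  proof -
    have "(s + r) ^ 3 \<le> (2 * r) ^ 3" using r s by (intro power_mono) auto
    then have "r ^ (2 * n - 2) * (s + r) ^ 3 \<le> r ^ (2 * n - 2) * (8 * r ^ 3)"
      using r by (intro mult_left_mono) (auto simp: power_mult_distrib)
    also have "\<dots> = 8 * (r * r ^ (2 * n))"
    proof -
      have "2 * n - 2 + 3 = Suc (2 * n)" using n by simp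
      then have "r ^ (2 * n - 2) * r ^ 3 = r * r ^ (2 * n)" by (simp flip: power_add)
      then show ?thesis by simp
    qed
    finally have "s / (8 * (r * r ^ (2 * n))) \<le> polar_kernel n s r"
      unfolding polar_kernel_def using r s by (intro divide_left_mono) auto
    then have "8 * (s / (8 * (r * r ^ (2 * n)))) \<le> 8 * polar_kernel n s r" by (rule mult_left_mono) simp
    then show ?thesis by simp
  qed
  finally show ?thesis using C unfolding r_def s_def n_def by (simp add: mult_ac)
qed

text \<open>At distance at most of order \<open>s\<close>, the separation of the poles (or \<open>\<delta>\<close>) prevents all the \<open>x l\<close> from being
  small compared to \<open>s\<close>. The largest one contributes the factor \<open>s\<^sup>-\<^sup>2\<close>, and the other \<open>n - 1\<close> are bounded by means of the smallest.\<close>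

lemma near_estimate:
  fixes x :: "'n::finite \<Rightarrow> real"
  assumes C: "C \<ge> 1" and \<delta>: "\<delta> > 0" and d: "d \<ge> 0" and x: "\<And>l. x l > 0"
    and lip: "\<And>l. \<bar>x l - x c\<bar> \<le> C * d"
    and sep: "d \<le> C * (\<Sum>l\<in>UNIV. x c + x l)"
    and F: "F \<le> C * (\<Prod>l\<in>UNIV. 1 / ((x l)\<^sup>2 + \<delta>\<^sup>2))"
    and near: "x c \<le> 2 * C * (\<delta> + d)"
  shows "\<exists>l. F \<le> 512 * (real CARD('n))\<^sup>2 * C ^ 6 * polar_kernel CARD('n) (\<delta> + d) (x l)"
proof -
  define s n where "s = \<delta> + d" and "n = CARD('n)"
  have n: "n \<ge> 1" unfolding n_def by (simp add: Suc_leI)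
  have s: "s > 0" unfolding s_def using \<delta> d by simp
  have "C * d \<le> C * s" unfolding s_def using C \<delta> by (intro mult_left_mono) auto
  moreover have "x c \<le> 2 * (C * s)" using near unfolding s_def by (simp add: mult.assoc)
  ultimately have xl: "x l \<le> 3 * (C * s)" for l using lip[of l] unfolding abs_le_iff by linarith
  have "Max (range x) \<in> range x" by (rule Max_in) auto
  then obtain M where "Max (range x) = x M" by blast
  then have M: "x l \<le> x M" for l using Max_ge[of "range x" "x l"] by simp
  have "Min (range x) \<in> range x" by (rule Min_in) auto
  then obtain m where "Min (range x) = x m" by blast
  then have m: "x m \<le> x l" for l using Min_le[of "range x" "x l"] by simp
  have "(\<Sum>l\<in>(UNIV::'n set). x c + x l) \<le> (\<Sum>l\<in>(UNIV::'n set). x M + x M)"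
    by (intro sum_mono add_mono M)
  then have "d \<le> C * (2 * n * x M)"
    using C by (intro order_trans[OF sep mult_left_mono]) (auto simp: n_def)
  moreover have "1 * \<delta> \<le> 2 * real n * C * \<delta>"
  proof (rule mult_right_mono)
    have "1 * 1 \<le> (2 * real n) * C" using n C by (intro mult_mono) auto
    then show "1 \<le> 2 * real n * C" by (simp only: mult_1_left)
  qed (use \<delta> in simp)
  ultimately have sM: "s \<le> 2 * n * C * (x M + \<delta>)" unfolding s_def by (simp add: algebra_simps)
  have "s\<^sup>2 \<le> (2 * n * C * (x M + \<delta>))\<^sup>2" using sM s by (intro power_mono) auto
  also have "\<dots> = 4 * n\<^sup>2 * C\<^sup>2 * (x M + \<delta>)\<^sup>2" by (simp add: power_mult_distrib)
  also have "\<dots> \<le> 4 * n\<^sup>2 * C\<^sup>2 * (2 * ((x M)\<^sup>2 + \<delta>\<^sup>2))"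
  proof (intro mult_left_mono)
    show "(x M + \<delta>)\<^sup>2 \<le> 2 * ((x M)\<^sup>2 + \<delta>\<^sup>2)"
      using sum_squares_bound[of "x M" \<delta>] by (simp add: power2_sum)
  qed (use C in simp)
  also have "\<dots> = (8 * n\<^sup>2 * C\<^sup>2) * ((x M)\<^sup>2 + \<delta>\<^sup>2)" by (simp add: algebra_simps)
  finally have "s\<^sup>2 \<le> (8 * n\<^sup>2 * C\<^sup>2) * ((x M)\<^sup>2 + \<delta>\<^sup>2)" .
  then have PM: "1 / ((x M)\<^sup>2 + \<delta>\<^sup>2) \<le> 8 * n\<^sup>2 * C\<^sup>2 / s\<^sup>2"
    using s \<delta> x[of M] by (simp add: divide_simps add_pos_pos)
  \<comment> \<open>The factor of the largest distance is split off, and the others are compared with the smallest.\<close>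
  have "(\<Prod>l\<in>UNIV. 1 / ((x l)\<^sup>2 + \<delta>\<^sup>2)) = 1 / ((x M)\<^sup>2 + \<delta>\<^sup>2) * (\<Prod>l\<in>UNIV - {M}. 1 / ((x l)\<^sup>2 + \<delta>\<^sup>2))"
    by (rule prod.remove) auto
  also have "\<dots> \<le> (8 * n\<^sup>2 * C\<^sup>2 / s\<^sup>2) * (\<Prod>l\<in>UNIV - {M}. 1 / (x m)\<^sup>2)"
  proof (intro mult_mono PM prod_mono conjI)
    fix l
    have "(x m)\<^sup>2 \<le> (x l)\<^sup>2" using m[of l] x[of m] by (intro power_mono) auto
    then have "(x m)\<^sup>2 \<le> (x l)\<^sup>2 + \<delta>\<^sup>2" by (simp add: add_increasing2)
    then show "1 / ((x l)\<^sup>2 + \<delta>\<^sup>2) \<le> 1 / (x m)\<^sup>2"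
      using x[of m] by (intro divide_left_mono) (auto intro!: mult_pos_pos add_pos_nonneg simp: x less_imp_neq[symmetric])
  qed (use C in \<open>auto intro!: prod_nonneg\<close>)
  also have "(\<Prod>l\<in>UNIV - {M}. 1 / (x m)\<^sup>2) = 1 / x m ^ (2 * n - 2)"
    by (simp add: n_def power_divide power_mult[symmetric] diff_mult_distrib2)
  finally have P: "(\<Prod>l\<in>UNIV. 1 / ((x l)\<^sup>2 + \<delta>\<^sup>2)) \<le> (8 * n\<^sup>2 * C\<^sup>2 / s\<^sup>2) * (1 / x m ^ (2 * n - 2))" .
  have "1 * s \<le> C * s" using C s by (intro mult_right_mono) auto
  then have "s + x m \<le> 4 * C * s" using xl[of m] by (simp add: mult.assoc)
  then have "(s + x m) ^ 3 \<le> (4 * C * s) ^ 3" using s x[of m] by (intro power_mono) auto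
  then have "x m ^ (2 * n - 2) * (s + x m) ^ 3 \<le> x m ^ (2 * n - 2) * (64 * C ^ 3 * s ^ 3)"
    using x[of m] by (intro mult_left_mono) (auto simp: power_mult_distrib)
  then have "s / (x m ^ (2 * n - 2) * (64 * C ^ 3 * s ^ 3)) \<le> polar_kernel n s (x m)"
    unfolding polar_kernel_def using s C x[of m] by (intro divide_left_mono mult_pos_pos) auto
  also have "s / (x m ^ (2 * n - 2) * (64 * C ^ 3 * s ^ 3)) = 1 / (x m ^ (2 * n - 2)) * (1 / s\<^sup>2) / (64 * C ^ 3)"
    using s C x[of m] by (simp add: power2_eq_square power3_eq_cube)
  finally have "1 / (x m ^ (2 * n - 2)) * (1 / s\<^sup>2) / (64 * C ^ 3) \<le> polar_kernel n s (x m)" .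
  moreover have "0 < 64 * C ^ 3" using C by simp
  ultimately have "1 / (x m ^ (2 * n - 2)) * (1 / s\<^sup>2) \<le> polar_kernel n s (x m) * (64 * C ^ 3)"
    by (simp only: pos_divide_le_eq)
  then have G: "1 / (x m ^ (2 * n - 2)) * (1 / s\<^sup>2) \<le> 64 * C ^ 3 * polar_kernel n s (x m)"
    by (simp only: mult.commute)
  have "F \<le> C * ((8 * n\<^sup>2 * C\<^sup>2 / s\<^sup>2) * (1 / x m ^ (2 * n - 2)))"
    by (rule order_trans[OF F mult_left_mono[OF P]]) (use C in simp)
  also have "\<dots> = 8 * n\<^sup>2 * C ^ 3 * (1 / (x m ^ (2 * n - 2)) * (1 / s\<^sup>2))"
    by (simp add: power2_eq_square power3_eq_cube mult_ac)
  also have "\<dots> \<le> 8 * n\<^sup>2 * C ^ 3 * (64 * C ^ 3 * polar_kernel n s (x m))"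
    by (rule mult_left_mono[OF G]) (use C in simp)
  also have "\<dots> = 512 * (real n)\<^sup>2 * C ^ 6 * polar_kernel n s (x m)"
    by (simp add: power_add[symmetric] mult_ac power3_eq_cube numeral_eq_Suc)
  finally show ?thesis unfolding s_def n_def by blast
qed

lemma polar_kernel_bound:
  fixes x :: "'n::finite \<Rightarrow> real"
  assumes C: "C \<ge> 1" and \<delta>: "\<delta> > 0" and d: "d \<ge> 0" and x: "\<And>l. x l > 0"
    and lip: "\<And>l. \<bar>x l - x c\<bar> \<le> C * d"
    and sep: "d \<le> C * (\<Sum>l\<in>UNIV. x c + x l)"
    and F: "F \<le> C * (\<Prod>l\<in>UNIV. 1 / ((x l)\<^sup>2 + \<delta>\<^sup>2))"
    and F': "x c * F \<le> C * (\<delta> + d) * (\<Prod>l\<in>UNIV. 1 / ((x l)\<^sup>2 + \<delta>\<^sup>2))"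
  shows "F \<le> (512 * (real CARD('n))\<^sup>2 * C ^ 6 + 8 * C * 4 ^ CARD('n)) *
    (\<Sum>l\<in>UNIV. polar_kernel CARD('n) (\<delta> + d) (x l))"
proof -
  let ?g = "\<lambda>l. polar_kernel CARD('n) (\<delta> + d) (x l)"
  have g: "?g l \<ge> 0" for l
    unfolding polar_kernel_def using \<delta> d less_imp_le[OF x[of l]] by (intro divide_nonneg_nonneg mult_nonneg_nonneg zero_le_power) auto
  then have le: "?g l \<le> (\<Sum>l\<in>UNIV. ?g l)" for l by (intro member_le_sum) auto
  have "\<exists>l. F \<le> (512 * (real CARD('n))\<^sup>2 * C ^ 6 + 8 * C * 4 ^ CARD('n)) * ?g l"
  proof (cases "2 * C * (\<delta> + d) \<le> x c")
    case True
    have "8 * C * 4 ^ CARD('n) * ?g c \<le> (512 * (real CARD('n))\<^sup>2 * C ^ 6 + 8 * C * 4 ^ CARD('n)) * ?g c"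
      using g C by (intro mult_right_mono) auto
    with far_estimate[where x = x and c = c, OF C \<delta> d lip F' True] show ?thesis by (meson order_trans)
  next
    case False
    then obtain l where "F \<le> 512 * (real CARD('n))\<^sup>2 * C ^ 6 * ?g l"
      using near_estimate[where x = x and c = c, OF C \<delta> d x lip sep F] by auto
    also have "\<dots> \<le> (512 * (real CARD('n))\<^sup>2 * C ^ 6 + 8 * C * 4 ^ CARD('n)) * ?g l"
      using g C by (intro mult_right_mono) auto
    finally show ?thesis by blast
  qed
  then obtain l where "F \<le> (512 * (real CARD('n))\<^sup>2 * C ^ 6 + 8 * C * 4 ^ CARD('n)) * ?g l" by blast
  also have "\<dots> \<le> (512 * (real CARD('n))\<^sup>2 * C ^ 6 + 8 * C * 4 ^ CARD('n)) * (\<Sum>l\<in>UNIV. ?g l)"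
    using C by (intro mult_left_mono le) auto
  finally show ?thesis .
qed

section \<open>Uniform integrability of the polar kernel\<close>

text \<open>A measure of the distance of the tuple \<open>\<omega>\<close> from the diagonal.\<close>

definition spread :: "'n::finite \<Rightarrow> ('n \<Rightarrow> 'n cproj) \<Rightarrow> real" where
  "spread base \<omega> = (\<Sum>l\<in>UNIV. proj_dist (\<omega> l) (\<omega> base))"

lemma spread_nonneg: "spread base \<omega> \<ge> 0"
  unfolding spread_def by (intro sum_nonneg proj_dist_nonneg)

lemma det_mixed_bound:
  fixes k :: "'n::finite option" and base :: 'n
  assumes Rad: "Rad \<ge> 0"
  shows "\<exists>K>0. \<forall>\<omega> \<delta> z. \<delta> > 0 \<longrightarrow> norm z \<le> Rad \<longrightarrow> (\<forall>l. chord k (\<omega> l) z > 0) \<longrightarrow>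
    cmod (det (mixed_matrix k \<delta> \<omega> z)) \<le>
      K * (\<Sum>l\<in>UNIV. polar_kernel CARD('n) (\<delta> + spread base \<omega>) (chord k (\<omega> l) z))"
proof -
  define n m where "n = real CARD('n)" and "m = real CARD('n option)"
  define c2 where "c2 = fact CARD('n) * 2 ^ CARD('n) * (1::real)"
  define c3 where "c3 = 2 * m * (1 + Rad) * n * m * fact CARD('n) * 2 ^ CARD('n) * (2 * n * (1 + Rad) + 1)"
  define C where "C = 1 + (1 + Rad) + 4 * m\<^sup>2 + c2 + c3"
  have nn: "n \<ge> 0" "m \<ge> 0" "c2 \<ge> 0" "c3 \<ge> 0" "4 * m\<^sup>2 \<ge> 0"
    unfolding n_def m_def c2_def c3_def using Rad by auto
  have C: "C \<ge> 1" "1 + Rad \<le> C" "4 * m\<^sup>2 \<le> C" "c2 \<le> C" "c3 \<le> C"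
    unfolding C_def using nn Rad by linarith+
  define K where "K = 512 * (real CARD('n))\<^sup>2 * C ^ 6 + 8 * C * 4 ^ CARD('n)"
  have "K > 0" unfolding K_def using C(1) by (intro add_nonneg_pos) auto
  moreover have "cmod (det (mixed_matrix k \<delta> \<omega> z)) \<le>
      K * (\<Sum>l\<in>UNIV. polar_kernel CARD('n) (\<delta> + spread base \<omega>) (chord k (\<omega> l) z))"
    if \<delta>: "\<delta> > 0" and z: "norm z \<le> Rad" and pos: "\<And>l. chord k (\<omega> l) z > 0" for \<omega> \<delta> z
    unfolding K_def
  proof (rule polar_kernel_bound[where c = base])
    let ?P = "\<Prod>l\<in>UNIV. 1 / ((chord k (\<omega> l) z)\<^sup>2 + \<delta>\<^sup>2)"
    have P: "?P \<ge> 0" by (intro prod_nonneg) simp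
    have lift: "norm (affine_lift k z) \<le> C" using norm_affine_lift_le[of k z] z C(2) by linarith
    show "\<bar>chord k (\<omega> l) z - chord k (\<omega> base) z\<bar> \<le> C * spread base \<omega>" for l
    proof -
      have "proj_dist (\<omega> l) (\<omega> base) \<le> spread base \<omega>"
        unfolding spread_def by (rule member_le_sum) (auto simp: proj_dist_nonneg)
      then have "norm (affine_lift k z) * proj_dist (\<omega> l) (\<omega> base) \<le> C * spread base \<omega>"
        using lift C by (intro mult_mono) (auto simp: proj_dist_nonneg)
      then show ?thesis using chord_lipschitz[of k "\<omega> l" z "\<omega> base"] by linarith
    qed
    show "spread base \<omega> \<le> C * (\<Sum>l\<in>UNIV. chord k (\<omega> base) z + chord k (\<omega> l) z)"
    proof -
      have "spread base \<omega> \<le> (\<Sum>l\<in>UNIV. 4 * m\<^sup>2 * (chord k (\<omega> l) z + chord k (\<omega> base) z))"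
        unfolding spread_def m_def by (intro sum_mono proj_dist_le_chords)
      also have "\<dots> \<le> (\<Sum>l\<in>UNIV. C * (chord k (\<omega> base) z + chord k (\<omega> l) z))"
      proof (rule sum_mono)
        fix l
        have "4 * m\<^sup>2 * (chord k (\<omega> base) z + chord k (\<omega> l) z) \<le> C * (chord k (\<omega> base) z + chord k (\<omega> l) z)"
          by (intro mult_right_mono C add_nonneg_nonneg chord_nonneg)
        then show "4 * m\<^sup>2 * (chord k (\<omega> l) z + chord k (\<omega> base) z) \<le> C * (chord k (\<omega> base) z + chord k (\<omega> l) z)"
          by (simp only: add.commute)
      qed
      finally show ?thesis by (simp only: sum_distrib_left)
    qed
    show "cmod (det (mixed_matrix k \<delta> \<omega> z)) \<le> C * ?P"
      by (rule order_trans[OF norm_det_mixed_le[OF \<delta>] mult_right_mono[OF _ P]]) (use C(4) in \<open>simp add: c2_def\<close>)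
    show "chord k (\<omega> base) z * cmod (det (mixed_matrix k \<delta> \<omega> z)) \<le> C * (\<delta> + spread base \<omega>) * ?P"
    proof -
      have "2 * m * (1 + norm z) * n * m * fact CARD('n) * 2 ^ CARD('n) * (2 * n * (1 + norm z) + 1) \<le> c3"
        unfolding c3_def using z nn Rad by (intro mult_mono add_mono mult_nonneg_nonneg) auto
      then have "2 * m * (1 + norm z) * n * m * fact CARD('n) * 2 ^ CARD('n) * (2 * n * (1 + norm z) + 1) \<le> C"
        using C(5) by linarith
      then show ?thesis
        by (intro order_trans[OF chord_norm_det_mixed_le[OF \<delta>, where base = base, folded n_def m_def spread_def]]
          mult_right_mono P) (use \<delta> spread_nonneg[of base \<omega>] in auto)
    qed
  qed (use C \<delta> pos spread_nonneg in auto)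
  ultimately show ?thesis by blast
qed

text \<open>If the coordinate \<open>e\<^sub>k\<close> of the unit vector of the pole is not small, the pole lies in the chart at \<open>a = e / e\<^sub>k\<close>, and the
  kernel vector is \<open>e\<^sub>k (z - a)\<close>. Otherwise the pole is so far away that the chord is bounded below on the ball, and
  \<open>a = 0\<close> will do.\<close>

lemma chord_ge_distance:
  fixes k :: "'n::finite option"
  assumes Rad: "Rad \<ge> 0"
  shows "\<exists>\<kappa>>0. \<forall>p. \<exists>a. \<forall>z. norm z \<le> Rad \<longrightarrow> \<kappa> * norm (z - a) \<le> chord k p z"
proof -
  define n where "n = real CARD('n)"
  have n: "n \<ge> 1" unfolding n_def by (simp add: Suc_leI)
  \<comment> \<open>Threshold for \<open>|e\<^sub>k|\<close>: small enough that \<open>e\<^sub>k z\<close> is negligible against \<open>e\<close> on the whole ball.\<close>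
  define c where "c = 1 / (4 * n * (1 + Rad))"
  define \<kappa> where "\<kappa> = c / (4 * n)"
  have c: "c > 0" unfolding c_def using n Rad by simp
  have nR: "1 \<le> n * (1 + Rad)" using mult_mono[of 1 n 1 "1 + Rad"] n Rad by simp
  have c1: "c \<le> 1 / 4" unfolding c_def using nR n Rad by (simp add: divide_simps mult.assoc)
  have cR: "n * c * Rad \<le> 1 / 4" 
  proof -
    have "n * c = 1 / (4 * (1 + Rad))" unfolding c_def using n by simp
    then have "n * c * Rad = 1 / (4 * (1 + Rad)) * Rad" by (simp only:)
    also have "1 / (4 * (1 + Rad)) * Rad \<le> 1 / 4" using Rad by (simp add: divide_simps)
    finally show ?thesis .
  qed
  have vec: "cmod (unit_rep p k * z $ j - unit_rep p (skip_index k j)) \<le> 2 * chord k p z" for p and z :: "complex^'n" and j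
    using kernel_vec_le[of k p z "skip_index k j"] unfolding kernel_vec_def by simp
  have "\<exists>a. \<forall>z. norm z \<le> Rad \<longrightarrow> \<kappa> * norm (z - a) \<le> chord k p z" for p
  proof (cases "cmod (unit_rep p k) \<ge> c")
    case True
    then have nz: "unit_rep p k \<noteq> 0" using c by auto
    define a where "a = (\<chi> j. unit_rep p (skip_index k j) / unit_rep p k)"
    have "\<kappa> * norm (z - a) \<le> chord k p z" for z
    proof -
      have 1: "c * cmod (z $ j - a $ j) \<le> 2 * chord k p z" for j
      proof -
        have "c * cmod (z $ j - a $ j) \<le> cmod (unit_rep p k) * cmod (z $ j - a $ j)"
          using True by (intro mult_right_mono) auto
        also have "\<dots> = cmod (unit_rep p k * z $ j - unit_rep p (skip_index k j))"
          unfolding norm_mult[symmetric] a_def using nz by (simp add: right_diff_distrib)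
        finally show ?thesis using vec[of p z j] by linarith
      qed
      have "c * norm (z - a) \<le> c * (\<Sum>j\<in>UNIV. cmod (z $ j - a $ j))"
        using c by (intro mult_left_mono order_trans[OF norm_vec_le_sum]) auto
      also have "\<dots> \<le> (\<Sum>j\<in>(UNIV::'n set). 2 * chord k p z)"
        unfolding sum_distrib_left by (intro sum_mono 1)
      also have "\<dots> = 2 * n * chord k p z" by (simp add: n_def)
      also have "\<dots> \<le> 4 * n * chord k p z" using n chord_nonneg[of k p z] by (intro mult_right_mono) auto
      finally show ?thesis unfolding \<kappa>_def using n by (simp add: divide_le_eq mult_ac)
    qed
    then show ?thesis by blast
  next
    case False
    have "\<kappa> * norm (z - 0) \<le> chord k p z" if z: "norm z \<le> Rad" for z
    proof -
      have le: "cmod (unit_rep p (skip_index k j)) \<le> 2 * chord k p z + c * Rad" for j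
      proof -
        have "cmod (unit_rep p (skip_index k j)) \<le> cmod (unit_rep p k * z $ j) + cmod (unit_rep p k * z $ j - unit_rep p (skip_index k j))"
          using norm_triangle_ineq4[of "unit_rep p k * z $ j" "unit_rep p k * z $ j - unit_rep p (skip_index k j)"] by simp
        moreover have "cmod (unit_rep p k * z $ j) \<le> c * Rad"
          unfolding norm_mult using False z Finite_Cartesian_Product.norm_nth_le[of z j] c by (intro mult_mono) auto
        ultimately show ?thesis using vec[of p z j] by linarith
      qed
      have "1 = (cmod (unit_rep p k))\<^sup>2 + (\<Sum>j\<in>UNIV. (cmod (unit_rep p (skip_index k j)))\<^sup>2)"
        using unit_rep_sum[of p] by (subst (asm) sum_skip_index[of _ k]) simp
      also have "\<dots> \<le> 1 / 4 + (\<Sum>j\<in>(UNIV::'n set). 2 * chord k p z + c * Rad)"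
      proof (intro add_mono sum_mono)
        have "(cmod (unit_rep p k))\<^sup>2 \<le> 1 * (1 / 4)"
          unfolding power2_eq_square using False c1 unit_rep_le_1[of p k] by (intro mult_mono) auto
        then show "(cmod (unit_rep p k))\<^sup>2 \<le> 1 / 4" by simp
        fix j
        have "(cmod (unit_rep p (skip_index k j)))\<^sup>2 \<le> 1 * cmod (unit_rep p (skip_index k j))"
          unfolding power2_eq_square by (intro mult_right_mono unit_rep_le_1) auto
        then show "(cmod (unit_rep p (skip_index k j)))\<^sup>2 \<le> 2 * chord k p z + c * Rad" using le[of j] by linarith
      qed
      also have "\<dots> = 1 / 4 + 2 * n * chord k p z + n * c * Rad" by (simp add: n_def algebra_simps)
      finally have half: "1 / 2 \<le> 2 * n * chord k p z" using cR by linarith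
      have "4 * n * (\<kappa> * norm z) = c * norm z" unfolding \<kappa>_def using n by simp
      also have "\<dots> \<le> c * Rad" using z c by (intro mult_left_mono) auto
      also have "\<dots> \<le> n * c * Rad" using n c Rad by (intro mult_right_mono) auto
      also have "\<dots> \<le> 1 / 2" using cR by linarith
      also note half
      also have "2 * n * chord k p z \<le> 4 * n * chord k p z" using n chord_nonneg[of k p z] by (intro mult_right_mono) auto
      finally have "(4 * n) * (\<kappa> * norm z) \<le> (4 * n) * chord k p z" .
      then have "\<kappa> * norm z \<le> chord k p z" by (rule mult_left_le_imp_le) (use n in simp)
      then show ?thesis by simp
    qed
    then show ?thesis by blast
  qed
  moreover have "\<kappa> > 0" unfolding \<kappa>_def using c n by simp
  ultimately show ?thesis by blast
qed

lemma polar_kernel_antimono: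
  assumes "s > 0" "0 < b" "b \<le> r"
  shows "polar_kernel n s r \<le> polar_kernel n s b"
  unfolding polar_kernel_def using assms by (intro divide_left_mono mult_mono power_mono mult_pos_pos) auto

lemma polar_kernel_scale:
  assumes "s > 0" "t \<ge> 0" "n \<ge> 1"
  shows "polar_kernel n s (s * t) = polar_kernel n 1 t / s ^ (2 * n)"
proof -
  have "s + s * t = s * (1 + t)" by (simp add: algebra_simps)
  moreover have "s ^ (2 * n) * s = s ^ (2 * n - 2) * s ^ 3"
  proof -
    have "Suc (2 * n) = 2 * n - 2 + 3" using assms(3) by simp
    then show ?thesis by (metis power_Suc2 power_add)
  qed
  ultimately show ?thesis
    unfolding polar_kernel_def using assms
    by (simp add: power_mult_distrib divide_simps) (simp add: mult_ac)
qed

lemma measurable_polar_kernel [measurable]: "polar_kernel n s \<in> borel_measurable borel"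
  unfolding polar_kernel_def by measurable

text \<open>Every \<open>t\<close> in \<open>(0, 1]\<close> lies in one of the shells \<open>2^-(k+1) < t \<le> 2^-k\<close>.\<close>

lemma dyadic_shell:
  fixes t :: real
  assumes "0 < t" "t \<le> 1"
  shows "\<exists>k::nat. (1/2) ^ Suc k < t \<and> t \<le> (1/2) ^ k"
proof -
  define P where "P k \<longleftrightarrow> (1/2) ^ k < t" for k :: nat
  have "\<exists>k. P k" unfolding P_def using real_arch_pow_inv[of t "1/2"] assms by auto
  then have L: "P (LEAST k. P k)" by (rule LeastI_ex)
  have "\<not> P 0" unfolding P_def using assms by simp
  with L obtain j where j: "(LEAST k. P k) = Suc j" by (cases "LEAST k. P k") auto
  have "\<not> P j" by (rule not_less_Least) (simp add: j)
  with L j show ?thesis unfolding P_def by (metis not_less)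
qed

text \<open>On the shell \<open>|x| \<approx> 2^-k\<close> the kernel is of order \<open>2^(k(2n-2))\<close> and the volume of order \<open>2^(-2nk)\<close>; on the shell
  \<open>|x| \<approx> 2^k\<close> they are of order \<open>2^(-k(2n+1))\<close> and \<open>2^(2nk)\<close>. Both resulting series are geometric.\<close>

lemma polar_kernel_integrable_1:
  "(\<integral>\<^sup>+ x. ennreal (polar_kernel CARD('n) 1 (norm (x::complex^'n))) \<partial>lborel) < \<infinity>"
proof -
  let ?n = "CARD('n)"
  have n: "?n \<ge> 1" by (simp add: Suc_leI)
  define D where "D = 2 * ?n"
  have D: "D \<ge> 2" unfolding D_def using n by simp
  define \<beta> where "\<beta> = unit_ball_vol (real D)"
  have \<beta>: "\<beta> \<ge> 0" unfolding \<beta>_def by simp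
  have vol: "emeasure lborel (cball (0::complex^'n) r) = ennreal (\<beta> * r ^ D)" if "r \<ge> 0" for r
    using emeasure_cball[OF that, of "0::complex^'n"] unfolding \<beta>_def D_def by (simp add: mult.commute)
  \<comment> \<open>\<open>f k\<close> majorises the kernel on the shells inside the unit ball, \<open>g k\<close> on those outside.\<close>
  define f g :: "nat \<Rightarrow> complex^'n \<Rightarrow> ennreal"
    where "f k x = ennreal ((2 ^ Suc k) ^ (D - 2)) * indicator (cball 0 ((1/2) ^ k)) x"
    and "g k x = ennreal ((1/2) ^ k * ((1/2) ^ k) ^ D) * indicator (cball 0 (2 ^ Suc k)) x" for k x
  have mem_le: "h k \<le> (\<Sum>k. h k)" for h :: "nat \<Rightarrow> ennreal" and k
    using sum_le_suminf[of h "{k}"] by simp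
  have bound: "ennreal (polar_kernel ?n 1 (norm x)) \<le> (\<Sum>k. f k x) + (\<Sum>k. g k x)" for x
  proof (cases "norm x \<le> 1")
    case True
    show ?thesis
    proof (cases "x = 0")
      case True
      have "polar_kernel ?n 1 0 \<le> 1" unfolding polar_kernel_def by (cases "2 * ?n - 2") auto
      moreover have "f 0 0 \<ge> 1" unfolding f_def using one_le_power[of 2 "D - 2"] by simp
      ultimately have "ennreal (polar_kernel ?n 1 (norm x)) \<le> f 0 x"
        using True by - (rule order_trans[of _ 1 "f 0 x"], simp_all add: ennreal_le_1)
      also have "\<dots> \<le> (\<Sum>k. f k x)" by (rule mem_le)
      finally show ?thesis by (simp add: add_increasing2)
    next
      case False
      then obtain k where k: "(1/2) ^ Suc k < norm x" "norm x \<le> (1/2) ^ k"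
        using dyadic_shell[of "norm x"] True by auto
      have "polar_kernel ?n 1 (norm x) \<le> polar_kernel ?n 1 ((1/2) ^ Suc k)"
        using k by (intro polar_kernel_antimono) auto
      also have "\<dots> \<le> 1 / ((1/2) ^ Suc k) ^ (D - 2)"
      proof -
        have "1 * 1 \<le> 1 * (1 + (1/2) ^ Suc k :: real) ^ 3" by (intro mult_mono one_le_power) auto
        then have "((1/2) ^ Suc k) ^ (D - 2) * 1 \<le> ((1/2) ^ Suc k) ^ (D - 2) * (1 + (1/2) ^ Suc k :: real) ^ 3"
          by (intro mult_left_mono) auto
        then show ?thesis unfolding polar_kernel_def D_def by (intro divide_left_mono mult_pos_pos) (auto intro: add_pos_pos)
      qed
      also have "\<dots> = (2 ^ Suc k) ^ (D - 2)" by (simp add: power_one_over power_divide)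
      finally have "ennreal (polar_kernel ?n 1 (norm x)) \<le> f k x"
        unfolding f_def using k(2) by (simp add: ennreal_leI)
      also have "\<dots> \<le> (\<Sum>k. f k x)" by (rule mem_le)
      finally show ?thesis by (simp add: add_increasing2)
    qed
  next
    case False
    then have x0: "norm x > 0" by linarith
    have "0 < inverse (norm x)" "inverse (norm x) \<le> 1"
      using False by (auto simp: inverse_le_1_iff)
    from dyadic_shell[OF this] obtain k where k: "(1/2) ^ Suc k < inverse (norm x)" "inverse (norm x) \<le> (1/2) ^ k"
      by blast
    have k1: "norm x < 2 ^ Suc k" using k(1) x0 by (simp add: field_simps)
    have k2: "2 ^ k \<le> norm x" using k(2) x0 by (simp add: field_simps)
    have "polar_kernel ?n 1 (norm x) \<le> polar_kernel ?n 1 (2 ^ k)"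
      using k2 by (intro polar_kernel_antimono) auto
    also have "\<dots> \<le> 1 / ((2 ^ k) ^ (D - 2) * (2 ^ k) ^ 3)"
      unfolding polar_kernel_def D_def
      by (intro divide_left_mono mult_left_mono power_mono mult_pos_pos) (auto intro: add_pos_pos)
    also have "(2 ^ k) ^ (D - 2) * (2 ^ k) ^ 3 = (2::real) ^ k * (2 ^ k) ^ D"
    proof -
      have "D - 2 + 3 = Suc D" using D by simp
      then show ?thesis by (metis power_Suc power_add)
    qed
    also have "1 / ((2::real) ^ k * (2 ^ k) ^ D) = (1/2) ^ k * ((1/2) ^ k) ^ D" by (simp add: power_one_over power_divide)
    finally have "ennreal (polar_kernel ?n 1 (norm x)) \<le> g k x"
      unfolding g_def using k1 by (simp add: ennreal_leI)
    also have "\<dots> \<le> (\<Sum>k. g k x)" by (rule mem_le)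
    finally show ?thesis by (simp add: add_increasing)
  qed
  have If: "(\<integral>\<^sup>+x. f k x \<partial>lborel) = ennreal (\<beta> * 2 ^ (D - 2) * (1/4) ^ k)" for k
  proof -
    have "(\<integral>\<^sup>+x. f k x \<partial>lborel) = ennreal ((2 ^ Suc k) ^ (D - 2)) * ennreal (\<beta> * ((1/2) ^ k) ^ D)"
      unfolding f_def by (subst nn_integral_cmult_indicator) (auto simp: vol)
    also have "\<dots> = ennreal ((2 ^ Suc k) ^ (D - 2) * (\<beta> * ((1/2) ^ k) ^ D))"
      using \<beta> by (simp add: ennreal_mult)
    also have "(2 ^ Suc k) ^ (D - 2) * (\<beta> * ((1/2) ^ k) ^ D) = \<beta> * 2 ^ (D - 2) * (1/4) ^ k"
    proof -
      obtain E where E: "D = E + 2" using D by (metis le_add_diff_inverse2)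
      have "(2 ^ Suc k) ^ E * ((1/2) ^ k) ^ (E + 2) = (2::real) ^ E * ((2 ^ k) ^ E * ((1/2) ^ k) ^ E) * ((1/2) ^ k)\<^sup>2"
        by (simp add: power_mult_distrib power_add power2_eq_square mult_ac)
      also have "((2::real) ^ k) ^ E * ((1/2) ^ k) ^ E = 1"
        by (simp flip: power_mult_distrib)
      also have "(((1::real)/2) ^ k)\<^sup>2 = (1/4) ^ k"
      proof -
        have "(((1::real)/2) ^ k)\<^sup>2 = ((1/2)\<^sup>2) ^ k" by (simp only: power_mult[symmetric] mult.commute)
        moreover have "((1::real)/2)\<^sup>2 = 1/4" by (simp add: power2_eq_square)
        ultimately show ?thesis by simp
      qed
      finally show ?thesis unfolding E by (simp add: mult_ac)
    qed
    finally show ?thesis .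
  qed
  have Ig: "(\<integral>\<^sup>+x. g k x \<partial>lborel) = ennreal (\<beta> * 2 ^ D * (1/2) ^ k)" for k
  proof -
    have "(\<integral>\<^sup>+x. g k x \<partial>lborel) = ennreal ((1/2) ^ k * ((1/2) ^ k) ^ D) * ennreal (\<beta> * (2 ^ Suc k) ^ D)"
      unfolding g_def by (subst nn_integral_cmult_indicator) (auto simp: vol)
    also have "\<dots> = ennreal (((1/2) ^ k * ((1/2) ^ k) ^ D) * (\<beta> * (2 ^ Suc k) ^ D))"
      using \<beta> by (simp add: ennreal_mult)
    also have "((1/2) ^ k * ((1/2) ^ k) ^ D) * (\<beta> * (2 ^ Suc k) ^ D) = \<beta> * 2 ^ D * (1/2) ^ k"
    proof -
      have "((2::real) ^ k) ^ D * ((1/2) ^ k) ^ D = 1" by (simp flip: power_mult_distrib)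
      moreover have "((1/2) ^ k * ((1/2) ^ k) ^ D) * (\<beta> * (2 ^ Suc k) ^ D) =
        \<beta> * 2 ^ D * (1/2) ^ k * (((2::real) ^ k) ^ D * ((1/2) ^ k) ^ D)"
        by (simp add: power_mult_distrib mult_ac)
      ultimately show ?thesis by simp
    qed
    finally show ?thesis .
  qed
  have ind: "(\<lambda>x :: complex^'n. c * indicator (cball 0 r) x) \<in> borel_measurable lborel" for c :: ennreal and r
    by (intro borel_measurable_times_ennreal borel_measurable_const borel_measurable_indicator) simp
  have mf: "f k \<in> borel_measurable lborel" "g k \<in> borel_measurable lborel" for k
    unfolding f_def[abs_def] g_def[abs_def] by (rule ind)+
  have fin: "(\<Sum>k. ennreal (c * q ^ k)) < \<infinity>" if "c \<ge> 0" "0 \<le> q" "q < 1" for c q :: real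
  proof -
    have "summable (\<lambda>k. c * q ^ k)" using that by (intro summable_mult summable_geometric) auto
    then have "(\<Sum>k. ennreal (c * q ^ k)) = ennreal (\<Sum>k. c * q ^ k)" using that by (intro suminf_ennreal2) auto
    then show ?thesis by simp
  qed
  have "(\<integral>\<^sup>+ x. ennreal (polar_kernel ?n 1 (norm (x::complex^'n))) \<partial>lborel) \<le>
      (\<integral>\<^sup>+ x. (\<Sum>k. f k x) + (\<Sum>k. g k x) \<partial>lborel)"
    by (intro nn_integral_mono bound)
  also have "\<dots> = (\<Sum>k. ennreal (\<beta> * 2 ^ (D - 2) * (1/4) ^ k)) + (\<Sum>k. ennreal (\<beta> * 2 ^ D * (1/2) ^ k))"
    using mf by (subst nn_integral_add) (auto simp: nn_integral_suminf If Ig)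
  also have "\<dots> < \<infinity>"
  proof -
    have "(\<Sum>k. ennreal (\<beta> * 2 ^ (D - 2) * (1/4) ^ k)) < \<infinity>" by (rule fin) (use \<beta> in auto)
    moreover have "(\<Sum>k. ennreal (\<beta> * 2 ^ D * (1/2) ^ k)) < \<infinity>" by (rule fin) (use \<beta> in auto)
    ultimately show ?thesis by (simp only: infinity_ennreal_def ennreal_add_less_top)
  qed
  finally show ?thesis .
qed

text \<open>The substitution \<open>z = a + (s / \<kappa>) x\<close>.\<close>

lemma polar_kernel_integral_bound:
  fixes a :: "complex^'n"
  assumes \<kappa>: "\<kappa> > 0" and s: "s > 0"
  shows "(\<integral>\<^sup>+ z. ennreal (polar_kernel CARD('n) s (\<kappa> * norm (z - a))) \<partial>lborel) =
    ennreal ((1 / \<kappa>) ^ (2 * CARD('n))) * (\<integral>\<^sup>+ x. ennreal (polar_kernel CARD('n) 1 (norm (x::complex^'n))) \<partial>lborel)"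
proof -
  let ?n = "CARD('n)"
  have n: "?n \<ge> 1" by (simp add: Suc_leI)
  define c where "c = s / \<kappa>"
  have c: "c > 0" unfolding c_def using \<kappa> s by simp
  have "(\<integral>\<^sup>+ z. ennreal (polar_kernel ?n s (\<kappa> * norm (z - a))) \<partial>lborel) =
    (\<integral>\<^sup>+ z. ennreal (polar_kernel ?n s (\<kappa> * norm (z - a))) \<partial>(density (distr lborel borel (\<lambda>x. a + c *\<^sub>R x)) (\<lambda>_. \<bar>c\<bar>^DIM(complex^'n))))"
    using lborel_affine[of c a] c by simp
  also have "\<dots> = (\<integral>\<^sup>+ x. ennreal (\<bar>c\<bar>^(2 * ?n)) * ennreal (polar_kernel ?n s (\<kappa> * norm (c *\<^sub>R (x::complex^'n)))) \<partial>lborel)"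
    by (subst nn_integral_density) (auto simp: nn_integral_distr mult.commute)
  also have "\<dots> = (\<integral>\<^sup>+ x. ennreal ((1 / \<kappa>) ^ (2 * ?n)) * ennreal (polar_kernel ?n 1 (norm (x::complex^'n))) \<partial>lborel)"
  proof (intro nn_integral_cong)
    fix x :: "complex^'n"
    have "\<kappa> * norm (c *\<^sub>R x) = s * norm x" unfolding c_def using \<kappa> s by simp
    then have "polar_kernel ?n s (\<kappa> * norm (c *\<^sub>R x)) = polar_kernel ?n 1 (norm x) / s ^ (2 * ?n)"
      by (simp only: polar_kernel_scale[OF s norm_ge_zero n])
    then have "\<bar>c\<bar>^(2 * ?n) * polar_kernel ?n s (\<kappa> * norm (c *\<^sub>R x)) = (1 / \<kappa>) ^ (2 * ?n) * polar_kernel ?n 1 (norm x)"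
      unfolding c_def using \<kappa> s by (simp add: power_divide)
    then show "ennreal (\<bar>c\<bar>^(2 * ?n)) * ennreal (polar_kernel ?n s (\<kappa> * norm (c *\<^sub>R x))) =
        ennreal ((1 / \<kappa>) ^ (2 * ?n)) * ennreal (polar_kernel ?n 1 (norm x))"
      using \<kappa> by (simp flip: ennreal_mult')
  qed
  also have "\<dots> = ennreal ((1 / \<kappa>) ^ (2 * ?n)) * (\<integral>\<^sup>+ x. ennreal (polar_kernel ?n 1 (norm (x::complex^'n))) \<partial>lborel)"
    by (rule nn_integral_cmult) measurable
  finally show ?thesis .
qed

lemma chord_kernel_integral_bound:
  fixes k :: "'n::finite option"
  assumes "Rad \<ge> 0"
  shows "\<exists>V<\<infinity>. \<forall>s>0. \<forall>p. (\<integral>\<^sup>+ z. ennreal (polar_kernel CARD('n) s (chord k p z)) * indicator (cball 0 Rad) z \<partial>lborel) \<le> V"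
proof -
  obtain \<kappa> where \<kappa>: "\<kappa> > 0" "\<And>p. \<exists>a. \<forall>z. norm z \<le> Rad \<longrightarrow> \<kappa> * norm (z - a) \<le> chord k p z"
    using chord_ge_distance[OF assms, of k] by blast
  define V where "V = ennreal ((1 / \<kappa>) ^ (2 * CARD('n))) * (\<integral>\<^sup>+ x. ennreal (polar_kernel CARD('n) 1 (norm (x::complex^'n))) \<partial>lborel)"
  have "V < \<infinity>" unfolding V_def using polar_kernel_integrable_1[where 'n = 'n] by (simp add: ennreal_mult_less_top)
  moreover have "(\<integral>\<^sup>+ z. ennreal (polar_kernel CARD('n) s (chord k p z)) * indicator (cball 0 Rad) z \<partial>lborel) \<le> V"
    if s: "s > 0" for s p
  proof -
    obtain a where a: "\<And>z. norm z \<le> Rad \<Longrightarrow> \<kappa> * norm (z - a) \<le> chord k p z" using \<kappa>(2) by blast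
    have "(\<integral>\<^sup>+ z. ennreal (polar_kernel CARD('n) s (chord k p z)) * indicator (cball 0 Rad) z \<partial>lborel) \<le>
      (\<integral>\<^sup>+ z. ennreal (polar_kernel CARD('n) s (\<kappa> * norm (z - a))) \<partial>lborel)"
    proof (rule nn_integral_mono_AE)
      have "AE z in lborel. z \<noteq> a"
        by (rule AE_lborel_singleton)
      then show "AE z in lborel. ennreal (polar_kernel CARD('n) s (chord k p z)) * indicator (cball 0 Rad) z
          \<le> ennreal (polar_kernel CARD('n) s (\<kappa> * norm (z - a)))"
      proof eventually_elim
        case (elim z)
        show ?case
        proof (cases "norm z \<le> Rad")
          case True
          then have "polar_kernel CARD('n) s (chord k p z) \<le> polar_kernel CARD('n) s (\<kappa> * norm (z - a))"
            using a elim \<kappa>(1) s by (intro polar_kernel_antimono) auto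
          then show ?thesis by (simp add: ennreal_leI indicator_def)
        qed (simp add: indicator_def)
      qed
    qed
    also have "\<dots> = V" unfolding V_def by (rule polar_kernel_integral_bound[OF \<kappa>(1) s])
    finally show ?thesis .
  qed
  ultimately show ?thesis by blast
qed

lemma AE_chord_pos: "AE z in lborel. chord k p z > 0"
proof -
  have "chord k p z \<noteq> 0 \<or> z = (\<chi> j. unit_rep p (skip_index k j) / unit_rep p k)" for z
  proof (rule disjCI)
    assume "\<not> z = (\<chi> j. unit_rep p (skip_index k j) / unit_rep p k)"
    then show "chord k p z \<noteq> 0"
    proof (rule contrapos_nn)
      assume "chord k p z = 0"
      then have 0: "kernel_vec k p z b = 0" for b using kernel_vec_le[of k p z b] by simp
      have "unit_rep p k \<noteq> 0"
      proof
        assume "unit_rep p k = 0"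
        then have "unit_rep p b = 0" for b using 0[of b] unfolding kernel_vec_def by simp
        then show False using unit_rep_sum[of p] by simp
      qed
      then show "z = (\<chi> j. unit_rep p (skip_index k j) / unit_rep p k)"
        using 0[of "skip_index k _"] unfolding kernel_vec_def by (simp add: vec_eq_iff field_simps)
    qed
  qed
  then have "AE z in lborel. chord k p z \<noteq> 0"
    using AE_lborel_singleton[of "\<chi> j. unit_rep p (skip_index k j) / unit_rep p k"] by (auto elim!: eventually_mono)
  then show ?thesis
    by eventually_elim (use chord_nonneg[of k p] in \<open>simp add: order_less_le\<close>)
qed

section \<open>Smooth approximants of the potential\<close>

lemma Ck_on_subset: "Ck_on m f T \<Longrightarrow> S \<subseteq> T \<Longrightarrow> Ck_on m f S"
  by (induction m arbitrary: f) (auto intro: continuous_on_subset)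

lemma psh_on_subset:
  assumes "psh_on T u" "S \<subseteq> T" "open S"
  shows "psh_on S u"
proof -
  have "{z \<in> S. u z < c} = S \<inter> {z \<in> T. u z < c}" for c using assms(2) by auto
  moreover have "u a \<le> circle_mean u a b" if "\<forall>t. norm t \<le> 1 \<longrightarrow> a + t *s b \<in> S" for a b
    using assms(1,2) that unfolding psh_on_def by (meson subsetD)
  ultimately show ?thesis using assms unfolding psh_on_def by (auto intro!: open_Int)
qed

text \<open>One chart \<open>k\<close> and one probability measure. Here \<open>approx \<delta>\<close> is the function \<open>u\<^sub>\<delta>\<close> of the introduction.\<close>

locale log_potential_chart =
  fixes \<mu> :: "'n::finite cproj measure" and k :: "'n option"
  assumes prob_mu: "prob_space \<mu>" and sets_mu: "sets \<mu> = sets borel"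
begin

sublocale M: prob_space \<mu> by (rule prob_mu)

lemma space_mu [simp]: "space \<mu> = UNIV"
  using sets_eq_imp_space_eq[OF sets_mu] by simp

lemma resid_mu: "(\<lambda>p. resid p a b) \<in> borel_measurable \<mu>"
  using measurable_resid unfolding measurable_cong_sets[OF sets_mu refl] .

lemma log_form_family_resid:
  assumes "\<delta> > 0"
  shows "log_form_family UNIV \<mu> resid k (\<delta>\<^sup>2)"
proof
  show "\<exists>m>0. \<forall>x\<in>C. \<forall>p\<in>space \<mu>. m \<le> Re (herm_form k (resid p) x) + \<delta>\<^sup>2" for C
    using assms by (intro exI[of _ "\<delta>\<^sup>2"]) (auto simp: herm_form_chord)
qed (rule open_UNIV M.finite_measure_axioms resid_mu resid_le_2 resid_hermitian)+

definition approx :: "real \<Rightarrow> complex^'n \<Rightarrow> real" where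
  "approx \<delta> z = log_form_family.potential \<mu> resid k (\<delta>\<^sup>2) z"

lemma approx_eq:
  assumes "\<delta> > 0"
  shows "approx \<delta> z = (\<integral>p. ln ((chord k p z)\<^sup>2 + \<delta>\<^sup>2) / 2 \<partial>\<mu>)"
  unfolding approx_def log_form_family.potential_eq[OF log_form_family_resid[OF assms]]
  by (simp add: herm_form_chord)

lemma approx_smooth:
  assumes "\<delta> > 0"
  shows "smooth_on U (approx \<delta>)"
  using log_form_family.smooth_potential[OF log_form_family_resid[OF assms]]
  unfolding approx_def[abs_def] smooth_on_def by (auto intro: Ck_on_subset)

text \<open>Along a complex line \<open>(I - P) Z\<close> is affine in \<open>t\<close>, and \<open>|L + t B|\<^sup>2 = |L|\<^sup>2 + |B|\<^sup>2 + 2 Re (L\<^sup>* B t)\<close> on the unit circle.\<close>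

lemma chord_affine:
  assumes t: "cmod t = 1"
  shows "(chord k p (a + t *s b))\<^sup>2 = (chord k p a)\<^sup>2
    + (\<Sum>i\<in>UNIV. (cmod (\<Sum>l\<in>UNIV. resid p i l * linear_lift k b $ l))\<^sup>2)
    + 2 * Re ((\<Sum>i\<in>UNIV. cnj (herm_row k (resid p) a i) * (\<Sum>l\<in>UNIV. resid p i l * linear_lift k b $ l)) * t)"
proof -
  define B where "B i = (\<Sum>l\<in>UNIV. resid p i l * linear_lift k b $ l)" for i
  have lift: "affine_lift k (a + t *s b) $ l = affine_lift k a $ l + t * linear_lift k b $ l" for l
    by (simp add: affine_lift_def linear_lift_def)
  have row: "herm_row k (resid p) (a + t *s b) i = herm_row k (resid p) a i + B i * t" for i
    unfolding herm_row_def B_def lift by (simp add: distrib_left sum.distrib sum_distrib_left sum_distrib_right mult_ac)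
  have sq: "(cmod (u + v * t))\<^sup>2 = (cmod u)\<^sup>2 + (cmod v)\<^sup>2 + 2 * Re (cnj u * v * t)" for u v
  proof -
    have "(cmod (u + v * t))\<^sup>2 = (cmod u)\<^sup>2 + (cmod (v * t))\<^sup>2 + 2 * Re (cnj u * (v * t))"
      unfolding cmod_power2 by (simp add: power2_eq_square algebra_simps)
    then show ?thesis using t by (simp add: norm_mult mult.assoc)
  qed
  show ?thesis
    unfolding chord_sq row sq B_def[symmetric] sum.distrib
    by (simp add: sum_distrib_left sum_distrib_right Re_sum)
qed

text \<open>The sub-mean value inequality for a single pole comes from \<open>ln_hermitian_circle_submean\<close>; its hypotheses
  are the Cauchy--Schwarz inequality and \<open>\<delta> > 0\<close>.\<close>

lemma approx_psh:
  assumes \<delta>: "\<delta> > 0"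
  shows "psh_on UNIV (\<lambda>z. ereal (approx \<delta> z))"
proof -
  interpret F: log_form_family UNIV \<mu> resid k "\<delta>\<^sup>2" by (rule log_form_family_resid[OF \<delta>])
  show ?thesis
    unfolding approx_def[abs_def] F.potential_def[abs_def]
  proof (rule psh_on_integral[OF open_UNIV M.finite_measure_axioms F.family_ln])
    fix a b :: "complex^'n" and p
    define B where "B i = (\<Sum>l\<in>UNIV. resid p i l * linear_lift k b $ l)" for i
    define L where "L i = herm_row k (resid p) a i" for i
    define \<beta> where "\<beta> = (\<Sum>i\<in>UNIV. cnj (L i) * B i)"
    define BB where "BB = (\<Sum>i\<in>UNIV. (cmod (B i))\<^sup>2)"
    define A where "A = (chord k p a)\<^sup>2 + \<delta>\<^sup>2"
    have BB: "BB \<ge> 0" unfolding BB_def by (intro sum_nonneg) auto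
    have "cmod \<beta> \<le> (\<Sum>i\<in>UNIV. \<bar>cmod (L i)\<bar> * \<bar>cmod (B i)\<bar>)"
      unfolding \<beta>_def by (rule order_trans[OF norm_sum]) (simp add: norm_mult)
    also have "\<dots> \<le> L2_set (\<lambda>i. cmod (L i)) UNIV * L2_set (\<lambda>i. cmod (B i)) UNIV" by (rule L2_set_mult_ineq)
    also have "\<dots> = chord k p a * sqrt BB"
      unfolding L2_set_def BB_def L_def chord_sq[symmetric] by (simp add: chord_nonneg)
    finally have \<beta>: "cmod \<beta> \<le> chord k p a * sqrt BB" .
    have A: "A > 0" "(chord k p a)\<^sup>2 < A" unfolding A_def using \<delta> by (simp_all add: add_nonneg_pos)
    have 1: "(cmod \<beta>)\<^sup>2 \<le> A * BB"
    proof -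
      have "(cmod \<beta>)\<^sup>2 \<le> (chord k p a * sqrt BB)\<^sup>2" using \<beta> by (rule power_mono) simp
      also have "\<dots> = (chord k p a)\<^sup>2 * BB" using BB by (simp add: power_mult_distrib)
      also have "\<dots> \<le> A * BB" using A BB by (intro mult_right_mono) auto
      finally show ?thesis .
    qed
    have "2 * (chord k p a * sqrt BB) \<le> (chord k p a)\<^sup>2 + (sqrt BB)\<^sup>2"
      using sum_squares_bound[of "chord k p a" "sqrt BB"] by (simp add: mult.assoc)
    then have 2: "2 * cmod \<beta> < A + BB" using \<beta> A(2) BB by simp
    obtain I where I: "I \<ge> 2 * pi * ln A" "((\<lambda>t. ln (A + BB + 2 * Re (\<beta> * cis t))) has_integral I) {0..2*pi}"
      using ln_hermitian_circle_submean[OF 1 A(1) BB 2] by blast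
    have eq: "Re (complex_of_real (ln (Re (herm_form k (resid p) (a + cis t *s b)) + \<delta>\<^sup>2) / 2)) = ln (A + BB + 2 * Re (\<beta> * cis t)) / 2" for t
    proof -
      have "Re (herm_form k (resid p) (a + cis t *s b)) + \<delta>\<^sup>2 = A + BB + 2 * Re (\<beta> * cis t)"
        unfolding herm_form_chord Re_complex_of_real chord_affine[OF norm_cis] A_def BB_def \<beta>_def B_def L_def by (simp only: add_ac)
      then show ?thesis by (simp only: Re_complex_of_real)
    qed
    show "\<exists>I\<ge>2 * pi * Re (complex_of_real (ln (Re (herm_form k (resid p) a) + \<delta>\<^sup>2) / 2)).
        ((\<lambda>t. Re (complex_of_real (ln (Re (herm_form k (resid p) (a + cis t *s b)) + \<delta>\<^sup>2) / 2))) has_integral I) {0..2*pi}"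
    proof (intro exI conjI)
      show "((\<lambda>t. Re (complex_of_real (ln (Re (herm_form k (resid p) (a + cis t *s b)) + \<delta>\<^sup>2) / 2))) has_integral I / 2) {0..2*pi}"
        unfolding eq using I(2) by (rule has_integral_divide)
      have "Re (complex_of_real (ln (Re (herm_form k (resid p) a) + \<delta>\<^sup>2) / 2)) = ln A / 2"
        unfolding A_def herm_form_chord by simp
      then show "2 * pi * Re (complex_of_real (ln (Re (herm_form k (resid p) a) + \<delta>\<^sup>2) / 2)) \<le> I / 2" using I(1) by simp
    qed
  qed
qed

lemma measurable_chord: "(\<lambda>p. chord k p z) \<in> borel_measurable \<mu>"
  unfolding chord_def herm_form_def herm_row_def using resid_mu by measurable

lemma ln_chord_integrable:
  assumes "\<delta> > 0"
  shows "integrable \<mu> (\<lambda>p. ln ((chord k p z)\<^sup>2 + \<delta>\<^sup>2) / 2)"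
proof (rule M.integrable_const_bound)
  let ?w = "norm (affine_lift k z)"
  show "AE p in \<mu>. norm (ln ((chord k p z)\<^sup>2 + \<delta>\<^sup>2) / 2) \<le> \<bar>ln (\<delta>\<^sup>2)\<bar> + \<bar>ln (?w\<^sup>2 + \<delta>\<^sup>2)\<bar>"
  proof (rule AE_I2)
    fix p
    have "(chord k p z)\<^sup>2 \<le> ?w\<^sup>2" by (intro power_mono chord_le_norm chord_nonneg)
    moreover have "\<delta>\<^sup>2 > 0" using assms by simp
    moreover from this have "(chord k p z)\<^sup>2 + \<delta>\<^sup>2 > 0" "?w\<^sup>2 + \<delta>\<^sup>2 > 0" by (intro add_nonneg_pos; simp)+
    ultimately have "ln (\<delta>\<^sup>2) \<le> ln ((chord k p z)\<^sup>2 + \<delta>\<^sup>2)" "ln ((chord k p z)\<^sup>2 + \<delta>\<^sup>2) \<le> ln (?w\<^sup>2 + \<delta>\<^sup>2)"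
      by (simp_all only: ln_le_cancel_iff) simp_all
    then show "norm (ln ((chord k p z)\<^sup>2 + \<delta>\<^sup>2) / 2) \<le> \<bar>ln (\<delta>\<^sup>2)\<bar> + \<bar>ln (?w\<^sup>2 + \<delta>\<^sup>2)\<bar>" by simp
  qed
  show "(\<lambda>p. ln ((chord k p z)\<^sup>2 + \<delta>\<^sup>2) / 2) \<in> borel_measurable \<mu>"
    using measurable_chord by measurable
qed

lemma approx_mono:
  assumes "0 < \<delta>" "\<delta> \<le> \<epsilon>"
  shows "approx \<delta> z \<le> approx \<epsilon> z"
proof -
  have "\<epsilon> > 0" using assms by simp
  moreover have "\<delta>\<^sup>2 \<le> \<epsilon>\<^sup>2" "\<delta>\<^sup>2 > 0" using assms by (auto intro: power_mono)
  ultimately show ?thesis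
    unfolding approx_eq[OF assms(1)] approx_eq[OF \<open>\<epsilon> > 0\<close>]
    by (intro integral_mono ln_chord_integrable assms divide_right_mono ln_mono add_left_mono)
      (auto intro!: add_nonneg_pos)
qed

text \<open>Monotone convergence for the nonnegative functions \<open>ln |Z| + 1 - 1/2 ln (r\<^sup>2 + \<delta>\<^sup>2)\<close>, including the case in which the limit
  is \<open>-\<infinity>\<close>.\<close>

lemma approx_tendsto:
  "(\<lambda>j. ereal (approx (1 / real (Suc j)) z)) \<longlonglongrightarrow>
     ereal_integral \<mu> (\<lambda>p. log_ereal (chord k p z / norm (affine_lift k z))) + ereal (ln (norm (affine_lift k z)))"
proof -
  define w where "w = norm (affine_lift k z)"
  have w: "w \<ge> 1" unfolding w_def by (rule norm_affine_lift_ge_1)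
  define \<delta> where "\<delta> j = 1 / real (Suc j)" for j
  have \<delta>: "\<delta> j > 0" "\<delta> j \<le> 1" for j unfolding \<delta>_def by auto
  have \<delta>0: "\<delta> \<longlonglongrightarrow> 0" unfolding \<delta>_def using LIMSEQ_inverse_real_of_nat by (simp add: inverse_eq_divide)
  \<comment> \<open>The summand \<open>1\<close> makes \<open>g\<close> nonnegative, since \<open>\<delta> \<le> 1\<close> and the chord is at most \<open>w\<close>.\<close>
  define g where "g j p = ln w + 1 - ln ((chord k p z)\<^sup>2 + (\<delta> j)\<^sup>2) / 2" for j p
  define h where "h p = 1 + e2ennreal (- log_ereal (chord k p z / w))" for p
  have x: "0 \<le> chord k p z" "chord k p z \<le> w" for p unfolding w_def by (rule chord_nonneg, rule chord_le_norm)
  have pos: "(chord k p z)\<^sup>2 + (\<delta> j)\<^sup>2 > 0" for p j using \<delta>(1)[of j] by (simp add: add_nonneg_pos)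
  have g0: "g j p \<ge> 0" for j p
  proof -
    have "(chord k p z)\<^sup>2 \<le> w\<^sup>2" using x by (intro power_mono)
    moreover have "(\<delta> j)\<^sup>2 \<le> 1\<^sup>2" using \<delta>(1)[of j] \<delta>(2)[of j] by (intro power_mono) auto
    moreover have "1 \<le> w\<^sup>2" using w by (simp add: one_le_power)
    ultimately have "(chord k p z)\<^sup>2 + (\<delta> j)\<^sup>2 \<le> 2 * w\<^sup>2" by simp
    moreover have "0 < 2 * w\<^sup>2" using w by simp
    ultimately have "ln ((chord k p z)\<^sup>2 + (\<delta> j)\<^sup>2) \<le> ln (2 * w\<^sup>2)"
      using pos[of p j] by (simp only: ln_le_cancel_iff)
    also have "\<dots> = ln 2 + 2 * ln w" using w by (simp add: ln_mult ln_realpow)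
    also have "ln 2 \<le> (1::real)" using ln_2_less_1 by simp
    finally show ?thesis unfolding g_def by simp
  qed
  have gmono: "g j p \<le> g (Suc j) p" for j p
  proof -
    have "\<delta> (Suc j) \<le> \<delta> j" unfolding \<delta>_def by (simp add: frac_le)
    then have "(\<delta> (Suc j))\<^sup>2 \<le> (\<delta> j)\<^sup>2" using \<delta>(1)[of "Suc j"] by (intro power_mono) auto
    then show ?thesis unfolding g_def using pos[of p "Suc j"] by simp
  qed
  have glim: "(\<lambda>j. ennreal (g j p)) \<longlonglongrightarrow> h p" for p
  proof (cases "chord k p z = 0")
    case False
    then have xp: "chord k p z > 0" using x(1)[of p] by simp
    have "(\<lambda>j. g j p) \<longlonglongrightarrow> ln w + 1 - ln ((chord k p z)\<^sup>2 + 0\<^sup>2) / 2"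
      unfolding g_def using xp by (intro tendsto_intros \<delta>0) auto
    also have "ln w + 1 - ln ((chord k p z)\<^sup>2 + 0\<^sup>2) / 2 = 1 + - ln (chord k p z / w)"
      using xp w by (simp add: ln_realpow ln_div)
    finally have "(\<lambda>j. ennreal (g j p)) \<longlonglongrightarrow> ennreal (1 + - ln (chord k p z / w))"
      by (rule tendsto_ennrealI)
    also have "ennreal (1 + - ln (chord k p z / w)) = h p"
    proof -
      have "ln (chord k p z / w) \<le> 0" using xp x(2)[of p] w by (simp add: divide_le_eq)
      then have "ennreal (1 + - ln (chord k p z / w)) = 1 + ennreal (- ln (chord k p z / w))"
        by (subst ennreal_plus) auto
      also have "ennreal (- ln (chord k p z / w)) = e2ennreal (- log_ereal (chord k p z / w))"
      proof -
        have "\<not> chord k p z / w \<le> 0" using xp w by (simp add: not_le)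
        then show ?thesis unfolding log_ereal_def by (simp add: e2ennreal_ereal)
      qed
      finally show ?thesis unfolding h_def .
    qed
    finally show ?thesis .
  next
    case True
    have "filterlim (\<lambda>j. g j p) at_top sequentially"
    proof -
      have "filterlim \<delta> (at_right 0) sequentially"
        unfolding filterlim_at using \<delta>0 \<delta>(1) by (auto simp: less_imp_neq[symmetric])
      then have "filterlim (\<lambda>j. ln (\<delta> j)) at_bot sequentially"
        by (rule filterlim_compose[OF ln_at_0])
      then have "filterlim (\<lambda>j. - ln (\<delta> j)) at_top sequentially"
        by (simp add: filterlim_uminus_at_top)
      then have "filterlim (\<lambda>j. (ln w + 1) + - ln (\<delta> j)) at_top sequentially"
        by (intro filterlim_tendsto_add_at_top[OF tendsto_const])
      moreover have "g j p = (ln w + 1) + - ln (\<delta> j)" for j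
        unfolding g_def using True \<delta>(1)[of j] by (simp add: ln_realpow)
      ultimately show ?thesis by simp
    qed
    then have "(\<lambda>j. ereal (g j p)) \<longlonglongrightarrow> \<infinity>"
      by (auto simp: tendsto_PInfty filterlim_at_top_dense)
    then have "(\<lambda>j. e2ennreal (ereal (g j p))) \<longlonglongrightarrow> e2ennreal \<infinity>"
      by (rule tendsto_e2ennrealI)
    then have "(\<lambda>j. ennreal (g j p)) \<longlonglongrightarrow> \<infinity>" by (simp add: e2ennreal_infty)
    moreover have "h p = \<infinity>" unfolding h_def using True by (simp add: log_ereal_def e2ennreal_infty)
    ultimately show ?thesis by simp
  qed
  have mg: "g j \<in> borel_measurable \<mu>" for j unfolding g_def using measurable_chord by measurable
  have ui: "integrable \<mu> (\<lambda>p. ln ((chord k p z)\<^sup>2 + (\<delta> j)\<^sup>2) / 2)" for j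
    by (rule ln_chord_integrable[OF \<delta>(1)])
  have gint: "(\<integral>\<^sup>+p. ennreal (g j p) \<partial>\<mu>) = ennreal (ln w + 1 - approx (\<delta> j) z)" for j
  proof -
    have "integrable \<mu> (g j)" unfolding g_def using ui by simp
    then have "(\<integral>\<^sup>+p. ennreal (g j p) \<partial>\<mu>) = ennreal (integral\<^sup>L \<mu> (g j))"
      using g0 by (intro nn_integral_eq_integral) auto
    also have "integral\<^sup>L \<mu> (g j) = ln w + 1 - approx (\<delta> j) z"
      unfolding g_def approx_eq[OF \<delta>(1)] using ui M.prob_space by simp
    finally show ?thesis .
  qed
  have u0: "ln w + 1 - approx (\<delta> j) z \<ge> 0" for j
  proof -
    have "integral\<^sup>L \<mu> (g j) \<ge> 0" by (intro integral_nonneg_AE) (use g0 in auto)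
    then show ?thesis unfolding g_def approx_eq[OF \<delta>(1)] using ui M.prob_space by simp
  qed
  define T where "T = (\<integral>\<^sup>+p. e2ennreal (- log_ereal (chord k p z / w)) \<partial>\<mu>)"
  have mh: "(\<lambda>p. e2ennreal (- log_ereal (chord k p z / w))) \<in> borel_measurable \<mu>"
    unfolding log_ereal_def using measurable_chord by measurable
  have "(\<lambda>j. \<integral>\<^sup>+p. ennreal (g j p) \<partial>\<mu>) \<longlonglongrightarrow> (\<integral>\<^sup>+p. h p \<partial>\<mu>)"
  proof (rule nn_integral_LIMSEQ)
    show "incseq (\<lambda>j p. ennreal (g j p))"
      by (intro incseq_SucI le_funI ennreal_leI gmono)
  qed (use mg glim in auto)
  also have "(\<integral>\<^sup>+p. h p \<partial>\<mu>) = 1 + T"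
    unfolding h_def T_def using mh by (subst nn_integral_add) (auto simp: M.emeasure_space_1[simplified])
  finally have "(\<lambda>j. ennreal (ln w + 1 - approx (\<delta> j) z)) \<longlonglongrightarrow> 1 + T" unfolding gint .
  then have lim: "(\<lambda>j. enn2ereal (ennreal (ln w + 1 - approx (\<delta> j) z))) \<longlonglongrightarrow> enn2ereal (1 + T)"
    by (rule tendsto_enn2erealI)
  then have "(\<lambda>j. ereal (ln w + 1) + - enn2ereal (ennreal (ln w + 1 - approx (\<delta> j) z))) \<longlonglongrightarrow> ereal (ln w + 1) + - enn2ereal (1 + T)"
    by (intro tendsto_add_ereal_general2 tendsto_uminus_ereal tendsto_const) auto
  moreover have "ereal (ln w + 1) + - enn2ereal (ennreal (ln w + 1 - approx (\<delta> j) z)) = ereal (approx (\<delta> j) z)" for j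
    using u0[of j] by (simp add: enn2ereal_ennreal)
  ultimately have "(\<lambda>j. ereal (approx (\<delta> j) z)) \<longlonglongrightarrow> ereal (ln w + 1) + - enn2ereal (1 + T)" by simp
  also have "ereal (ln w + 1) + - enn2ereal (1 + T) = ereal_integral \<mu> (\<lambda>p. log_ereal (chord k p z / w)) + ereal (ln w)"
  proof -
    have "e2ennreal (log_ereal (chord k p z / w)) = 0" for p
    proof -
      have "log_ereal (chord k p z / w) \<le> 0"
      proof (cases "chord k p z / w \<le> 0")
        case False
        then have "ln (chord k p z / w) \<le> 0" using x(2)[of p] w by (subst ln_le_zero_iff) (auto simp: divide_le_eq)
        then show ?thesis using False by (simp add: log_ereal_def)
      qed (simp add: log_ereal_def)
      then show ?thesis by (rule e2ennreal_neg)
    qed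
    then have "ereal_integral \<mu> (\<lambda>p. log_ereal (chord k p z / w)) = - enn2ereal T"
      unfolding ereal_integral_def T_def by (simp add: zero_ennreal.rep_eq)
    moreover have "ereal (ln w + 1) + - enn2ereal (1 + T) = - enn2ereal T + ereal (ln w)"
    proof (cases T)
      case (real r)
      then have "1 + T = ennreal (1 + r)" by (simp add: ennreal_plus)
      then have 1: "enn2ereal (1 + T) = ereal (1 + r)" using real by (simp only: enn2ereal_ennreal)
      have 2: "enn2ereal T = ereal r" using real by (simp add: enn2ereal_ennreal)
      show ?thesis unfolding 1 2 by simp
    qed (simp add: top_ennreal.rep_eq)
    ultimately show ?thesis by simp
  qed
  finally show ?thesis unfolding w_def \<delta>_def .
qed

text \<open>The complex Hessian of \<open>approx \<delta>\<close>, without the factor \<open>\<i> / \<pi>\<close>.\<close>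

definition hess_mean :: "real \<Rightarrow> complex^'n \<Rightarrow> complex^'n^'n" where
  "hess_mean \<delta> z = (\<chi> j l. \<integral>p. log_hessian k (resid p) (\<delta>\<^sup>2) z j l \<partial>\<mu>)"

lemma top_power_density_approx:
  assumes "\<delta> > 0"
  shows "top_power_density (ddc (approx \<delta>) z) = of_real (fact CARD('n) * (2 / pi) ^ CARD('n)) * det (hess_mean \<delta> z)"
proof -
  interpret F: log_form_family UNIV \<mu> resid k "\<delta>\<^sup>2" by (rule log_form_family_resid[OF assms])
  have "ddc (approx \<delta>) z = (\<chi> j l. \<i> / of_real pi * hess_mean \<delta> z $ j $ l)"
    unfolding approx_def[abs_def] F.ddc_potential[OF UNIV_I] hess_mean_def by simp
  also have "\<dots> = (\<chi> j. (\<i> / of_real pi) *s hess_mean \<delta> z $ j)"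
    by (simp add: vec_eq_iff)
  finally have "det (ddc (approx \<delta>) z) = (\<i> / of_real pi) ^ CARD('n) * det (hess_mean \<delta> z)"
    using det_rows_mul[of "\<lambda>_. \<i> / of_real pi" "\<lambda>j. hess_mean \<delta> z $ j"] by simp
  then have "top_power_density (ddc (approx \<delta>) z) = fact CARD('n) * ((- 2 * \<i>) * (\<i> / of_real pi)) ^ CARD('n) * det (hess_mean \<delta> z)"
    unfolding top_power_density_def by (simp only: power_mult_distrib mult.assoc)
  moreover have "(- 2 * \<i>) * (\<i> / complex_of_real pi) = of_real (2 / pi)"
    by (simp add: field_simps)
  ultimately show ?thesis by simp
qed

lemma density_approx:
  assumes "\<delta> > 0"
  shows "Re (top_power_density (ddc (approx \<delta>) z)) \<le> fact CARD('n) * (2 / pi) ^ CARD('n) * cmod (det (hess_mean \<delta> z))"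
proof -
  have "cmod (top_power_density (ddc (approx \<delta>) z)) = \<bar>fact CARD('n) * (2 / pi) ^ CARD('n)\<bar> * cmod (det (hess_mean \<delta> z))"
    unfolding top_power_density_approx[OF assms] by (simp only: norm_mult norm_of_real)
  then show ?thesis using complex_Re_le_cmod[of "top_power_density (ddc (approx \<delta>) z)"] by simp
qed

abbreviation tuples :: "('n \<Rightarrow> 'n cproj) measure" where
  "tuples \<equiv> \<Pi>\<^sub>M l\<in>UNIV. \<mu>"

lemma hessian_integrable:
  assumes "\<delta> > 0"
  shows "integrable \<mu> (\<lambda>p. log_hessian k (resid p) (\<delta>\<^sup>2) z j l)"
proof -
  interpret F: log_form_family UNIV \<mu> resid k "\<delta>\<^sup>2" by (rule log_form_family_resid[OF assms])
  show ?thesis by (rule smooth_family_integrable[OF F.family_hessian M.finite_measure_axioms UNIV_I])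
qed

text \<open>Leibniz's formula for the transposed matrix: in each product the factors belong to different rows, so their integrals
  multiply to an integral over the product space.\<close>

lemma det_hess_mean:
  assumes \<delta>: "\<delta> > 0"
  shows "integrable tuples (\<lambda>\<omega>. det (mixed_matrix k \<delta> \<omega> z))"
    "det (hess_mean \<delta> z) = (\<integral>\<omega>. det (mixed_matrix k \<delta> \<omega> z) \<partial>tuples)"
proof -
  interpret P: product_sigma_finite "\<lambda>_::'n. \<mu>" ..
  have int: "integrable tuples (\<lambda>\<omega>. \<Prod>l\<in>UNIV. log_hessian k (resid (\<omega> l)) (\<delta>\<^sup>2) z (q l) l)"
    and eq: "(\<integral>\<omega>. (\<Prod>l\<in>UNIV. log_hessian k (resid (\<omega> l)) (\<delta>\<^sup>2) z (q l) l) \<partial>tuples) =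
      (\<Prod>l\<in>UNIV. \<integral>p. log_hessian k (resid p) (\<delta>\<^sup>2) z (q l) l \<partial>\<mu>)" for q
    using P.product_integrable_prod[of UNIV "\<lambda>l p. log_hessian k (resid p) (\<delta>\<^sup>2) z (q l) l"]
      P.product_integral_prod[of UNIV "\<lambda>l p. log_hessian k (resid p) (\<delta>\<^sup>2) z (q l) l"]
      hessian_integrable[OF \<delta>] by auto
  show "integrable tuples (\<lambda>\<omega>. det (mixed_matrix k \<delta> \<omega> z))"
    unfolding det_def mixed_matrix_def using int by simp
  have "det (hess_mean \<delta> z) = det (transpose (hess_mean \<delta> z))" by (rule det_transpose[symmetric])
  also have "\<dots> = (\<Sum>q\<in>{q. q permutes (UNIV::'n set)}. of_int (sign q) *
      (\<integral>\<omega>. (\<Prod>l\<in>UNIV. log_hessian k (resid (\<omega> l)) (\<delta>\<^sup>2) z (q l) l) \<partial>tuples))"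
    unfolding det_def transpose_def hess_mean_def eq by simp
  also have "\<dots> = (\<integral>\<omega>. det (mixed_matrix k \<delta> \<omega> z) \<partial>tuples)"
    unfolding det_def mixed_matrix_def using int by simp
  finally show "det (hess_mean \<delta> z) = (\<integral>\<omega>. det (mixed_matrix k \<delta> \<omega> z) \<partial>tuples)" .
qed

lemma norm_det_hess_mean:
  assumes \<delta>: "\<delta> > 0"
  shows "ennreal (cmod (det (hess_mean \<delta> z))) \<le> (\<integral>\<^sup>+\<omega>. ennreal (cmod (det (mixed_matrix k \<delta> \<omega> z))) \<partial>tuples)"
proof -
  have "ennreal (cmod (det (hess_mean \<delta> z))) \<le> ennreal (\<integral>\<omega>. cmod (det (mixed_matrix k \<delta> \<omega> z)) \<partial>tuples)"
    unfolding det_hess_mean(2)[OF \<delta>] by (intro ennreal_leI integral_norm_bound)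
  also have "\<dots> = (\<integral>\<^sup>+\<omega>. ennreal (cmod (det (mixed_matrix k \<delta> \<omega> z))) \<partial>tuples)"
    by (rule nn_integral_eq_integral[symmetric]) (use det_hess_mean(1)[OF \<delta>] in auto)
  finally show ?thesis .
qed

end

section \<open>Monge--Ampere densities of the approximants\<close>

text \<open>The value \<open>\<infinity>\<close> at the pole makes the bound for the mixed determinant valid at every point, and a single point does not
  affect integrals.\<close>

definition polar_ennreal :: "nat \<Rightarrow> real \<Rightarrow> real \<Rightarrow> ennreal" where
  "polar_ennreal n s r = (if r = 0 then \<infinity> else ennreal (polar_kernel n s r))"

lemma measurable_polar_ennreal [measurable]:
  "(\<lambda>(s, r). polar_ennreal n s r) \<in> borel_measurable (borel \<Otimes>\<^sub>M borel)"
  unfolding polar_ennreal_def polar_kernel_def by measurable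

lemma measurable_polar_ennreal_right: "polar_ennreal n s \<in> borel_measurable borel"
  unfolding polar_ennreal_def[abs_def] polar_kernel_def by measurable

lemma polar_ennreal_le_double:
  assumes "\<delta> > 0" "\<delta> \<le> s" "r \<ge> 0"
  shows "polar_ennreal n (\<delta> + s) r \<le> 2 * polar_ennreal n s r"
proof (cases "r = 0")
  case True
  then show ?thesis by (simp add: polar_ennreal_def ennreal_mult_top)
next
  case False
  then have r: "r > 0" using assms by simp
  have s: "s > 0" using assms by simp
  have "polar_kernel n (\<delta> + s) r \<le> (2 * s) / (r ^ (2 * n - 2) * (s + r) ^ 3)"
    unfolding polar_kernel_def using assms r s
    by (intro frac_le mult_left_mono power_mono mult_pos_pos zero_less_power) auto
  also have "\<dots> = 2 * polar_kernel n s r" unfolding polar_kernel_def by simp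
  finally have "ennreal (polar_kernel n (\<delta> + s) r) \<le> ennreal 2 * ennreal (polar_kernel n s r)"
    by (subst ennreal_mult'[symmetric]) (auto intro: ennreal_leI)
  then show ?thesis using False by (simp add: polar_ennreal_def)
qed

context log_potential_chart
begin

sublocale P: prob_space tuples
proof
  interpret product_sigma_finite "\<lambda>_::'n. \<mu>" ..
  show "emeasure tuples (space tuples) = 1"
    unfolding space_PiM using emeasure_PiM[of UNIV "\<lambda>_. space \<mu>"] M.emeasure_space_1 sets.top[of \<mu>] by simp
qed

lemma measurable_component: "(\<lambda>\<omega>. \<omega> l) \<in> measurable tuples \<mu>"
  by (rule measurable_component_singleton) simp

lemma measurable_spread [measurable]: "spread base \<in> borel_measurable tuples"
proof -
  have m: "(\<lambda>p. proj_mat p a b) \<in> borel_measurable \<mu>" for a b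
    using measurable_proj_mat unfolding measurable_cong_sets[OF sets_mu refl] .
  have "(\<lambda>\<omega>. proj_mat (\<omega> l) a b) \<in> borel_measurable tuples" for l a b
    by (rule measurable_compose[OF measurable_component m])
  then show ?thesis unfolding spread_def[abs_def] proj_dist_def by measurable
qed

lemma measurable_chord_pair [measurable]:
  "(\<lambda>(\<omega>, z). chord k (\<omega> l) z) \<in> borel_measurable (tuples \<Otimes>\<^sub>M lborel)"
proof -
  have "(\<lambda>\<omega>. resid (\<omega> l) a b) \<in> borel_measurable tuples" for a b
    by (rule measurable_compose[OF measurable_component resid_mu])
  then have 1: "(\<lambda>x. resid (fst x l) a b) \<in> borel_measurable (tuples \<Otimes>\<^sub>M lborel)" for a b
    by (rule measurable_compose[OF measurable_fst])
  have "continuous_on UNIV (\<lambda>z. affine_lift k z $ a)" for a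
    by (intro continuous_at_imp_continuous_on ballI has_derivative_continuous[OF affine_lift_has_derivative])
  then have "(\<lambda>z. affine_lift k z $ a) \<in> borel_measurable lborel" for a
    by (simp add: borel_measurable_continuous_onI)
  then have 2: "(\<lambda>x. affine_lift k (snd x) $ a) \<in> borel_measurable (tuples \<Otimes>\<^sub>M lborel)" for a
    by (rule measurable_compose[OF measurable_snd])
  have "cnj \<in> borel_measurable borel"
    by (intro borel_measurable_continuous_onI continuous_intros)
  then have 3: "(\<lambda>x. cnj (affine_lift k (snd x) $ a)) \<in> borel_measurable (tuples \<Otimes>\<^sub>M lborel)" for a
    by (rule measurable_compose[OF 2])
  show ?thesis
    unfolding chord_def herm_form_def herm_row_def split_beta' using 1 2 3 by measurable
qed

definition kernel_sum :: "real \<Rightarrow> ('n \<Rightarrow> 'n cproj) \<Rightarrow> complex^'n \<Rightarrow> ennreal" where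
  "kernel_sum s \<omega> z = (\<Sum>l\<in>UNIV. polar_ennreal CARD('n) s (chord k (\<omega> l) z))"

lemma measurable_kernel_sum:
  "(\<lambda>(\<omega>, z). kernel_sum (\<delta> + spread base \<omega>) \<omega> z) \<in> borel_measurable (tuples \<Otimes>\<^sub>M lborel)"
proof -
  have s: "(\<lambda>x. \<delta> + spread base (fst x)) \<in> borel_measurable (tuples \<Otimes>\<^sub>M lborel)"
    by measurable
  have c: "(\<lambda>x. chord k (fst x l) (snd x)) \<in> borel_measurable (tuples \<Otimes>\<^sub>M lborel)" for l
    using measurable_chord_pair by (simp add: split_beta')
  have "(\<lambda>x. polar_ennreal CARD('n) (\<delta> + spread base (fst x)) (chord k (fst x l) (snd x)))
      \<in> borel_measurable (tuples \<Otimes>\<^sub>M lborel)" for l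
    using measurable_compose[OF measurable_Pair[OF s c] measurable_polar_ennreal] by simp
  then show ?thesis unfolding kernel_sum_def split_beta' by measurable
qed

text \<open>The uniform bound for one pole, summed over the poles of the tuple.\<close>

lemma kernel_sum_integral_le:
  assumes V: "\<forall>s>0. \<forall>p. (\<integral>\<^sup>+ z. ennreal (polar_kernel CARD('n) s (chord k p z)) * indicator (cball 0 Rad) z \<partial>lborel) \<le> V"
    and s: "s > 0"
  shows "(\<integral>\<^sup>+ z. kernel_sum s \<omega> z * indicator (cball 0 Rad) z \<partial>lborel) \<le> of_nat CARD('n) * V"
proof -
  have ch: "(\<lambda>z. chord k p z) \<in> borel_measurable lborel" for p
    using measurable_compose[OF measurable_Pair1'[of "\<lambda>_. p"] measurable_chord_pair[of undefined]]
    by (simp add: space_PiM)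
  have m: "(\<lambda>z. polar_ennreal CARD('n) s (chord k p z) * indicator (cball 0 Rad) z) \<in> borel_measurable lborel" for p
  proof -
    have "(\<lambda>z. polar_ennreal CARD('n) s (chord k p z)) \<in> borel_measurable lborel"
      by (rule measurable_compose[OF ch measurable_polar_ennreal_right])
    then show ?thesis by (intro borel_measurable_times_ennreal borel_measurable_indicator) auto
  qed
  have "(\<integral>\<^sup>+ z. kernel_sum s \<omega> z * indicator (cball 0 Rad) z \<partial>lborel) =
    (\<Sum>l\<in>UNIV. \<integral>\<^sup>+ z. polar_ennreal CARD('n) s (chord k (\<omega> l) z) * indicator (cball 0 Rad) z \<partial>lborel)"
    unfolding kernel_sum_def sum_distrib_right using m by (intro nn_integral_sum) auto
  also have "\<dots> \<le> (\<Sum>l\<in>(UNIV::'n set). V)"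
  proof (rule sum_mono)
    fix l
    have "(\<integral>\<^sup>+ z. polar_ennreal CARD('n) s (chord k (\<omega> l) z) * indicator (cball 0 Rad) z \<partial>lborel) =
      (\<integral>\<^sup>+ z. ennreal (polar_kernel CARD('n) s (chord k (\<omega> l) z)) * indicator (cball 0 Rad) z \<partial>lborel)"
      by (rule nn_integral_cong_AE) (use AE_chord_pos[of k "\<omega> l"] in eventually_elim, simp add: polar_ennreal_def)
    then show "(\<integral>\<^sup>+ z. polar_ennreal CARD('n) s (chord k (\<omega> l) z) * indicator (cball 0 Rad) z \<partial>lborel) \<le> V"
      using V s by simp
  qed
  finally show ?thesis by simp
qed

text \<open>The function \<open>\<Psi>\<close> of the introduction, which dominates the Monge--Ampere measure.\<close>

definition majorant :: "'n \<Rightarrow> complex^'n \<Rightarrow> ennreal" where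
  "majorant base z = (\<integral>\<^sup>+ \<omega>. indicator {\<omega>. spread base \<omega> > 0} \<omega> * kernel_sum (spread base \<omega>) \<omega> z \<partial>tuples)"

lemma measurable_restricted_kernel:
  "(\<lambda>(\<omega>, z). indicator {\<omega>. 0 < spread base \<omega>} \<omega> * kernel_sum (spread base \<omega>) \<omega> z) \<in> borel_measurable (tuples \<Otimes>\<^sub>M lborel)"
  "(\<lambda>(\<omega>, z). indicator {\<omega>. spread base \<omega> < \<delta>} \<omega> * kernel_sum (\<delta> + spread base \<omega>) \<omega> z) \<in> borel_measurable (tuples \<Otimes>\<^sub>M lborel)"
proof -
  have i: "(\<lambda>x. indicator {\<omega>. P (spread base \<omega>)} (fst x) :: ennreal) \<in> borel_measurable (tuples \<Otimes>\<^sub>M lborel)"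
    if "Measurable.pred borel P" for P
  proof -
    have "(\<lambda>x. if P (spread base (fst x)) then 1 else 0 :: ennreal) \<in> borel_measurable (tuples \<Otimes>\<^sub>M lborel)"
      using that by measurable
    then show ?thesis by (simp add: indicator_def of_bool_def)
  qed
  show "(\<lambda>(\<omega>, z). indicator {\<omega>. 0 < spread base \<omega>} \<omega> * kernel_sum (spread base \<omega>) \<omega> z) \<in> borel_measurable (tuples \<Otimes>\<^sub>M lborel)"
    using measurable_kernel_sum[of 0 base] i[of "\<lambda>s. 0 < s"] by (auto simp: split_beta' intro!: borel_measurable_times_ennreal)
  show "(\<lambda>(\<omega>, z). indicator {\<omega>. spread base \<omega> < \<delta>} \<omega> * kernel_sum (\<delta> + spread base \<omega>) \<omega> z) \<in> borel_measurable (tuples \<Otimes>\<^sub>M lborel)"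
    using measurable_kernel_sum[of \<delta> base] i[of "\<lambda>s. s < \<delta>"] by (auto simp: split_beta' intro!: borel_measurable_times_ennreal)
qed

lemma pair_sf: "pair_sigma_finite tuples (lborel :: (complex^'n) measure)"
  by (intro pair_sigma_finite.intro P.sigma_finite_measure_axioms sigma_finite_lborel)

lemma measurable_majorant: "majorant base \<in> borel_measurable lborel"
proof -
  have "(\<lambda>(z, \<omega>). indicator {\<omega>. 0 < spread base \<omega>} \<omega> * kernel_sum (spread base \<omega>) \<omega> z)
      \<in> borel_measurable (lborel \<Otimes>\<^sub>M tuples)"
    using measurable_compose[OF measurable_pair_swap' measurable_restricted_kernel(1)[of base]] by (simp add: split_beta')
  from P.borel_measurable_nn_integral[OF this] show ?thesis unfolding majorant_def[abs_def] .
qed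

text \<open>Tonelli: for each tuple off the diagonal the inner integral is bounded independently of the tuple.\<close>

lemma majorant_integral_le:
  assumes V: "\<forall>s>0. \<forall>p. (\<integral>\<^sup>+ z. ennreal (polar_kernel CARD('n) s (chord k p z)) * indicator (cball 0 Rad) z \<partial>lborel) \<le> V"
  shows "(\<integral>\<^sup>+ z. majorant base z * indicator (cball 0 Rad) z \<partial>lborel) \<le> of_nat CARD('n) * V"
proof -
  interpret PL: pair_sigma_finite tuples "lborel :: (complex^'n) measure" by (rule pair_sf)
  let ?f = "\<lambda>\<omega> z. indicator {\<omega>. 0 < spread base \<omega>} \<omega> * kernel_sum (spread base \<omega>) \<omega> z"
  have m1: "(\<lambda>(\<omega>, z). ?f \<omega> z * indicator (cball 0 Rad) z) \<in> borel_measurable (tuples \<Otimes>\<^sub>M lborel)"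
  proof -
    have "(\<lambda>x. indicator (cball (0::complex^'n) Rad) (snd x) :: ennreal) \<in> borel_measurable (tuples \<Otimes>\<^sub>M lborel)"
      by (rule measurable_compose[OF measurable_snd], rule borel_measurable_indicator) simp
    then show ?thesis using measurable_restricted_kernel(1)[of base] by (auto simp: split_beta' intro!: borel_measurable_times_ennreal)
  qed
  have mz: "(\<lambda>\<omega>. ?f \<omega> z) \<in> borel_measurable tuples" for z
    using measurable_compose[OF measurable_Pair2'[of z] measurable_restricted_kernel(1)] by simp
  have mw: "(\<lambda>z. kernel_sum (spread base \<omega>) \<omega> z * indicator (cball 0 Rad) z) \<in> borel_measurable lborel" for \<omega>
  proof -
    have "(\<lambda>z. kernel_sum (spread base \<omega>) \<omega> z) \<in> borel_measurable lborel"
      using measurable_compose[OF measurable_Pair1'[of \<omega>] measurable_kernel_sum[of 0 base]] by (simp add: space_PiM)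
    then show ?thesis by (intro borel_measurable_times_ennreal borel_measurable_indicator) auto
  qed
  have "(\<integral>\<^sup>+ z. majorant base z * indicator (cball 0 Rad) z \<partial>lborel) =
    (\<integral>\<^sup>+ z. (\<integral>\<^sup>+ \<omega>. ?f \<omega> z * indicator (cball 0 Rad) z \<partial>tuples) \<partial>lborel)"
    unfolding majorant_def by (intro nn_integral_cong nn_integral_multc[symmetric] mz)
  also have "\<dots> = (\<integral>\<^sup>+ \<omega>. (\<integral>\<^sup>+ z. ?f \<omega> z * indicator (cball 0 Rad) z \<partial>lborel) \<partial>tuples)"
    using PL.Fubini'[OF m1] by simp
  also have "\<dots> \<le> (\<integral>\<^sup>+ \<omega>. of_nat CARD('n) * V \<partial>tuples)"
  proof (intro nn_integral_mono)
    fix \<omega>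
    show "(\<integral>\<^sup>+ z. ?f \<omega> z * indicator (cball 0 Rad) z \<partial>lborel) \<le> of_nat CARD('n) * V"
    proof (cases "spread base \<omega> > 0")
      case True
      then show ?thesis using kernel_sum_integral_le[OF V True] by simp
    qed simp
  qed
  also have "\<dots> = of_nat CARD('n) * V" using P.emeasure_space_1 by simp
  finally show ?thesis .
qed

text \<open>Tuples with \<open>spread \<ge> \<delta>\<close> are dominated by twice the kernel with \<open>\<delta> = 0\<close> and give the
  majorant. For the others the uniform integral bound leaves only the measure of the set of such tuples.\<close>

lemma approximate_density_bound:
  assumes Rad: "Rad \<ge> 0"
  shows "\<exists>c<\<infinity>. \<forall>\<delta>>0. \<forall>h\<in>borel_measurable lborel. (\<forall>z. h z \<le> indicator (cball 0 Rad) z) \<longrightarrow>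
    (\<integral>\<^sup>+ z. h z * ennreal (cmod (det (hess_mean \<delta> z))) \<partial>lborel) \<le>
      c * ((\<integral>\<^sup>+ z. h z * majorant base z \<partial>lborel) + emeasure tuples {\<omega>\<in>space tuples. spread base \<omega> < \<delta>})"
proof -
  interpret PL: pair_sigma_finite tuples "lborel :: (complex^'n) measure" by (rule pair_sf)
  obtain K where K: "K > 0" "\<And>\<omega> \<delta> z. \<delta> > 0 \<Longrightarrow> norm z \<le> Rad \<Longrightarrow> (\<forall>l. chord k (\<omega> l) z > 0) \<Longrightarrow>
    cmod (det (mixed_matrix k \<delta> \<omega> z)) \<le> K * (\<Sum>l\<in>UNIV. polar_kernel CARD('n) (\<delta> + spread base \<omega>) (chord k (\<omega> l) z))"
    using det_mixed_bound[OF Rad, of k base] by blast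
  obtain V where V: "V < \<infinity>" "\<forall>s>0. \<forall>p. (\<integral>\<^sup>+ z. ennreal (polar_kernel CARD('n) s (chord k p z)) * indicator (cball 0 Rad) z \<partial>lborel) \<le> V"
    using chord_kernel_integral_bound[OF Rad, of k] by blast
  define c where "c = ennreal K * (2 + of_nat CARD('n) * V)"
  have "c < \<infinity>" unfolding c_def using V(1) by (auto simp: ennreal_mult_less_top ennreal_of_nat_eq_real_of_nat)
  moreover have "(\<integral>\<^sup>+ z. h z * ennreal (cmod (det (hess_mean \<delta> z))) \<partial>lborel) \<le>
      c * ((\<integral>\<^sup>+ z. h z * majorant base z \<partial>lborel) + emeasure tuples {\<omega>\<in>space tuples. spread base \<omega> < \<delta>})"
    if \<delta>: "\<delta> > 0" and h: "h \<in> borel_measurable lborel" "\<And>z. h z \<le> indicator (cball 0 Rad) z" for \<delta> and h :: "complex^'n \<Rightarrow> ennreal"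
  proof -
    let ?s = "spread base"
    let ?A = "\<lambda>\<omega> z. indicator {\<omega>. 0 < ?s \<omega>} \<omega> * kernel_sum (?s \<omega>) \<omega> z"
    let ?B = "\<lambda>\<omega> z. indicator {\<omega>. ?s \<omega> < \<delta>} \<omega> * kernel_sum (\<delta> + ?s \<omega>) \<omega> z"
    \<comment> \<open>\<open>?A\<close> collects the tuples far from the diagonal, \<open>?B\<close> those near it.\<close>
    have split: "kernel_sum (\<delta> + ?s \<omega>) \<omega> z \<le> 2 * ?A \<omega> z + ?B \<omega> z" for \<omega> z
    proof (cases "?s \<omega> < \<delta>")
      case True
      then show ?thesis by (simp add: add_increasing)
    next
      case False
      then have "0 < ?s \<omega>" "\<delta> \<le> ?s \<omega>" using \<delta> by auto
      then have "kernel_sum (\<delta> + ?s \<omega>) \<omega> z \<le> 2 * kernel_sum (?s \<omega>) \<omega> z"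
        unfolding kernel_sum_def sum_distrib_left using \<delta>
        by (intro sum_mono polar_ennreal_le_double chord_nonneg)
      then show ?thesis using \<open>0 < ?s \<omega>\<close> by (simp add: add_increasing2)
    qed
    have det_le: "ennreal (cmod (det (mixed_matrix k \<delta> \<omega> z))) \<le> ennreal K * kernel_sum (\<delta> + ?s \<omega>) \<omega> z"
      if z: "norm z \<le> Rad" for \<omega> z
    proof (cases "\<exists>l. chord k (\<omega> l) z = 0")
      case True
      then have "kernel_sum (\<delta> + ?s \<omega>) \<omega> z = \<infinity>"
        unfolding kernel_sum_def by (auto simp: polar_ennreal_def)
      then show ?thesis using K(1) by (simp add: ennreal_mult_top)
    next
      case False
      then have pos: "chord k (\<omega> l) z > 0" for l using chord_nonneg[of k "\<omega> l" z] by (metis order_less_le)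
      have g: "polar_kernel CARD('n) (\<delta> + ?s \<omega>) (chord k (\<omega> l) z) \<ge> 0" for l
        unfolding polar_kernel_def using \<delta> spread_nonneg[of base \<omega>] chord_nonneg[of k "\<omega> l" z]
        by (intro divide_nonneg_nonneg mult_nonneg_nonneg zero_le_power) auto
      have "ennreal (cmod (det (mixed_matrix k \<delta> \<omega> z))) \<le>
          ennreal (K * (\<Sum>l\<in>UNIV. polar_kernel CARD('n) (\<delta> + ?s \<omega>) (chord k (\<omega> l) z)))"
        using pos by (intro ennreal_leI K(2) \<delta> z) auto
      also have "\<dots> = ennreal K * kernel_sum (\<delta> + ?s \<omega>) \<omega> z"
        unfolding kernel_sum_def polar_ennreal_def using False K(1) g
        by (simp add: ennreal_mult' sum_ennreal)
      finally show ?thesis .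
    qed
    have mA: "(\<lambda>\<omega>. ?A \<omega> z) \<in> borel_measurable tuples" for z
      using measurable_compose[OF measurable_Pair2'[of z] measurable_restricted_kernel(1)] by simp
    have mB: "(\<lambda>\<omega>. ?B \<omega> z) \<in> borel_measurable tuples" for z
      using measurable_compose[OF measurable_Pair2'[of z] measurable_restricted_kernel(2)] by simp
    have mBz: "(\<lambda>z. \<integral>\<^sup>+ \<omega>. ?B \<omega> z \<partial>tuples) \<in> borel_measurable lborel"
    proof -
      have "(\<lambda>(z, \<omega>). ?B \<omega> z) \<in> borel_measurable (lborel \<Otimes>\<^sub>M tuples)"
        using measurable_compose[OF measurable_pair_swap' measurable_restricted_kernel(2)[of base \<delta>]] by (simp add: split_beta')
      from P.borel_measurable_nn_integral[OF this] show ?thesis .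
    qed
    have pointwise: "h z * ennreal (cmod (det (hess_mean \<delta> z))) \<le>
      ennreal K * (2 * (h z * majorant base z) + h z * (\<integral>\<^sup>+ \<omega>. ?B \<omega> z \<partial>tuples))" for z
    proof (cases "norm z \<le> Rad")
      case True
      have "ennreal (cmod (det (hess_mean \<delta> z))) \<le> (\<integral>\<^sup>+\<omega>. ennreal (cmod (det (mixed_matrix k \<delta> \<omega> z))) \<partial>tuples)"
        by (rule norm_det_hess_mean[OF \<delta>])
      also have "\<dots> \<le> (\<integral>\<^sup>+\<omega>. ennreal K * (2 * ?A \<omega> z + ?B \<omega> z) \<partial>tuples)"
        by (intro nn_integral_mono order_trans[OF det_le[OF True]] mult_left_mono split) auto
      also have "\<dots> = ennreal K * (2 * majorant base z + (\<integral>\<^sup>+ \<omega>. ?B \<omega> z \<partial>tuples))"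
        unfolding majorant_def using mA[of z] mB[of z]
        by (simp add: nn_integral_cmult nn_integral_add)
      finally have "h z * ennreal (cmod (det (hess_mean \<delta> z))) \<le>
          h z * (ennreal K * (2 * majorant base z + (\<integral>\<^sup>+ \<omega>. ?B \<omega> z \<partial>tuples)))"
        by (rule mult_left_mono) simp
      then show ?thesis by (simp only: distrib_left mult_ac)
    next
      case False
      then have "h z = 0" using h(2)[of z] by (simp add: indicator_def)
      then show ?thesis by simp
    qed
    have near: "(\<integral>\<^sup>+ z. h z * (\<integral>\<^sup>+ \<omega>. ?B \<omega> z \<partial>tuples) \<partial>lborel) \<le>
        of_nat CARD('n) * V * emeasure tuples {\<omega>\<in>space tuples. ?s \<omega> < \<delta>}"
    proof -
      have m1: "(\<lambda>(\<omega>, z). ?B \<omega> z * indicator (cball 0 Rad) z) \<in> borel_measurable (tuples \<Otimes>\<^sub>M lborel)"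
      proof -
        have "(\<lambda>x. indicator (cball (0::complex^'n) Rad) (snd x) :: ennreal) \<in> borel_measurable (tuples \<Otimes>\<^sub>M lborel)"
          by (rule measurable_compose[OF measurable_snd], rule borel_measurable_indicator) simp
        then show ?thesis using measurable_restricted_kernel(2)[of base \<delta>] by (auto simp: split_beta' intro!: borel_measurable_times_ennreal)
      qed
      have "(\<integral>\<^sup>+ z. h z * (\<integral>\<^sup>+ \<omega>. ?B \<omega> z \<partial>tuples) \<partial>lborel) \<le>
          (\<integral>\<^sup>+ z. (\<integral>\<^sup>+ \<omega>. ?B \<omega> z * indicator (cball 0 Rad) z \<partial>tuples) \<partial>lborel)"
      proof (intro nn_integral_mono)
        fix z
        have "h z * (\<integral>\<^sup>+ \<omega>. ?B \<omega> z \<partial>tuples) \<le> indicator (cball 0 Rad) z * (\<integral>\<^sup>+ \<omega>. ?B \<omega> z \<partial>tuples)"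
          by (intro mult_right_mono h) auto
        also have "\<dots> = (\<integral>\<^sup>+ \<omega>. ?B \<omega> z * indicator (cball 0 Rad) z \<partial>tuples)"
          using nn_integral_multc[OF mB[of z]] by (simp add: mult.commute)
        finally show "h z * (\<integral>\<^sup>+ \<omega>. ?B \<omega> z \<partial>tuples) \<le> (\<integral>\<^sup>+ \<omega>. ?B \<omega> z * indicator (cball 0 Rad) z \<partial>tuples)" .
      qed
      also have "\<dots> = (\<integral>\<^sup>+ \<omega>. (\<integral>\<^sup>+ z. ?B \<omega> z * indicator (cball 0 Rad) z \<partial>lborel) \<partial>tuples)"
        using PL.Fubini'[OF m1] by simp
      also have "\<dots> \<le> (\<integral>\<^sup>+ \<omega>. of_nat CARD('n) * V * indicator {\<omega>\<in>space tuples. ?s \<omega> < \<delta>} \<omega> \<partial>tuples)"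
      proof (intro nn_integral_mono)
        fix \<omega> assume \<omega>: "\<omega> \<in> space tuples"
        have pos: "\<delta> + ?s \<omega> > 0" using \<delta> spread_nonneg[of base \<omega>] by simp
        show "(\<integral>\<^sup>+ z. ?B \<omega> z * indicator (cball 0 Rad) z \<partial>lborel) \<le>
            of_nat CARD('n) * V * indicator {\<omega>\<in>space tuples. ?s \<omega> < \<delta>} \<omega>"
          using kernel_sum_integral_le[OF V(2) pos, of \<omega>] \<omega> by (cases "?s \<omega> < \<delta>") auto
      qed
      also have "\<dots> = of_nat CARD('n) * V * emeasure tuples {\<omega>\<in>space tuples. ?s \<omega> < \<delta>}"
        by (rule nn_integral_cmult_indicator) measurable
      finally show ?thesis .
    qed
    have "(\<integral>\<^sup>+ z. h z * ennreal (cmod (det (hess_mean \<delta> z))) \<partial>lborel) \<le>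
      (\<integral>\<^sup>+ z. ennreal K * (2 * (h z * majorant base z) + h z * (\<integral>\<^sup>+ \<omega>. ?B \<omega> z \<partial>tuples)) \<partial>lborel)"
      by (intro nn_integral_mono pointwise)
    also have "\<dots> = ennreal K * (2 * (\<integral>\<^sup>+ z. h z * majorant base z \<partial>lborel) + (\<integral>\<^sup>+ z. h z * (\<integral>\<^sup>+ \<omega>. ?B \<omega> z \<partial>tuples) \<partial>lborel))"
      using h(1) measurable_majorant[of base] mBz by (simp add: nn_integral_cmult nn_integral_add)
    also have "\<dots> \<le> ennreal K * (2 * (\<integral>\<^sup>+ z. h z * majorant base z \<partial>lborel) + of_nat CARD('n) * V * emeasure tuples {\<omega>\<in>space tuples. ?s \<omega> < \<delta>})"
      by (intro mult_left_mono add_left_mono near) auto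
    also have "\<dots> \<le> c * ((\<integral>\<^sup>+ z. h z * majorant base z \<partial>lborel) + emeasure tuples {\<omega>\<in>space tuples. ?s \<omega> < \<delta>})"
    proof -
      have "2 * a + b * e \<le> (2 + b) * (a + e)" for a b e :: ennreal
        by (simp only: distrib_left distrib_right) (simp add: add_increasing add_increasing2 add_mono)
      then show ?thesis unfolding c_def mult.assoc[of "ennreal K"] by (intro mult_left_mono) auto
    qed
    finally show ?thesis .
  qed
  ultimately show ?thesis by blast
qed

end

section \<open>Passage to the limit\<close>

context log_potential_chart
begin

lemma continuous_hess_mean:
  assumes \<delta>: "\<delta> > 0"
  shows "continuous_on UNIV (\<lambda>z. hess_mean \<delta> z $ j $ l)"
proof -
  interpret F: log_form_family UNIV \<mu> resid k "\<delta>\<^sup>2" by (rule log_form_family_resid[OF \<delta>])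
  show ?thesis
    using smooth_family_integral_Ck[OF open_UNIV M.finite_measure_axioms F.family_hessian, of 0 j l]
    unfolding hess_mean_def by simp
qed

lemma measurable_det_hess_mean:
  assumes "\<delta> > 0"
  shows "(\<lambda>z. det (hess_mean \<delta> z)) \<in> borel_measurable borel"
  unfolding det_def
  by (intro borel_measurable_continuous_onI continuous_intros continuous_hess_mean assms)

lemma smooth_MA_integral_le:
  fixes h :: "complex^'n \<Rightarrow> real"
  assumes \<delta>: "\<delta> > 0" and U: "open U" and h: "h \<in> borel_measurable borel"
  shows "(\<integral>\<^sup>+ z. ennreal (h z) \<partial>smooth_MA U (approx \<delta>)) \<le>
    ennreal (fact CARD('n) * (2 / pi) ^ CARD('n)) * (\<integral>\<^sup>+ z. ennreal (h z) * ennreal (cmod (det (hess_mean \<delta> z))) \<partial>lborel)"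
proof -
  define c where "c = fact CARD('n) * (2 / pi) ^ CARD('n)"
  have c: "c \<ge> 0" unfolding c_def by simp
  have U': "U \<inter> space lborel \<in> sets lborel" using U by simp
  have "(\<lambda>z. Re (top_power_density (ddc (approx \<delta>) z))) \<in> borel_measurable borel"
    unfolding top_power_density_approx[OF \<delta>] using measurable_det_hess_mean[OF \<delta>] by measurable
  then have m: "(\<lambda>z. ennreal (Re (top_power_density (ddc (approx \<delta>) z)))) \<in> borel_measurable (restrict_space lborel U)"
    by (intro measurable_restrict_space1) simp
  have mh: "(\<lambda>z. ennreal (h z)) \<in> borel_measurable (restrict_space lborel U)"
    using h by (intro measurable_restrict_space1) simp
  have "(\<integral>\<^sup>+ z. ennreal (h z) \<partial>smooth_MA U (approx \<delta>)) =
    (\<integral>\<^sup>+ z. ennreal (Re (top_power_density (ddc (approx \<delta>) z))) * ennreal (h z) \<partial>restrict_space lborel U)"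
    unfolding smooth_MA_def by (rule nn_integral_density[OF m mh])
  also have "\<dots> = (\<integral>\<^sup>+ z. ennreal (Re (top_power_density (ddc (approx \<delta>) z))) * ennreal (h z) * indicator U z \<partial>lborel)"
    by (rule nn_integral_restrict_space[OF U'])
  also have "\<dots> \<le> (\<integral>\<^sup>+ z. ennreal c * (ennreal (h z) * ennreal (cmod (det (hess_mean \<delta> z)))) \<partial>lborel)"
  proof (intro nn_integral_mono)
    fix z
    have "ennreal (Re (top_power_density (ddc (approx \<delta>) z))) \<le> ennreal (c * cmod (det (hess_mean \<delta> z)))"
      unfolding c_def by (intro ennreal_leI density_approx \<delta>)
    also have "\<dots> = ennreal c * ennreal (cmod (det (hess_mean \<delta> z)))" using c by (simp add: ennreal_mult)
    finally have "ennreal (Re (top_power_density (ddc (approx \<delta>) z))) * ennreal (h z) * indicator U z \<le>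
      (ennreal c * ennreal (cmod (det (hess_mean \<delta> z)))) * ennreal (h z) * 1"
      by (intro mult_mono) (auto simp: indicator_def)
    then show "ennreal (Re (top_power_density (ddc (approx \<delta>) z))) * ennreal (h z) * indicator U z \<le>
      ennreal c * (ennreal (h z) * ennreal (cmod (det (hess_mean \<delta> z))))" by (simp add: mult_ac)
  qed
  also have "\<dots> = ennreal c * (\<integral>\<^sup>+ z. ennreal (h z) * ennreal (cmod (det (hess_mean \<delta> z))) \<partial>lborel)"
    using h measurable_det_hess_mean[OF \<delta>] by (intro nn_integral_cmult) simp
  finally show ?thesis unfolding c_def .
qed

text \<open>As \<open>n \<ge> 2\<close>, there is an index other than \<open>base\<close>. On the diagonal the coordinates with these two indices agree, and for each
  value of the one, the other hits it with probability \<open>0\<close> because there are no atoms.\<close>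

lemma spread_null:
  assumes n: "2 \<le> CARD('n)" and atoms: "\<And>\<eta>. emeasure \<mu> {\<eta>} = 0"
  shows "emeasure tuples {\<omega>\<in>space tuples. spread base \<omega> \<le> 0} = 0"
proof -
  interpret Q: product_sigma_finite "\<lambda>_::'n. \<mu>" ..
  have "\<exists>i. i \<noteq> base"
  proof (rule ccontr)
    assume "\<not> ?thesis"
    then have "(UNIV :: 'n set) = {base}" by auto
    then have "CARD('n) = card {base}" by simp
    then show False using n by simp
  qed
  then obtain i where i: "i \<noteq> base" by blast
  let ?I = "UNIV - {i}"
  let ?f = "\<lambda>\<omega>. indicator {\<omega>\<in>space tuples. spread base \<omega> \<le> 0} \<omega> :: ennreal"
  have ins: "insert i ?I = UNIV" by auto
  have "(\<lambda>x. ?f x) \<in> borel_measurable tuples"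
    by (rule borel_measurable_indicator) measurable
  then have "(\<integral>\<^sup>+ \<omega>. ?f \<omega> \<partial>tuples) = (\<integral>\<^sup>+ x. (\<integral>\<^sup>+ y. ?f (x(i := y)) \<partial>\<mu>) \<partial>(\<Pi>\<^sub>M l\<in>?I. \<mu>))"
    using Q.product_nn_integral_insert[of ?I i ?f] unfolding ins by simp
  also have "\<dots> = (\<integral>\<^sup>+ x. 0 \<partial>(\<Pi>\<^sub>M l\<in>?I. \<mu>))"
  proof (intro nn_integral_cong)
    fix x :: "'n \<Rightarrow> 'n cproj"
    have m: "(\<lambda>p. proj_dist p (x base)) \<in> borel_measurable \<mu>"
    proof -
      have "(\<lambda>p. proj_mat p a b) \<in> borel_measurable \<mu>" for a b
        using measurable_proj_mat unfolding measurable_cong_sets[OF sets_mu refl] .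
      then show ?thesis unfolding proj_dist_def by measurable
    qed
    have "{p\<in>space \<mu>. proj_dist p (x base) = 0} \<in> sets \<mu>" using m by measurable
    then have s: "{x base} \<in> sets \<mu>" by (simp add: proj_dist_eq_0_iff)
    have "(\<integral>\<^sup>+ y. ?f (x(i := y)) \<partial>\<mu>) \<le> (\<integral>\<^sup>+ y. indicator {x base} y \<partial>\<mu>)"
    proof (intro nn_integral_mono)
      fix y
      have "y = x base" if "spread base (x(i := y)) \<le> 0"
      proof -
        have "proj_dist ((x(i := y)) i) ((x(i := y)) base) \<le> spread base (x(i := y))"
          unfolding spread_def by (rule member_le_sum) (auto simp: proj_dist_nonneg)
        then have "proj_dist y (x base) \<le> 0" using that i by simp
        then have "proj_dist y (x base) = 0" using proj_dist_nonneg[of y "x base"] by simp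
        then show ?thesis by (simp add: proj_dist_eq_0_iff)
      qed
      then show "?f (x(i := y)) \<le> indicator {x base} y" by (auto simp: indicator_def)
    qed
    also have "\<dots> = 0" using atoms s by simp
    finally show "(\<integral>\<^sup>+ y. ?f (x(i := y)) \<partial>\<mu>) = 0" by simp
  qed
  finally have "(\<integral>\<^sup>+ \<omega>. ?f \<omega> \<partial>tuples) = 0" by simp
  moreover have "{\<omega>\<in>space tuples. spread base \<omega> \<le> 0} \<in> sets tuples" by measurable
  ultimately show ?thesis by simp
qed

lemma spread_small_tendsto:
  assumes n: "2 \<le> CARD('n)" and atoms: "\<And>\<eta>. emeasure \<mu> {\<eta>} = 0"
  shows "(\<lambda>j. emeasure tuples {\<omega>\<in>space tuples. spread base \<omega> < 1 / real (Suc j)}) \<longlonglongrightarrow> 0"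
proof -
  let ?A = "\<lambda>j. {\<omega>\<in>space tuples. spread base \<omega> < 1 / real (Suc j)}"
  have "(\<lambda>j. emeasure tuples (?A j)) \<longlonglongrightarrow> emeasure tuples (\<Inter>j. ?A j)"
  proof (rule Lim_emeasure_decseq)
    show "range ?A \<subseteq> sets tuples" by (auto intro!: measurable_sets_borel)
    show "decseq ?A"
    proof (rule decseq_SucI)
      fix j
      have "1 / real (Suc (Suc j)) \<le> 1 / real (Suc j)" by (simp add: frac_le)
      then show "?A (Suc j) \<subseteq> ?A j" by auto
    qed
  qed (simp add: P.emeasure_eq_measure)
  moreover have "(\<Inter>j. ?A j) = {\<omega>\<in>space tuples. spread base \<omega> \<le> 0}"
  proof -
    have "s \<le> 0" if "\<forall>j. s < 1 / real (Suc j)" for s :: real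
    proof (rule ccontr)
      assume "\<not> s \<le> 0"
      then obtain j where "1 / real (Suc j) < s" using reals_Archimedean[of s] by (auto simp: inverse_eq_divide)
      then show False using that[rule_format, of j] by simp
    qed
    moreover have "s < 1 / real (Suc j)" if "s \<le> 0" for s j
      using that by (rule order_le_less_trans) simp
    ultimately show ?thesis by auto
  qed
  ultimately show ?thesis using spread_null[OF n atoms, of base] by simp
qed

lemma approx_is_smooth_psh_approx:
  assumes "open U"
    and \<phi>: "\<And>z. \<phi> z = ereal_integral \<mu> (\<lambda>p. log_ereal (chord k p z / norm (affine_lift k z))) + ereal (ln (norm (affine_lift k z)))"
  shows "smooth_psh_approx U (\<lambda>j. approx (1 / real (Suc j))) \<phi>"
  unfolding smooth_psh_approx_def
proof (intro conjI allI ballI)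
  fix j
  show "smooth_on U (approx (1 / real (Suc j)))" by (rule approx_smooth) simp
  show "psh_on U (\<lambda>z. ereal (approx (1 / real (Suc j)) z))"
    by (rule psh_on_subset[OF approx_psh]) (use assms in auto)
next
  fix z
  show "decseq (\<lambda>j. approx (1 / real (Suc j)) z)"
    by (intro decseq_SucI approx_mono) (auto simp: frac_le)
  show "(\<lambda>j. ereal (approx (1 / real (Suc j)) z)) \<longlonglongrightarrow> \<phi> z"
    unfolding \<phi> by (rule approx_tendsto)
qed

text \<open>The weak limit is tested with \<open>h\<close> along \<open>\<delta> = 1 / (j + 1)\<close>; the contribution of the tuples near the diagonal
  disappears in the limit.\<close>

lemma MA_compact_bound:
  assumes n: "2 \<le> CARD('n)" and atoms: "\<And>\<eta>. emeasure \<mu> {\<eta>} = 0"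
    and \<phi>: "\<And>z. \<phi> z = ereal_integral \<mu> (\<lambda>p. log_ereal (chord k p z / norm (affine_lift k z))) + ereal (ln (norm (affine_lift k z)))"
    and MA: "MA_on UNIV \<phi> \<sigma>" and Rad: "Rad \<ge> 0"
  shows "\<exists>c<\<infinity>. \<forall>h. continuous_on UNIV h \<longrightarrow> (\<forall>z. 0 \<le> h z) \<longrightarrow> (\<forall>z. ennreal (h z) \<le> indicator (cball 0 Rad) z) \<longrightarrow>
     (\<integral>\<^sup>+ z. ennreal (h z) \<partial>\<sigma>) \<le> c * (\<integral>\<^sup>+ z. ennreal (h z) * majorant base z \<partial>lborel)"
proof -
  obtain c where c: "c < \<infinity>" "\<And>\<delta> h. \<delta> > 0 \<Longrightarrow> h \<in> borel_measurable lborel \<Longrightarrow> (\<forall>z. h z \<le> indicator (cball 0 Rad) z) \<Longrightarrow>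
    (\<integral>\<^sup>+ z. h z * ennreal (cmod (det (hess_mean \<delta> z))) \<partial>lborel) \<le>
      c * ((\<integral>\<^sup>+ z. h z * majorant base z \<partial>lborel) + emeasure tuples {\<omega>\<in>space tuples. spread base \<omega> < \<delta>})"
    using approximate_density_bound[OF Rad, of base] by blast
  obtain V where V: "V < \<infinity>" "\<forall>s>0. \<forall>p. (\<integral>\<^sup>+ z. ennreal (polar_kernel CARD('n) s (chord k p z)) * indicator (cball 0 Rad) z \<partial>lborel) \<le> V"
    using chord_kernel_integral_bound[OF Rad, of k] by blast
  define c0 where "c0 = ennreal (fact CARD('n) * (2 / pi) ^ CARD('n)) * c"
  have c0: "c0 < \<infinity>" unfolding c0_def using c(1) by (simp add: ennreal_mult_less_top)
  have "(\<integral>\<^sup>+ z. ennreal (h z) \<partial>\<sigma>) \<le> c0 * (\<integral>\<^sup>+ z. ennreal (h z) * majorant base z \<partial>lborel)"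
    if h: "continuous_on UNIV h" "\<And>z. 0 \<le> h z" "\<And>z. ennreal (h z) \<le> indicator (cball 0 Rad) z" for h
  proof -
    let ?U = "ball (0::complex^'n) (Rad + 1)" and ?\<delta> = "\<lambda>j. 1 / real (Suc j)"
    define B where "B = (\<integral>\<^sup>+ z. ennreal (h z) * majorant base z \<partial>lborel)"
    define N where "N j = emeasure tuples {\<omega>\<in>space tuples. spread base \<omega> < ?\<delta> j}" for j
    have B: "B < \<infinity>"
    proof -
      have "B \<le> (\<integral>\<^sup>+ z. majorant base z * indicator (cball 0 Rad) z \<partial>lborel)"
        unfolding B_def by (intro nn_integral_mono) (subst mult.commute, intro mult_left_mono h; simp)
      also have "\<dots> \<le> of_nat CARD('n) * V" by (rule majorant_integral_le[OF V(2)])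
      also have "\<dots> < \<infinity>" using V(1) by (simp add: ennreal_mult_less_top ennreal_of_nat_eq_real_of_nat)
      finally show ?thesis .
    qed
    have hb: "h \<in> borel_measurable borel" using h(1) by (rule borel_measurable_continuous_onI)
    have supp: "{x. h x \<noteq> 0} \<subseteq> cball 0 Rad"
    proof
      fix x assume "x \<in> {x. h x \<noteq> 0}"
      then have "ennreal (h x) > 0" using h(2)[of x] by (simp add: less_le)
      then have "indicator (cball 0 Rad) x > (0::ennreal)" using h(3)[of x] by (rule less_le_trans)
      then show "x \<in> cball 0 Rad" by (cases "x \<in> cball 0 Rad") auto
    qed
    then have cl: "closure {x. h x \<noteq> 0} \<subseteq> cball 0 Rad" by (rule closure_minimal) simp
    have sets_\<sigma>: "sets \<sigma> = sets borel" using MA unfolding MA_on_def by simp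
    have "weakly_converges_on ?U (\<lambda>j. smooth_MA ?U (approx (?\<delta> j))) \<sigma>"
    proof -
      have "smooth_psh_approx ?U (\<lambda>j. approx (?\<delta> j)) \<phi>"
        by (rule approx_is_smooth_psh_approx[OF _ \<phi>]) simp
      moreover have "compact (closure ?U)" using Rad by simp
      ultimately show ?thesis using MA unfolding MA_on_def by blast
    qed
    moreover have "compact (closure {x. h x \<noteq> 0})"
      using cl by (meson bounded_cball bounded_subset closed_closure compact_eq_bounded_closed)
    moreover have "closure {x. h x \<noteq> 0} \<subseteq> ?U" using cl by auto
    ultimately have lim: "(\<lambda>j. integral\<^sup>L (smooth_MA ?U (approx (?\<delta> j))) h) \<longlonglongrightarrow> integral\<^sup>L \<sigma> h"
      using h(1) unfolding weakly_converges_on_def by blast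
    have Nfin: "N j < \<infinity>" for j unfolding N_def by (simp add: P.emeasure_eq_measure)
    have bound: "integral\<^sup>L (smooth_MA ?U (approx (?\<delta> j))) h \<le> enn2real (c0 * (B + N j))" for j
    proof -
      have d: "?\<delta> j > 0" by simp
      have "h \<in> borel_measurable (smooth_MA ?U (approx (?\<delta> j)))"
        unfolding smooth_MA_def using hb by (simp add: measurable_restrict_space1)
      then have "integral\<^sup>L (smooth_MA ?U (approx (?\<delta> j))) h = enn2real (\<integral>\<^sup>+ z. ennreal (h z) \<partial>smooth_MA ?U (approx (?\<delta> j)))"
        by (rule integral_eq_nn_integral) (simp add: h)
      also have "\<dots> \<le> enn2real (c0 * (B + N j))"
      proof (rule enn2real_mono)
        have "(\<integral>\<^sup>+ z. ennreal (h z) \<partial>smooth_MA ?U (approx (?\<delta> j))) \<le>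
          ennreal (fact CARD('n) * (2 / pi) ^ CARD('n)) * (\<integral>\<^sup>+ z. ennreal (h z) * ennreal (cmod (det (hess_mean (?\<delta> j) z))) \<partial>lborel)"
          by (rule smooth_MA_integral_le[OF d _ hb]) simp
        also have "\<dots> \<le> ennreal (fact CARD('n) * (2 / pi) ^ CARD('n)) * (c * (B + N j))"
          unfolding B_def N_def using hb h(3) by (intro mult_left_mono c(2) d) auto
        finally show "(\<integral>\<^sup>+ z. ennreal (h z) \<partial>smooth_MA ?U (approx (?\<delta> j))) \<le> c0 * (B + N j)"
          unfolding c0_def by (simp only: mult.assoc)
        show "c0 * (B + N j) < top" using c0 B Nfin[of j] by (simp add: ennreal_mult_less_top)
      qed
      finally show ?thesis .
    qed
    have "N \<longlonglongrightarrow> 0" unfolding N_def by (rule spread_small_tendsto[OF n atoms])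
    then have "(\<lambda>j. B + N j) \<longlonglongrightarrow> B + 0" by (intro tendsto_add tendsto_const)
    then have "(\<lambda>j. c0 * (B + N j)) \<longlonglongrightarrow> c0 * (B + 0)"
      using c0 by (intro ennreal_tendsto_cmult) auto
    then have "(\<lambda>j. enn2real (c0 * (B + N j))) \<longlonglongrightarrow> enn2real (c0 * B)"
      using c0 B by (intro tendsto_enn2real) (auto simp: ennreal_mult_less_top)
    from LIMSEQ_le[OF lim this] bound have le: "integral\<^sup>L \<sigma> h \<le> enn2real (c0 * B)" by blast
    have "integrable \<sigma> h"
    proof (rule integrableI_nonneg)
      show "h \<in> borel_measurable \<sigma>" using hb unfolding measurable_cong_sets[OF sets_\<sigma> refl] .
      have "(\<integral>\<^sup>+ z. ennreal (h z) \<partial>\<sigma>) \<le> (\<integral>\<^sup>+ z. indicator (cball 0 Rad) z \<partial>\<sigma>)" by (intro nn_integral_mono h)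
      also have "\<dots> = emeasure \<sigma> (cball 0 Rad)" by (rule nn_integral_indicator) (simp add: sets_\<sigma>)
      also have "\<dots> < \<infinity>" using MA unfolding MA_on_def by simp
      finally show "(\<integral>\<^sup>+ z. ennreal (h z) \<partial>\<sigma>) < \<infinity>" .
    qed (simp add: h)
    then have "(\<integral>\<^sup>+ z. ennreal (h z) \<partial>\<sigma>) = ennreal (integral\<^sup>L \<sigma> h)"
      by (rule nn_integral_eq_integral) (simp add: h)
    also have "\<dots> \<le> ennreal (enn2real (c0 * B))" by (rule ennreal_leI[OF le])
    also have "\<dots> = c0 * B" using c0 B by (intro ennreal_enn2real) (simp add: ennreal_mult_less_top)
    finally show ?thesis unfolding B_def .
  qed
  with c0 show ?thesis by blast
qed

text \<open>The bound is applied to continuous functions that decrease to the indicator of \<open>K\<close>. The measure with density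
  \<open>majorant\<close> is finite on the ball and vanishes on \<open>K\<close>, so it is continuous from above along the neighbourhoods \<open>A m\<close> of \<open>K\<close>.\<close>

lemma MA_null_compact:
  assumes n: "2 \<le> CARD('n)" and atoms: "\<And>\<eta>. emeasure \<mu> {\<eta>} = 0"
    and \<phi>: "\<And>z. \<phi> z = ereal_integral \<mu> (\<lambda>p. log_ereal (chord k p z / norm (affine_lift k z))) + ereal (ln (norm (affine_lift k z)))"
    and MA: "MA_on UNIV \<phi> \<sigma>" and K: "compact K" "emeasure lborel K = 0"
  shows "emeasure \<sigma> K = 0"
proof (cases "K = {}")
  case False
  obtain R0 where R0: "\<And>x. x \<in> K \<Longrightarrow> norm x \<le> R0" using compact_imp_bounded[OF K(1)] by (auto simp: bounded_iff)
  define Rad where "Rad = max 0 R0 + 1"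
  have Rad: "Rad \<ge> 0" unfolding Rad_def by simp
  \<comment> \<open>The base pole of the tuples may be any of them.\<close>
  obtain base :: 'n where True by blast
  obtain c where c: "c < \<infinity>" "\<And>h. continuous_on UNIV h \<Longrightarrow> (\<And>z. 0 \<le> h z) \<Longrightarrow> (\<And>z. ennreal (h z) \<le> indicator (cball 0 Rad) z) \<Longrightarrow>
     (\<integral>\<^sup>+ z. ennreal (h z) \<partial>\<sigma>) \<le> c * (\<integral>\<^sup>+ z. ennreal (h z) * majorant base z \<partial>lborel)"
    using MA_compact_bound[OF n atoms \<phi> MA Rad, of base] by blast
  obtain V where V: "V < \<infinity>" "\<forall>s>0. \<forall>p. (\<integral>\<^sup>+ z. ennreal (polar_kernel CARD('n) s (chord k p z)) * indicator (cball 0 Rad) z \<partial>lborel) \<le> V"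
    using chord_kernel_integral_bound[OF Rad, of k] by blast
  have sets_\<sigma>: "sets \<sigma> = sets borel" using MA unfolding MA_on_def by simp
  define \<nu> where "\<nu> = density lborel (\<lambda>z. majorant base z * indicator (cball 0 Rad) z)"
  have mm: "(\<lambda>z. majorant base z * indicator (cball 0 Rad) z) \<in> borel_measurable lborel"
    by (intro borel_measurable_times_ennreal measurable_majorant borel_measurable_indicator) simp
  have \<nu>: "emeasure \<nu> A = (\<integral>\<^sup>+ z. majorant base z * indicator (cball 0 Rad) z * indicator A z \<partial>lborel)" if "A \<in> sets borel" for A
    unfolding \<nu>_def using emeasure_density[OF mm, of A] that by simp
  have \<nu>fin: "emeasure \<nu> A \<noteq> \<infinity>" if "A \<in> sets borel" for A
  proof -
    have "emeasure \<nu> A \<le> (\<integral>\<^sup>+ z. majorant base z * indicator (cball 0 Rad) z \<partial>lborel)"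
      unfolding \<nu>[OF that] by (intro nn_integral_mono) (auto simp: indicator_def)
    also have "\<dots> \<le> of_nat CARD('n) * V" by (rule majorant_integral_le[OF V(2)])
    also have "\<dots> < \<infinity>" using V(1) by (simp add: ennreal_mult_less_top ennreal_of_nat_eq_real_of_nat)
    finally show ?thesis by simp
  qed
  define A where "A m = {z. infdist z K \<le> 1 / real (Suc m)}" for m
  have A: "A m \<in> sets borel" for m unfolding A_def
    by (intro borel_closed closed_Collect_le continuous_intros)
  have le: "emeasure \<sigma> K \<le> c * emeasure \<nu> (A m)" for m
  proof -
    \<comment> \<open>A tent function: \<open>1\<close> on \<open>K\<close>, supported in \<open>A m\<close>.\<close>
    define h where "h z = max 0 (1 - real (Suc m) * infdist z K)" for z
    have h1: "continuous_on UNIV h" unfolding h_def by (intro continuous_intros)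
    have h0: "0 \<le> h z" "h z \<le> 1" for z unfolding h_def using infdist_nonneg[of z K] by auto
    have hA: "z \<in> A m" if "h z \<noteq> 0" for z
    proof -
      have "real (Suc m) * infdist z K < 1" using that unfolding h_def by (auto simp: max_def split: if_splits)
      then show ?thesis unfolding A_def by (simp add: field_simps)
    qed
    have hR: "z \<in> cball 0 Rad" if "h z \<noteq> 0" for z
    proof -
      have "infdist z K \<le> 1 / real (Suc m)" using hA[OF that] unfolding A_def by simp
      also have "\<dots> \<le> 1" by simp
      finally have "infdist z K \<le> 1" .
      moreover obtain x where "x \<in> K" "infdist z K = dist z x"
        using infdist_attains_inf[OF compact_imp_closed[OF K(1)] False] by blast
      ultimately have "norm (z - x) \<le> 1" "norm x \<le> R0" using R0 by (auto simp: dist_norm)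
      then have "norm z \<le> Rad" unfolding Rad_def using norm_triangle_ineq[of "z - x" x] by simp
      then show ?thesis by simp
    qed
    have hle: "ennreal (h z) \<le> indicator (cball 0 Rad) z * indicator (A m) z" for z
    proof (cases "h z = 0")
      case False
      then show ?thesis using hA hR h0(2)[of z] by (simp add: ennreal_le_1)
    qed simp
    have "emeasure \<sigma> K = (\<integral>\<^sup>+ z. indicator K z \<partial>\<sigma>)"
      by (rule nn_integral_indicator[symmetric]) (simp add: sets_\<sigma> compact_imp_closed K)
    also have "\<dots> \<le> (\<integral>\<^sup>+ z. ennreal (h z) \<partial>\<sigma>)"
      by (intro nn_integral_mono) (auto simp: indicator_def h_def)
    also have "\<dots> \<le> c * (\<integral>\<^sup>+ z. ennreal (h z) * majorant base z \<partial>lborel)"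
    proof (rule c(2)[OF h1 h0(1)])
      fix z
      show "ennreal (h z) \<le> indicator (cball 0 Rad) z"
        using hle[of z] by (rule order_trans) (auto simp: indicator_def)
    qed
    also have "\<dots> \<le> c * emeasure \<nu> (A m)"
      unfolding \<nu>[OF A]
    proof (intro mult_left_mono nn_integral_mono)
      fix z
      have "ennreal (h z) * majorant base z \<le> (indicator (cball 0 Rad) z * indicator (A m) z) * majorant base z"
        by (intro mult_right_mono hle) simp
      then show "ennreal (h z) * majorant base z \<le> majorant base z * indicator (cball 0 Rad) z * indicator (A m) z"
        by (simp add: mult_ac)
    qed simp
    finally show ?thesis .
  qed
  have "(\<lambda>m. emeasure \<nu> (A m)) \<longlonglongrightarrow> emeasure \<nu> (\<Inter>m. A m)"
  proof (rule Lim_emeasure_decseq)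
    show "range A \<subseteq> sets \<nu>" using A unfolding \<nu>_def by auto
    show "decseq A"
    proof (rule decseq_SucI)
      fix m
      have "1 / real (Suc (Suc m)) \<le> 1 / real (Suc m)" by (simp add: frac_le)
      then show "A (Suc m) \<subseteq> A m" unfolding A_def by auto
    qed
  qed (use \<nu>fin A in blast)
  moreover have "(\<Inter>m. A m) = K"
  proof -
    have "s \<le> 0" if "\<forall>j. s \<le> 1 / real (Suc j)" for s :: real
    proof (rule ccontr)
      assume "\<not> s \<le> 0"
      then obtain j where "1 / real (Suc j) < s" using reals_Archimedean[of s] by (auto simp: inverse_eq_divide)
      then show False using that[rule_format, of j] by simp
    qed
    then have "(\<Inter>m. A m) = {z. infdist z K \<le> 0}" unfolding A_def by (auto intro: order_trans)
    also have "\<dots> = K"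
      using in_closed_iff_infdist_zero[OF compact_imp_closed[OF K(1)] False] infdist_nonneg[of _ K]
      by (auto intro: antisym)
    finally show ?thesis .
  qed
  moreover have "emeasure \<nu> K = 0"
  proof -
    have Kb: "K \<in> sets borel" using K(1) by (simp add: compact_imp_closed)
    then have "AE z in lborel. z \<notin> K" using K(2) by (intro AE_not_in) (simp add: null_sets_def)
    then have "AE z in lborel. majorant base z * indicator (cball 0 Rad) z * indicator K z = 0"
      by eventually_elim simp
    then have "(\<integral>\<^sup>+ z. majorant base z * indicator (cball 0 Rad) z * indicator K z \<partial>lborel) = (\<integral>\<^sup>+ (z::complex^'n). 0 \<partial>lborel)"
      by (rule nn_integral_cong_AE)
    then show ?thesis unfolding \<nu>[OF Kb] by simp
  qed
  ultimately have "(\<lambda>m. emeasure \<nu> (A m)) \<longlonglongrightarrow> 0" by simp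
  then have "(\<lambda>m. c * emeasure \<nu> (A m)) \<longlonglongrightarrow> c * 0" using c(1) by (intro ennreal_tendsto_cmult) auto
  then have "emeasure \<sigma> K \<le> c * 0" by (rule LIMSEQ_le_const) (use le in blast)
  then show ?thesis by simp
qed simp

text \<open>Inner regularity on each closed ball, where the Monge--Ampere measure is finite, reduces Borel sets to compact sets.\<close>

lemma MA_null:
  assumes n: "2 \<le> CARD('n)" and atoms: "\<And>\<eta>. emeasure \<mu> {\<eta>} = 0"
    and \<phi>: "\<And>z. \<phi> z = ereal_integral \<mu> (\<lambda>p. log_ereal (chord k p z / norm (affine_lift k z))) + ereal (ln (norm (affine_lift k z)))"
    and MA: "MA_on UNIV \<phi> \<sigma>" and A: "A \<in> sets borel" "emeasure lborel A = 0"
  shows "emeasure \<sigma> A = 0"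
proof -
  have sets_\<sigma>: "sets \<sigma> = sets borel" using MA unfolding MA_on_def by simp
  have "emeasure \<sigma> (A \<inter> cball 0 (real m)) = 0" for m
  proof -
    \<comment> \<open>Inner regularity holds for finite measures, so \<open>\<sigma>\<close> is cut off outside a ball.\<close>
    define \<tau> where "\<tau> = density \<sigma> (indicator (cball 0 (real m)))"
    have \<tau>: "emeasure \<tau> B = emeasure \<sigma> (B \<inter> cball 0 (real m))" if "B \<in> sets borel" for B
    proof -
      have "(indicator (cball 0 (real m)) :: _ \<Rightarrow> ennreal) \<in> borel_measurable \<sigma>"
        by (rule borel_measurable_indicator) (simp add: sets_\<sigma>)
      then have "emeasure \<tau> B = (\<integral>\<^sup>+ z. indicator (cball 0 (real m)) z * indicator B z \<partial>\<sigma>)"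
        unfolding \<tau>_def using that by (intro emeasure_density) (simp_all add: sets_\<sigma>)
      also have "\<dots> = (\<integral>\<^sup>+ z. indicator (B \<inter> cball 0 (real m)) z \<partial>\<sigma>)"
        by (intro nn_integral_cong) (auto simp: indicator_def)
      also have "\<dots> = emeasure \<sigma> (B \<inter> cball 0 (real m))"
        by (rule nn_integral_indicator) (use that in \<open>auto simp: sets_\<sigma>\<close>)
      finally show ?thesis .
    qed
    have sets_\<tau>: "sets \<tau> = sets borel" unfolding \<tau>_def by (simp add: sets_\<sigma>)
    have "emeasure \<tau> (space \<tau>) = emeasure \<sigma> (cball 0 (real m))"
      using \<tau>[of UNIV] sets_eq_imp_space_eq[OF sets_\<tau>] by simp
    also have "\<dots> < \<infinity>" using MA unfolding MA_on_def by simp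
    finally have "emeasure \<tau> A = (SUP K\<in>{K. K \<subseteq> A \<and> compact K}. emeasure \<tau> K)"
      by (intro inner_regular[OF sets_\<tau>]) (use A in auto)
    also have "\<dots> = 0"
    proof -
      have "emeasure \<tau> K = 0" if "K \<subseteq> A" "compact K" for K
      proof -
        have Kb: "K \<in> sets borel" using that by (simp add: compact_imp_closed)
        have "emeasure lborel K \<le> emeasure lborel A" by (rule emeasure_mono) (use that A in auto)
        then have "emeasure lborel K = 0" using A by simp
        from MA_null_compact[OF n atoms \<phi> MA that(2) this] have "emeasure \<sigma> K = 0" .
        moreover have "emeasure \<sigma> (K \<inter> cball 0 (real m)) \<le> emeasure \<sigma> K"
          by (rule emeasure_mono) (use Kb in \<open>auto simp: sets_\<sigma>\<close>)
        ultimately show ?thesis unfolding \<tau>[OF Kb] by simp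
      qed
      then have "(SUP K\<in>{K. K \<subseteq> A \<and> compact K}. emeasure \<tau> K) \<le> 0" by (intro SUP_least) auto
      then show ?thesis by simp
    qed
    finally show ?thesis unfolding \<tau>[OF A(1)] .
  qed
  then have "emeasure \<sigma> (\<Union>m. A \<inter> cball 0 (real m)) = 0"
    using A by (intro emeasure_UN_eq_0) (auto simp: sets_\<sigma>)
  moreover have "(\<Union>m. A \<inter> cball 0 (real m)) = A"
    using real_arch_simple by fastforce
  ultimately show ?thesis by simp
qed

end

section \<open>Affine charts of projective space\<close>

lemma has_derivative_vec:
  fixes f :: "'a::real_normed_vector \<Rightarrow> complex^'m"
  assumes "\<And>j. ((\<lambda>x. f x $ j) has_derivative (\<lambda>v. D v $ j)) (at x)"
  shows "(f has_derivative D) (at x)"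
proof (subst has_derivative_componentwise_within, rule ballI)
  fix i :: "complex^'m" assume "i \<in> Basis"
  then obtain j b where i: "i = axis j b" by (auto simp: Basis_vec_def)
  show "((\<lambda>x. f x \<bullet> i) has_derivative (\<lambda>x. D x \<bullet> i)) (at x)"
    unfolding i inner_axis by (rule bounded_linear.has_derivative[OF bounded_linear_inner_left assms])
qed

lemma rep_proj_pt_nth_zero_iff:
  assumes "v \<noteq> 0"
  shows "rep (proj_pt v) $ i = 0 \<longleftrightarrow> v $ i = 0"
proof -
  obtain c where "c \<noteq> 0" "rep (proj_pt v) = c *s v" using rep_proj_pt[OF assms] .
  then show ?thesis by simp
qed

lemma affine_chart_proj_pt:
  assumes "v \<noteq> 0"
  shows "affine_chart k (proj_pt v) = (\<chi> j. v $ skip_index k j / v $ k)"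
proof -
  obtain c where "c \<noteq> 0" "rep (proj_pt v) = c *s v" using rep_proj_pt[OF assms] .
  then show ?thesis unfolding affine_chart_def by simp
qed

lemma proj_pt_mem_affine_dom: "v \<noteq> 0 \<Longrightarrow> proj_pt v \<in> affine_dom k \<longleftrightarrow> v $ k \<noteq> 0"
  unfolding affine_dom_def by (simp add: rep_proj_pt_nth_zero_iff)

lemma affine_chart_lift: "affine_chart k (proj_pt (affine_lift k w)) = w"
  unfolding affine_chart_proj_pt[OF affine_lift_nonzero] by (simp add: vec_eq_iff)

lemma affine_lift_chart:
  assumes "p \<in> affine_dom k"
  shows "proj_pt (affine_lift k (affine_chart k p)) = p"
proof -
  have nz: "rep p $ k \<noteq> 0" using assms unfolding affine_dom_def by simp
  have "rep p = (rep p $ k) *s affine_lift k (affine_chart k p)"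
  proof (rule vec_eq_iff[THEN iffD2], rule allI)
    fix i
    show "rep p $ i = ((rep p $ k) *s affine_lift k (affine_chart k p)) $ i"
      using nz by (cases "i = k") (simp_all add: affine_lift_def affine_chart_def skip_drop_index)
  qed
  then have "proj_rel (affine_lift k (affine_chart k p)) (rep p)"
    unfolding proj_rel_def using nz rep_nonzero[of p] affine_lift_nonzero by blast
  then have "proj_pt (affine_lift k (affine_chart k p)) = proj_pt (rep p)"
    using proj_pt_eq_iff affine_lift_nonzero rep_nonzero by blast
  then show ?thesis by (simp add: proj_pt_rep)
qed

lemma proj_pt_lift_mem: "proj_pt (affine_lift k w) \<in> affine_dom k'\<longleftrightarrow> affine_lift k w $ k' \<noteq> 0"
  by (rule proj_pt_mem_affine_dom[OF affine_lift_nonzero])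

lemma inj_on_affine_chart: "inj_on (affine_chart k) (affine_dom k)"
  by (rule inj_on_inverseI[where g = "\<lambda>w. proj_pt (affine_lift k w)"]) (rule affine_lift_chart)

lemma affine_inv_eq: "affine_inv k w = proj_pt (affine_lift k w)"
  unfolding affine_inv_def
  by (rule the_inv_into_f_eq[OF inj_on_affine_chart affine_chart_lift]) (simp add: proj_pt_lift_mem)

lemma affine_chart_image: "affine_chart k ` affine_dom k = UNIV"
proof (intro equalityI subset_UNIV subsetI)
  fix w :: "complex^'a"
  have "affine_chart k (proj_pt (affine_lift k w)) \<in> affine_chart k ` affine_dom k"
    by (rule imageI) (simp add: proj_pt_lift_mem)
  then show "w \<in> affine_chart k ` affine_dom k" by (simp only: affine_chart_lift)
qed

lemma affine_chart_image_Int: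
  "affine_chart k' ` (affine_dom k \<inter> affine_dom k') = {w. affine_lift k' w $ k \<noteq> 0}"
proof (intro equalityI subsetI)
  fix w assume "w \<in> affine_chart k' ` (affine_dom k \<inter> affine_dom k')"
  then obtain p where p: "p \<in> affine_dom k" "p \<in> affine_dom k'" "w = affine_chart k' p" by blast
  then have "proj_pt (affine_lift k' w) \<in> affine_dom k" by (simp add: affine_lift_chart)
  then show "w \<in> {w. affine_lift k' w $ k \<noteq> 0}" by (simp add: proj_pt_lift_mem)
next
  fix w assume "w \<in> {w. affine_lift k' w $ k \<noteq> 0}"
  then have "proj_pt (affine_lift k' w) \<in> affine_dom k \<inter> affine_dom k'" by (simp add: proj_pt_lift_mem)
  then have "affine_chart k' (proj_pt (affine_lift k' w)) \<in> affine_chart k' ` (affine_dom k \<inter> affine_dom k')" by (rule imageI)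
  then show "w \<in> affine_chart k' ` (affine_dom k \<inter> affine_dom k')" by (simp only: affine_chart_lift)
qed

lemma continuous_affine_lift_nth: "continuous_on UNIV (\<lambda>z. affine_lift k z $ i)"
  by (intro continuous_at_imp_continuous_on ballI has_derivative_continuous[OF affine_lift_has_derivative])

lemma continuous_affine_lift: "continuous_on UNIV (affine_lift k)"
proof -
  have "continuous_on UNIV (\<lambda>z. \<chi> i. affine_lift k z $ i)"
    by (intro continuous_on_vec_lambda continuous_affine_lift_nth)
  then show ?thesis by simp
qed

lemma continuous_vec_nth: "continuous_on UNIV (\<lambda>v :: complex^'m. v $ i)"
  by (intro continuous_intros)

lemma open_affine_dom: "open (affine_dom k)"
proof -
  have "{v. v \<noteq> 0 \<and> proj_pt v \<in> affine_dom k} = {v. v $ k \<noteq> 0}"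
  proof (rule Collect_cong)
    fix v :: "complex^('a option)"
    show "(v \<noteq> 0 \<and> proj_pt v \<in> affine_dom k) = (v $ k \<noteq> 0)"
      by (cases "v = 0") (simp_all add: proj_pt_mem_affine_dom)
  qed
  moreover have "open {v :: complex^('a option). v $ k \<noteq> 0}"
    using open_Collect_neq[OF continuous_vec_nth[of k] continuous_on_const[of UNIV 0]] by simp
  ultimately show ?thesis unfolding open_cproj_def by simp
qed

lemma continuous_affine_chart: "continuous_on (affine_dom k) (affine_chart k)"
proof (rule continuous_on_open_vimage[OF open_affine_dom, THEN iffD2], intro allI impI)
  fix B :: "(complex^'a) set" assume B: "open B"
  let ?g = "\<lambda>v :: complex^('a option). \<chi> j. v $ skip_index k j / v $ k"
  have S: "open {v :: complex^('a option). v $ k \<noteq> 0}"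
    using open_Collect_neq[OF continuous_vec_nth[of k] continuous_on_const[of UNIV 0]] by simp
  have "continuous_on {v. v $ k \<noteq> 0} ?g"
    by (intro continuous_on_vec_lambda continuous_intros) auto
  then have "open (?g -` B \<inter> {v. v $ k \<noteq> 0})"
    using continuous_on_open_vimage[OF S] B by blast
  moreover have "?g -` B \<inter> {v. v $ k \<noteq> 0} = {v. v \<noteq> 0 \<and> proj_pt v \<in> affine_chart k -` B \<inter> affine_dom k}"
  proof (rule set_eqI)
    fix v :: "complex^('a option)"
    show "v \<in> ?g -` B \<inter> {v. v $ k \<noteq> 0} \<longleftrightarrow> v \<in> {v. v \<noteq> 0 \<and> proj_pt v \<in> affine_chart k -` B \<inter> affine_dom k}"
      by (cases "v = 0") (simp_all add: proj_pt_mem_affine_dom affine_chart_proj_pt)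
  qed
  ultimately show "open (affine_chart k -` B \<inter> affine_dom k)" unfolding open_cproj_def by simp
qed

lemma continuous_affine_inv: "continuous_on UNIV (affine_inv k)"
proof (rule continuous_on_open_vimage[OF open_UNIV, THEN iffD2], intro allI impI)
  fix B :: "'a cproj set" assume "open B"
  then have "open {v. v \<noteq> 0 \<and> proj_pt v \<in> B}" unfolding open_cproj_def .
  then have "open (affine_lift k -` {v. v \<noteq> 0 \<and> proj_pt v \<in> B})"
    by (rule open_vimage[OF _ continuous_affine_lift])
  moreover have "affine_lift k -` {v. v \<noteq> 0 \<and> proj_pt v \<in> B} = affine_inv k -` B \<inter> UNIV"
    by (auto simp: affine_inv_eq affine_lift_nonzero)
  ultimately show "open (affine_inv k -` B \<inter> UNIV)" by simp
qed

lemma affine_transition: "(affine_chart k \<circ> affine_inv k') w = (\<chi> j. affine_lift k' w $ skip_index k j / affine_lift k' w $ k)"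
  by (simp add: affine_inv_eq affine_chart_proj_pt affine_lift_nonzero)

lemma affine_transition_has_derivative:
  assumes nz: "affine_lift k' w $ k \<noteq> 0"
  shows "((affine_chart k \<circ> affine_inv k') has_derivative
    (\<lambda>v. \<chi> j. (linear_lift k' v $ skip_index k j * affine_lift k' w $ k - affine_lift k' w $ skip_index k j * linear_lift k' v $ k)
      / (affine_lift k' w $ k * affine_lift k' w $ k))) (at w)"
proof (rule has_derivative_vec)
  fix j
  have "((\<lambda>w. affine_lift k' w $ skip_index k j / affine_lift k' w $ k) has_derivative
    (\<lambda>v. (linear_lift k' v $ skip_index k j * affine_lift k' w $ k - affine_lift k' w $ skip_index k j * linear_lift k' v $ k)
      / (affine_lift k' w $ k * affine_lift k' w $ k))) (at w)"
    by (rule has_derivative_divide'[OF affine_lift_has_derivative affine_lift_has_derivative nz])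
  then show "((\<lambda>x. (affine_chart k \<circ> affine_inv k') x $ j) has_derivative
    (\<lambda>v. (\<chi> j. (linear_lift k' v $ skip_index k j * affine_lift k' w $ k - affine_lift k' w $ skip_index k j * linear_lift k' v $ k)
      / (affine_lift k' w $ k * affine_lift k' w $ k)) $ j)) (at w)"
    unfolding affine_transition by simp
qed

lemma holomorphic_affine_transition:
  "holomorphic_map_on (affine_chart k' ` (affine_dom k \<inter> affine_dom k')) (affine_chart k \<circ> affine_inv k')"
  unfolding holomorphic_map_on_def affine_chart_image_Int
proof (intro ballI exI conjI allI)
  fix w assume "w \<in> {w. affine_lift k' w $ k \<noteq> 0}"
  then show "((affine_chart k \<circ> affine_inv k') has_derivative
    (\<lambda>v. \<chi> j. (linear_lift k' v $ skip_index k j * affine_lift k' w $ k - affine_lift k' w $ skip_index k j * linear_lift k' v $ k)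
      / (affine_lift k' w $ k * affine_lift k' w $ k))) (at w)"
    by (intro affine_transition_has_derivative) simp
  fix c v
  have "linear_lift k' (c *s v) $ i = c * linear_lift k' v $ i" for i
    by (simp add: linear_lift_def)
  then show "(\<chi> j. (linear_lift k' (c *s v) $ skip_index k j * affine_lift k' w $ k - affine_lift k' w $ skip_index k j * linear_lift k' (c *s v) $ k)
      / (affine_lift k' w $ k * affine_lift k' w $ k)) =
    c *s (\<chi> j. (linear_lift k' v $ skip_index k j * affine_lift k' w $ k - affine_lift k' w $ skip_index k j * linear_lift k' v $ k)
      / (affine_lift k' w $ k * affine_lift k' w $ k))"
    by (simp add: vec_eq_iff right_diff_distrib mult_ac)
qed

lemma the_inv_affine_chart: "the_inv_into (affine_dom k) (affine_chart k) = affine_inv k"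
  unfolding affine_inv_def ..

lemma holomorphic_chart_affine: "holomorphic_chart (affine_dom k) (affine_chart k)"
  unfolding holomorphic_chart_def affine_chart_image the_inv_affine_chart
proof (intro conjI allI)
  show "homeomorphism (affine_dom k) UNIV (affine_chart k) (affine_inv k)"
  proof (rule homeomorphismI)
    show "continuous_on UNIV (affine_inv k)" by (rule continuous_affine_inv)
    show "affine_inv k ` UNIV \<subseteq> affine_dom k" by (auto simp: affine_inv_eq proj_pt_lift_mem)
  qed (auto simp: affine_inv_eq affine_lift_chart affine_chart_lift continuous_affine_chart continuous_affine_inv)
  fix k'
  show "holomorphic_map_on (affine_chart k' ` (affine_dom k \<inter> affine_dom k')) (affine_chart k \<circ> affine_inv k')"
    by (rule holomorphic_affine_transition)
  show "holomorphic_map_on (affine_chart k ` (affine_dom k \<inter> affine_dom k')) (affine_chart k' \<circ> affine_inv k)"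
    using holomorphic_affine_transition[of k k'] by (simp only: Int_commute)
qed (auto simp: open_affine_dom inj_on_affine_chart)

lemma wedge_norm_scale: "wedge_norm (c *s v) w = cmod c * wedge_norm v w"
proof -
  have "c * v $ i * w $ j - c * v $ j * w $ i = c * (v $ i * w $ j - v $ j * w $ i)" for i j
    by (simp add: algebra_simps)
  then have "(\<Sum>i\<in>UNIV. \<Sum>j\<in>UNIV. (cmod ((c *s v) $ i * w $ j - (c *s v) $ j * w $ i))\<^sup>2) / 2 =
    (cmod c)\<^sup>2 * ((\<Sum>i\<in>UNIV. \<Sum>j\<in>UNIV. (cmod (v $ i * w $ j - v $ j * w $ i))\<^sup>2) / 2)"
    by (simp add: norm_mult power_mult_distrib sum_distrib_left)
  then show ?thesis unfolding wedge_norm_def by (simp only: real_sqrt_mult real_sqrt_abs abs_norm_cancel)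
qed

text \<open>Lagrange's identity.\<close>

lemma wedge_norm_sq: "(wedge_norm v w)\<^sup>2 = (norm v)\<^sup>2 * (norm w)\<^sup>2 - (cmod (\<Sum>i\<in>UNIV. cnj (w $ i) * v $ i))\<^sup>2"
proof -
  let ?p = "\<Sum>i\<in>UNIV. cnj (w $ i) * v $ i"
  let ?V = "\<Sum>i\<in>UNIV. v $ i * cnj (v $ i)" and ?W = "\<Sum>i\<in>UNIV. w $ i * cnj (w $ i)"
  have n: "complex_of_real ((norm x)\<^sup>2) = (\<Sum>i\<in>UNIV. x $ i * cnj (x $ i))" for x :: "complex^'a"
    by (simp only: norm_vec_sq of_real_sum of_real_power of_real_cmod_sq)
  have cp: "cnj ?p = (\<Sum>i\<in>UNIV. w $ i * cnj (v $ i))" by simp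
  have e: "complex_of_real ((cmod (v $ i * w $ j - v $ j * w $ i))\<^sup>2) =
      (v $ i * cnj (v $ i)) * (w $ j * cnj (w $ j)) + (w $ i * cnj (w $ i)) * (v $ j * cnj (v $ j))
      - (cnj (w $ i) * v $ i) * (w $ j * cnj (v $ j)) - (w $ i * cnj (v $ i)) * (cnj (w $ j) * v $ j)" for i j
    by (simp only: of_real_power of_real_cmod_sq complex_cnj_diff complex_cnj_mult) (simp only: algebra_simps)
  have "complex_of_real (\<Sum>i\<in>UNIV. \<Sum>j\<in>UNIV. (cmod (v $ i * w $ j - v $ j * w $ i))\<^sup>2) =
    ?V * ?W + ?W * ?V - ?p * cnj ?p - cnj ?p * ?p"
    unfolding of_real_sum e cp sum_product by (simp only: sum.distrib sum_subtractf)
  also have "\<dots> = complex_of_real (2 * ((norm v)\<^sup>2 * (norm w)\<^sup>2 - (cmod ?p)\<^sup>2))"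
    unfolding of_real_mult of_real_diff n of_real_power[of "cmod ?p"] of_real_cmod_sq by (simp add: algebra_simps)
  finally have eq: "(\<Sum>i\<in>UNIV. \<Sum>j\<in>UNIV. (cmod (v $ i * w $ j - v $ j * w $ i))\<^sup>2) = 2 * ((norm v)\<^sup>2 * (norm w)\<^sup>2 - (cmod ?p)\<^sup>2)"
    by (simp only: of_real_eq_iff)
  have "(wedge_norm v w)\<^sup>2 = (\<Sum>i\<in>UNIV. \<Sum>j\<in>UNIV. (cmod (v $ i * w $ j - v $ j * w $ i))\<^sup>2) / 2"
    unfolding wedge_norm_def by (rule real_sqrt_pow2) (intro divide_nonneg_nonneg sum_nonneg; simp)
  then show ?thesis unfolding eq by simp
qed

lemma wedge_norm_chord: "wedge_norm (affine_lift k z) (rep p) = norm (rep p) * chord k p z"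
proof (rule power2_eq_imp_eq)
  have nz: "norm (rep p) \<noteq> 0" using rep_nonzero[of p] by simp
  have "(\<Sum>i\<in>UNIV. cnj (rep p $ i) * affine_lift k z $ i) = of_real (norm (rep p)) * inner_rep k p z"
    unfolding inner_rep_def unit_rep_def sum_distrib_left using nz by (intro sum.cong) simp_all
  then have "(wedge_norm (affine_lift k z) (rep p))\<^sup>2 =
    (norm (affine_lift k z))\<^sup>2 * (norm (rep p))\<^sup>2 - (norm (rep p))\<^sup>2 * (cmod (inner_rep k p z))\<^sup>2"
    unfolding wedge_norm_sq by (simp add: norm_mult power_mult_distrib)
  also have "\<dots> = (norm (rep p))\<^sup>2 * ((norm (affine_lift k z))\<^sup>2 - (cmod (inner_rep k p z))\<^sup>2)"
    by (simp add: algebra_simps)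
  also have "(norm (affine_lift k z))\<^sup>2 - (cmod (inner_rep k p z))\<^sup>2 = (chord k p z)\<^sup>2"
    using chord_inner_rep[of k p z] by simp
  finally show "(wedge_norm (affine_lift k z) (rep p))\<^sup>2 = (norm (rep p) * chord k p z)\<^sup>2"
    by (simp only: power_mult_distrib)
  show "0 \<le> wedge_norm (affine_lift k z) (rep p)"
    unfolding wedge_norm_def by (intro real_sqrt_ge_zero divide_nonneg_nonneg sum_nonneg) auto
qed (simp add: chord_nonneg)

text \<open>The kernel does not depend on the choice of homogeneous coordinates, so those of the chart may be used for the first
  point.\<close>

lemma log_kernel_affine:
  "log_kernel (affine_inv k z) p = log_ereal (chord k p z / norm (affine_lift k z))"
proof -
  obtain c where c: "c \<noteq> 0" "rep (affine_inv k z) = c *s affine_lift k z"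
    unfolding affine_inv_eq using rep_proj_pt[OF affine_lift_nonzero] by blast
  have nz: "norm (rep p) \<noteq> 0" using rep_nonzero[of p] by simp
  have "wedge_norm (rep (affine_inv k z)) (rep p) / (norm (rep (affine_inv k z)) * norm (rep p)) =
    chord k p z / norm (affine_lift k z)"
    unfolding c(2) wedge_norm_scale norm_vscale wedge_norm_chord using c(1) nz by simp
  then show ?thesis unfolding log_kernel_def by simp
qed

section \<open>The Fubini--Study form and its null sets\<close>

text \<open>The local potentials \<open>log (|\<zeta>| / |\<zeta>\<^sub>k|)\<close> are, in any other chart, differences of two logarithms of Hermitian forms.\<close>

lemma ddc_diff_potential:
  assumes F1: "log_form_family X M1 R1 k \<epsilon>1" and F2: "log_form_family X M2 R2 k \<epsilon>2" and x: "x \<in> X"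
    and u: "\<And>y. y \<in> X \<Longrightarrow> u y = log_form_family.potential M1 R1 k \<epsilon>1 y - log_form_family.potential M2 R2 k \<epsilon>2 y"
  shows "ddc u x = (\<chi> j l. \<i> / of_real pi *
    ((\<integral>p. log_hessian k (R1 p) \<epsilon>1 x j l \<partial>M1) - (\<integral>p. log_hessian k (R2 p) \<epsilon>2 x j l \<partial>M2)))"
proof -
  interpret F1: log_form_family X M1 R1 k \<epsilon>1 by fact
  interpret F2: log_form_family X M2 R2 k \<epsilon>2 by fact
  have sub: "(\<Sum>j\<in>UNIV. a j * v $ j + b j * cnj (v $ j)) - (\<Sum>j\<in>UNIV. a' j * v $ j + b' j * cnj (v $ j)) =
    (\<Sum>j\<in>UNIV. (a j - a' j) * v $ j + (b j - b' j) * cnj (v $ j))" for a b a' b' and v :: "complex^'a"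
    unfolding sum_subtractf[symmetric] by (intro sum.cong) (simp_all add: algebra_simps)
  have zbar: "partial_zbar l (\<lambda>w. of_real (u w)) y =
      partial_zbar l (\<lambda>w. of_real (F1.potential w)) y - partial_zbar l (\<lambda>w. of_real (F2.potential w)) y"
    if y: "y \<in> X" for y l
  proof -
    note d = has_derivative_diff[OF F1.potential_has_derivative[OF y] F2.potential_has_derivative[OF y], unfolded sub]
    have "complex_of_real (F1.potential w) - of_real (F2.potential w) = of_real (u w)" if "w \<in> X" for w
      using that by (simp add: u)
    from partial_of_has_derivative(2)[OF has_derivative_transform_within_open[OF d F1.open_X y this]] show ?thesis
      unfolding F1.partial_zbar_potential[OF y] F2.partial_zbar_potential[OF y] .
  qed
  have "partial_z j (partial_zbar l (\<lambda>w. of_real (u w))) x =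
    (\<integral>p. log_hessian k (R1 p) \<epsilon>1 x j l \<partial>M1) - (\<integral>p. log_hessian k (R2 p) \<epsilon>2 x j l \<partial>M2)" for j l
  proof -
    note d = has_derivative_diff[OF F1.partial_zbar_potential_has_derivative[OF x, of l]
        F2.partial_zbar_potential_has_derivative[OF x, of l], unfolded sub]
    from partial_of_has_derivative(1)[OF has_derivative_transform_within_open[OF d F1.open_X x zbar[symmetric]]]
    show ?thesis .
  qed
  then show ?thesis unfolding ddc_def by simp
qed

text \<open>The matrices of \<open>1 + |z|\<^sup>2\<close> and, in \<open>coordinate_form\<close> below, of \<open>|Z\<^sub>k|\<^sup>2\<close>, as families with one member.\<close>

definition identity_form :: "unit \<Rightarrow> 'n option \<Rightarrow> 'n option \<Rightarrow> complex" where
  "identity_form p a b = (if a = b then 1 else 0)"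

definition coordinate_form :: "'n option \<Rightarrow> unit \<Rightarrow> 'n option \<Rightarrow> 'n option \<Rightarrow> complex" where
  "coordinate_form k p a b = (if a = k \<and> b = k then 1 else 0)"

abbreviation point_measure :: "unit measure" where
  "point_measure \<equiv> count_space UNIV"

lemma integral_point_measure: "(\<integral>p. f p \<partial>point_measure) = f ()"
  for f :: "unit \<Rightarrow> 'a::{banach, second_countable_topology}"
  by (simp add: lebesgue_integral_count_space_finite UNIV_unit)

lemma herm_row_identity: "herm_row k (identity_form p) z a = affine_lift k z $ a"
proof -
  have "herm_row k (identity_form p) z a = (\<Sum>b\<in>UNIV. if a = b then affine_lift k z $ a else 0)"
    unfolding herm_row_def identity_form_def by (intro sum.cong) auto
  then show ?thesis by simp
qed

lemma herm_form_identity: "herm_form k (identity_form p) z = of_real (1 + (norm z)\<^sup>2)"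
  unfolding herm_form_def herm_row_identity norm_affine_lift[of k z, symmetric]
  by (simp only: norm_vec_sq of_real_sum of_real_power of_real_cmod_sq mult.commute)

lemma herm_row_coordinate: "herm_row k' (coordinate_form k p) z a = (if a = k then affine_lift k' z $ k else 0)"
proof -
  have "herm_row k' (coordinate_form k p) z a = (\<Sum>b\<in>UNIV. if b = k then (if a = k then affine_lift k' z $ k else 0) else 0)"
    unfolding herm_row_def coordinate_form_def by (intro sum.cong) auto
  then show ?thesis by simp
qed

lemma herm_form_coordinate: "herm_form k' (coordinate_form k p) z = of_real ((cmod (affine_lift k' z $ k))\<^sup>2)"
proof -
  have "herm_form k' (coordinate_form k p) z =
    (\<Sum>a\<in>UNIV. if a = k then cnj (affine_lift k' z $ k) * affine_lift k' z $ k else 0)"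
    unfolding herm_form_def herm_row_coordinate by (intro sum.cong) auto
  then show ?thesis by (simp add: of_real_cmod_sq mult.commute)
qed

lemma identity_form_family:
  assumes "open X"
  shows "log_form_family X point_measure identity_form k 0"
proof
  show "\<exists>m>0. \<forall>x\<in>C. \<forall>p\<in>space point_measure. m \<le> Re (herm_form k (identity_form p) x) + 0" for C
    by (intro exI[of _ 1]) (auto simp: herm_form_identity)
qed (auto simp: assms identity_form_def intro: finite_measure_count_space)

lemma coordinate_form_family:
  fixes k k' :: "'n::finite option"
  shows "log_form_family {w. affine_lift k' w $ k \<noteq> 0} point_measure (coordinate_form k) k' 0"
proof
  show "open {w. affine_lift k' w $ k \<noteq> 0}"
    using open_Collect_neq[OF continuous_affine_lift_nth[of k' k] continuous_on_const[of UNIV 0]] by simp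
  fix C :: "(complex^'n) set" assume C: "compact C" "C \<subseteq> {w. affine_lift k' w $ k \<noteq> 0}"
  show "\<exists>m>0. \<forall>x\<in>C. \<forall>p\<in>space point_measure. m \<le> Re (herm_form k' (coordinate_form k p) x) + 0"
  proof (cases "C = {}")
    case False
    have "continuous_on C (\<lambda>w. (cmod (affine_lift k' w $ k))\<^sup>2)"
      by (intro continuous_intros continuous_on_subset[OF continuous_affine_lift_nth]) auto
    from continuous_attains_inf[OF C(1) False this]
    obtain x where x: "x \<in> C" "\<forall>y\<in>C. (cmod (affine_lift k' x $ k))\<^sup>2 \<le> (cmod (affine_lift k' y $ k))\<^sup>2" by blast
    then have "affine_lift k' x $ k \<noteq> 0" using C by auto
    then show ?thesis
      using x(2) by (intro exI[of _ "(cmod (affine_lift k' x $ k))\<^sup>2"]) (auto simp: herm_form_coordinate)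
  qed (auto intro: exI[of _ 1])
qed (auto simp: coordinate_form_def intro: finite_measure_count_space)

lemma identity_potential:
  "log_form_family.potential point_measure identity_form k 0 = (\<lambda>z. ln (1 + (norm z)\<^sup>2) / 2)"
proof (rule ext)
  fix z :: "complex^'a"
  interpret F: log_form_family UNIV point_measure identity_form k 0 by (rule identity_form_family) simp
  show "F.potential z = ln (1 + (norm z)\<^sup>2) / 2"
    unfolding F.potential_eq integral_point_measure herm_form_identity by simp
qed

lemma omega_FS_eq: "omega_FS w = (\<chi> j l. \<i> / of_real pi * log_hessian k (identity_form ()) 0 w j l)"
proof -
  interpret F: log_form_family UNIV point_measure identity_form k 0 by (rule identity_form_family) simp
  show ?thesis
    unfolding omega_FS_def identity_potential[of k, symmetric] F.ddc_potential[OF UNIV_I] integral_point_measure ..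
qed

definition fs_potential :: "'n::finite option \<Rightarrow> 'n cproj \<Rightarrow> real" where
  "fs_potential k p = ln (norm (rep p) / cmod (rep p $ k))"

lemma fs_potential_affine: "fs_potential k (affine_inv k' w) = ln (norm (affine_lift k' w) / cmod (affine_lift k' w $ k))"
proof -
  obtain c where c: "c \<noteq> 0" "rep (affine_inv k' w) = c *s affine_lift k' w"
    unfolding affine_inv_eq using rep_proj_pt[OF affine_lift_nonzero] by blast
  then show ?thesis unfolding fs_potential_def c(2) by (simp add: norm_vscale norm_mult)
qed

lemma fs_potential_diff:
  assumes "affine_lift k' w $ k \<noteq> 0"
  shows "fs_potential k (affine_inv k' w) =
    log_form_family.potential point_measure identity_form k' 0 w - log_form_family.potential point_measure (coordinate_form k) k' 0 w"
proof -
  interpret F: log_form_family "{w. affine_lift k' w $ k \<noteq> 0}" point_measure "coordinate_form k" k' 0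
    by (rule coordinate_form_family)
  have n: "norm (affine_lift k' w) > 0" using affine_lift_nonzero by simp
  have "F.potential w = ln ((cmod (affine_lift k' w $ k))\<^sup>2) / 2"
    unfolding F.potential_eq integral_point_measure herm_form_coordinate by simp
  also have "\<dots> = ln (cmod (affine_lift k' w $ k))" using assms by (simp add: ln_realpow)
  finally have 2: "F.potential w = ln (cmod (affine_lift k' w $ k))" .
  have "ln (1 + (norm w)\<^sup>2) / 2 = ln (norm (affine_lift k' w))"
    unfolding norm_affine_lift[of k' w, symmetric] using n by (simp add: ln_realpow)
  then show ?thesis
    unfolding fs_potential_affine 2 identity_potential using assms n by (simp add: ln_div)
qed

text \<open>\<open>log |Z\<^sub>k|\<close> is pluriharmonic where \<open>Z\<^sub>k \<noteq> 0\<close>.\<close>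

lemma coordinate_hessian_zero:
  assumes "affine_lift k' w $ k \<noteq> 0"
  shows "log_hessian k' (coordinate_form k p) 0 w j l = 0"
  unfolding log_hessian_def herm_form_coordinate herm_row_coordinate coordinate_form_def
    of_real_power of_real_cmod_sq
  using assms by (auto simp: power2_eq_square)

text \<open>In the chart \<open>k'\<close> the function is \<open>1/2 log (1 + |w|\<^sup>2) - log |Z\<^sub>k|\<close>, and the second term does not contribute to \<open>dd\<^sup>c\<close>.\<close>

lemma local_potential_fs: "local_potential (affine_dom k) (fs_potential k)"
  unfolding local_potential_def affine_chart_image_Int
proof (intro conjI allI ballI)
  fix k'
  let ?X = "{w. affine_lift k' w $ k \<noteq> 0}"
  interpret F2: log_form_family ?X point_measure "coordinate_form k" k' 0 by (rule coordinate_form_family)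
  interpret F1: log_form_family ?X point_measure identity_form k' 0
    by (rule identity_form_family) (rule F2.open_X)
  have "smooth_on ?X (\<lambda>x. Re (\<integral>p. of_real (ln (Re (herm_form k' (identity_form p) x) + 0) / 2)
      - of_real (ln (Re (herm_form k' (coordinate_form k p) x) + 0) / 2) \<partial>point_measure))"
    by (rule smooth_family_integral_smooth_on[OF F1.open_X F1.finite_M smooth_family_diff[OF F1.family_ln F2.family_ln]])
  moreover have "Re (\<integral>p. of_real (ln (Re (herm_form k' (identity_form p) w) + 0) / 2)
      - of_real (ln (Re (herm_form k' (coordinate_form k p) w) + 0) / 2) \<partial>point_measure) = (fs_potential k \<circ> affine_inv k') w"
    if "w \<in> ?X" for w
  proof -
    have "(fs_potential k \<circ> affine_inv k') w = F1.potential w - F2.potential w"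
      using that by (simp add: fs_potential_diff)
    then show ?thesis unfolding F1.potential_def F2.potential_def integral_point_measure by simp
  qed
  ultimately show "smooth_on ?X (fs_potential k \<circ> affine_inv k')"
    unfolding smooth_on_def using Ck_on_cong[OF F1.open_X] by (metis (no_types, lifting))
  fix w assume w: "w \<in> ?X"
  have "ddc (fs_potential k \<circ> affine_inv k') w = (\<chi> j l. \<i> / of_real pi *
    ((\<integral>p. log_hessian k' (identity_form p) 0 w j l \<partial>point_measure)
      - (\<integral>p. log_hessian k' (coordinate_form k p) 0 w j l \<partial>point_measure)))"
    by (rule ddc_diff_potential[OF F1.log_form_family_axioms F2.log_form_family_axioms w])
      (simp add: fs_potential_diff)
  then show "ddc (fs_potential k \<circ> affine_inv k') w = omega_FS w"
    using w unfolding omega_FS_eq[of w k'] integral_point_measure by (simp add: coordinate_hessian_zero)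
qed (rule open_affine_dom)

lemma cnj_det: "cnj (det A) = det (\<chi> i j. cnj (A $ i $ j))"
  for A :: "complex^'n^'n"
  unfolding det_def by (simp add: cnj_sum cnj_prod)

text \<open>For \<open>0 \<le> s \<le> t\<close> the matrix \<open>I - s w w\<^sup>*\<close>, up to transposition, is Hermitian and invertible, so its determinant is
  real and nonzero. Being \<open>1\<close> at \<open>s = 0\<close> it stays positive by the intermediate value theorem.\<close>

lemma det_identity_minus_rank_one_pos:
  fixes w :: "complex^'n" and t :: real
  assumes "0 \<le> t" "t * (norm w)\<^sup>2 < 1"
  shows "Re (det (\<chi> j l. (if l = j then 1 else 0) - of_real t * (cnj (w $ j) * w $ l))) > 0"
proof -
  define A :: "real \<Rightarrow> complex^'n^'n" where
    "A s = (\<chi> j l. (if l = j then 1 else 0) - of_real s * (cnj (w $ j) * w $ l))" for s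
  have nonzero: "Re (det (A s)) \<noteq> 0" if s: "0 \<le> s" "s \<le> t" for s
  proof
    assume 0: "Re (det (A s)) = 0"
    have "(\<chi> i j. cnj (A s $ i $ j)) = transpose (A s)"
      unfolding A_def transpose_def by (simp add: vec_eq_iff mult.commute)
    then have "cnj (det (A s)) = det (A s)" unfolding cnj_det by (simp only: det_transpose)
    then have "Im (cnj (det (A s))) = Im (det (A s))" by (simp only:)
    then have "Im (det (A s)) = 0" by simp
    then have "det (A s) = 0" using 0 by (simp add: complex_eq_iff)
    have "\<not> (\<exists>B. B ** A s = mat 1)"
    proof
      assume "\<exists>B. B ** A s = mat 1"
      then obtain B where "B ** A s = mat 1" by blast
      then have "det B * det (A s) = 1" unfolding det_mul[symmetric] by simp
      then show False using \<open>det (A s) = 0\<close> by simp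
    qed
    then obtain x where x: "A s *v x = 0" "x \<noteq> 0" unfolding matrix_left_invertible_ker by blast
    define S where "S = (\<Sum>l\<in>UNIV. w $ l * x $ l)"
    have comp: "x $ j = of_real s * cnj (w $ j) * S" for j
    proof -
      have "(A s *v x) $ j = (\<Sum>l\<in>UNIV. (if l = j then x $ j else 0) - of_real s * cnj (w $ j) * (w $ l * x $ l))"
        unfolding matrix_vector_mult_def A_def by (simp, intro sum.cong) (auto simp: algebra_simps)
      also have "\<dots> = x $ j - of_real s * cnj (w $ j) * S"
        unfolding S_def by (simp add: sum_subtractf sum_distrib_left)
      finally show ?thesis using x(1) by simp
    qed
    have "S = (\<Sum>l\<in>UNIV. w $ l * (of_real s * cnj (w $ l) * S))"
      unfolding comp[symmetric] by (rule S_def)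
    also have "\<dots> = of_real s * (\<Sum>l\<in>UNIV. w $ l * cnj (w $ l)) * S"
      by (simp add: sum_distrib_left sum_distrib_right mult_ac)
    also have "(\<Sum>l\<in>UNIV. w $ l * cnj (w $ l)) = of_real ((norm w)\<^sup>2)"
      by (simp only: norm_vec_sq of_real_sum of_real_power of_real_cmod_sq)
    finally have "S * of_real (1 - s * (norm w)\<^sup>2) = 0" by (simp add: algebra_simps)
    moreover have "s * (norm w)\<^sup>2 < 1" using s assms by (meson mult_right_mono order_le_less_trans zero_le_power2)
    ultimately have "S = 0" by (simp only: mult_eq_0_iff of_real_eq_0_iff) simp
    then have "x = 0" using comp by (simp add: vec_eq_iff)
    with x(2) show False by blast
  qed
  have cont: "continuous_on {0..t} (\<lambda>s. Re (det (A s)))"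
    unfolding det_def A_def by (intro continuous_intros)
  have "A 0 = mat 1" unfolding A_def mat_def by (simp add: vec_eq_iff)
  then have "Re (det (A 0)) = 1" by simp
  have "Re (det (A t)) > 0"
  proof (rule ccontr)
    assume "\<not> ?thesis"
    then obtain s where "0 \<le> s" "s \<le> t" "Re (det (A s)) = 0"
      using IVT2'[of "\<lambda>s. Re (det (A s))" t 0 0] cont \<open>Re (det (A 0)) = 1\<close> assms(1) by auto
    then show False using nonzero by blast
  qed
  then show ?thesis unfolding A_def .
qed

text \<open>The coefficient matrix of \<open>\<omega>\<close>, divided by \<open>\<i> / (2 \<pi> (1 + |w|\<^sup>2))\<close>.\<close>

definition fs_matrix :: "complex^'n \<Rightarrow> complex^'n^'n" where
  "fs_matrix w = (\<chi> j l. (if l = j then 1 else 0) - of_real (1 / (1 + (norm w)\<^sup>2)) * (cnj (w $ j) * w $ l))"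

lemma FS_density_eq:
  fixes w :: "complex^'n"
  shows "top_power_density (omega_FS w) = of_real (fact CARD('n) * (1 / (pi * (1 + (norm w)\<^sup>2))) ^ CARD('n)) * det (fs_matrix w)"
proof -
  define q where "q = 1 + (norm w)\<^sup>2"
  have q: "q > 0" unfolding q_def by (simp add: add_pos_nonneg)
  \<comment> \<open>The coefficients of \<open>\<omega>\<close> are the same functions in every chart.\<close>
  obtain k :: "'n option" where True by blast
  have entry: "log_hessian k (identity_form ()) 0 w j l = of_real (1 / (2 * q)) * fs_matrix w $ j $ l" for j l
  proof -
    have "skip_index k l = skip_index k j \<longleftrightarrow> l = j" by (metis drop_skip_index)
    then have "log_hessian k (identity_form ()) 0 w j l =
      (1/2) * ((if l = j then 1 else 0) / of_real q - cnj (w $ j) * w $ l / (of_real q)\<^sup>2)"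
      unfolding log_hessian_def herm_form_identity herm_row_identity affine_lift_skip q_def
      by (simp add: identity_form_def)
    also have "\<dots> = of_real (1 / (2 * q)) * ((if l = j then 1 else 0) - of_real (1 / q) * (cnj (w $ j) * w $ l))"
      using q by (simp add: field_simps power2_eq_square)
    finally show ?thesis unfolding fs_matrix_def q_def by simp
  qed
  have "omega_FS w = (\<chi> j. (\<i> / of_real pi * of_real (1 / (2 * q))) *s fs_matrix w $ j)"
    unfolding omega_FS_eq[of w k] entry by (simp add: vec_eq_iff mult.assoc)
  then have "det (omega_FS w) = (\<i> / of_real pi * of_real (1 / (2 * q))) ^ CARD('n) * det (fs_matrix w)"
    using det_rows_mul[of "\<lambda>_. \<i> / of_real pi * of_real (1 / (2 * q))" "\<lambda>j. fs_matrix w $ j"] by simp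
  then have "top_power_density (omega_FS w) =
      fact CARD('n) * ((- 2 * \<i>) * (\<i> / of_real pi * of_real (1 / (2 * q)))) ^ CARD('n) * det (fs_matrix w)"
    unfolding top_power_density_def by (simp only: power_mult_distrib mult.assoc)
  moreover have "(- 2 * \<i>) * (\<i> / complex_of_real pi * of_real (1 / (2 * q))) = of_real (1 / (pi * q))"
    using q by (simp add: field_simps)
  ultimately show ?thesis unfolding q_def by simp
qed

lemma FS_density_pos: "Re (top_power_density (omega_FS (w :: complex^'n))) > 0"
proof -
  have "(norm w)\<^sup>2 < 1 + (norm w)\<^sup>2" "1 + (norm w)\<^sup>2 > 0" by (simp_all add: add_pos_nonneg)
  then have "Re (det (fs_matrix w)) > 0"
    unfolding fs_matrix_def by (intro det_identity_minus_rank_one_pos) (simp_all add: divide_simps)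
  moreover have "fact CARD('n) * (1 / (pi * (1 + (norm w)\<^sup>2))) ^ CARD('n) > 0"
    using \<open>1 + (norm w)\<^sup>2 > 0\<close> by simp
  ultimately show ?thesis unfolding FS_density_eq Re_complex_of_real by (simp del: of_real_mult of_real_power)
qed

lemma measurable_FS_density: "(\<lambda>w :: complex^'n. ennreal (Re (top_power_density (omega_FS w)))) \<in> borel_measurable borel"
proof -
  have nz: "1 + (norm w)\<^sup>2 \<noteq> 0" "pi * (1 + (norm w)\<^sup>2) \<noteq> 0" for w :: "complex^'n"
    using zero_le_power2[of "norm w"] by (auto simp: add_nonneg_eq_0_iff)
  have "continuous_on UNIV (\<lambda>w :: complex^'n. Re (top_power_density (omega_FS w)))"
    unfolding FS_density_eq det_def fs_matrix_def vec_lambda_beta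
    by (intro continuous_intros) (use nz in auto)
  then have "(\<lambda>w :: complex^'n. Re (top_power_density (omega_FS w))) \<in> borel_measurable borel"
    by (rule borel_measurable_continuous_onI)
  then show ?thesis by (rule measurable_compose[OF _ measurable_ennreal])
qed

lemma measurable_affine_inv: "affine_inv k \<in> measurable borel borel"
  by (rule borel_measurable_continuous_onI[OF continuous_affine_inv])

text \<open>The density of \<open>\<omega>\<^sup>n\<close> is positive everywhere.\<close>

lemma FS_null_affine_None:
  assumes "A \<in> null_sets FS_volume"
  shows "emeasure lborel (affine_inv None -` A) = 0"
proof -
  define d where "d = (\<lambda>w :: complex^'a. ennreal (Re (top_power_density (omega_FS w))))"
  have A: "A \<in> sets borel" "emeasure FS_volume A = 0"
    using assms unfolding null_sets_def FS_volume_def by auto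
  have md: "d \<in> borel_measurable lborel" unfolding d_def using measurable_FS_density by simp
  have B: "affine_inv None -` A \<in> sets borel" using measurable_sets[OF measurable_affine_inv A(1), of None] by simp
  have "emeasure FS_volume A = emeasure (density lborel d) (affine_inv None -` A)"
    unfolding FS_volume_def d_def[symmetric] using measurable_affine_inv[of None] A(1)
    by (subst emeasure_distr) auto
  also have "\<dots> = (\<integral>\<^sup>+w. d w * indicator (affine_inv None -` A) w \<partial>lborel)"
    using B by (intro emeasure_density md) simp
  finally have "(\<integral>\<^sup>+w. d w * indicator (affine_inv None -` A) w \<partial>lborel) = 0" using A by simp
  moreover have "(\<lambda>w. d w * indicator (affine_inv None -` A) w) \<in> borel_measurable lborel"
    using B by (intro borel_measurable_times_ennreal md borel_measurable_indicator) simp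
  ultimately have "AE w in lborel. d w * indicator (affine_inv None -` A) w = 0"
    by (simp add: nn_integral_0_iff_AE)
  then have "AE w in lborel. w \<notin> affine_inv None -` A"
  proof eventually_elim
    case (elim w)
    have "d w \<noteq> 0" unfolding d_def using FS_density_pos[of w] by simp
    with elim show ?case by (auto simp: indicator_def split: if_splits)
  qed
  then have "affine_inv None -` A \<in> null_sets lborel"
    using AE_iff_null_sets[of "affine_inv None -` A" lborel] B by (simp only: sets_lborel)
  then show ?thesis by (rule null_setsD1)
qed

text \<open>The change of charts is differentiable and so preserves null sets. The points which it misses have a vanishing coordinate
  and form a hyperplane.\<close>

lemma FS_null_affine:
  fixes A :: "'n::finite cproj set"
  assumes A: "A \<in> null_sets FS_volume"
  shows "emeasure lborel (affine_inv k -` A) = 0"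
proof -
  have Ab: "A \<in> sets borel" using A unfolding null_sets_def FS_volume_def by auto
  have Bb: "affine_inv k -` A \<in> sets borel" for k using measurable_sets[OF measurable_affine_inv Ab, of k] by simp
  let ?B = "affine_inv None -` A \<inter> {z. affine_lift None z $ k \<noteq> 0}"
  let ?T = "affine_chart k \<circ> affine_inv None"
  have neg0: "negligible (affine_inv None -` A)"
    using FS_null_affine_None[OF A] Bb[of None] by (simp add: negligible_iff_emeasure0)
  have "?T differentiable_on ?B"
    unfolding differentiable_on_def
  proof
    fix z assume "z \<in> ?B"
    then have "affine_lift None z $ k \<noteq> 0" by simp
    from has_derivative_at_withinI[OF affine_transition_has_derivative[OF this]]
    show "?T differentiable (at z within ?B)" by (rule differentiableI)
  qed
  then have neg1: "negligible (?T ` ?B)"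
    by (intro negligible_differentiable_image_negligible negligible_subset[OF neg0 Int_lower1]) simp_all
  have neg2: "negligible {w :: complex^'n. affine_lift k w $ None = 0}"
  proof (cases k)
    case (Some j)
    have "{w :: complex^'n. affine_lift k w $ None = 0} \<subseteq> {w. axis j 1 \<bullet> w = 0}"
      unfolding Some affine_lift_def by (auto simp: drop_index_def inner_axis')
    moreover have "negligible {w :: complex^'n. axis j 1 \<bullet> w = 0}"
      by (rule negligible_hyperplane) (simp add: axis_eq_0_iff)
    ultimately show ?thesis by (rule negligible_subset[rotated])
  qed simp
  have "affine_inv k -` A \<subseteq> ?T ` ?B \<union> {w. affine_lift k w $ None = 0}"
  proof
    fix w assume w: "w \<in> affine_inv k -` A"
    show "w \<in> ?T ` ?B \<union> {w. affine_lift k w $ None = 0}"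
    proof (cases "affine_lift k w $ None = 0")
      case False
      define z where "z = affine_chart None (affine_inv k w)"
      have "affine_inv k w \<in> affine_dom None" using False by (simp add: affine_inv_eq proj_pt_lift_mem)
      then have z: "affine_inv None z = affine_inv k w" unfolding z_def by (simp add: affine_inv_eq affine_lift_chart)
      have "affine_inv k w \<in> affine_dom k" by (simp add: affine_inv_eq proj_pt_lift_mem)
      then have "affine_lift None z $ k \<noteq> 0" unfolding z[symmetric] by (simp add: affine_inv_eq proj_pt_lift_mem)
      moreover have "?T z = w" using z by (simp add: affine_inv_eq affine_chart_lift)
      ultimately show ?thesis using w z by force
    qed simp
  qed
  then have "negligible (affine_inv k -` A)" using neg1 neg2 negligible_Un negligible_subset by blast
  then show ?thesis using Bb[of k] by (simp add: negligible_iff_emeasure0)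
qed

text \<open>The affine charts cover projective space, and in each of them the preceding lemmas apply to the potential
  \<open>fs_potential k\<close>.\<close>

theorem theorem1p2:
  fixes \<mu> \<sigma> :: "'n::finite cproj measure"
  assumes "2 \<le> CARD('n)"
    and "prob_space \<mu>" and "sets \<mu> = sets borel"
    and "\<And>\<eta>. emeasure \<mu> {\<eta>} = 0"
    and "log_potential \<mu> has_MA_omega \<sigma>"
  shows "absolutely_continuous FS_volume \<sigma>"
  unfolding absolutely_continuous_def
proof
  fix A :: "'n cproj set" assume A: "A \<in> null_sets FS_volume"
  then have Ab: "A \<in> sets borel" unfolding null_sets_def FS_volume_def by auto
  have sets_\<sigma>: "sets \<sigma> = sets borel" using assms(5) unfolding has_MA_omega_def by simp
  have "emeasure \<sigma> (A \<inter> affine_dom k) = 0" for k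
  proof -
    interpret C: log_potential_chart \<mu> k by (rule log_potential_chart.intro) (rule assms)+
    let ?\<sigma> = "distr (restrict_space \<sigma> (affine_dom k)) (restrict_space borel UNIV) (affine_chart k)"
    let ?\<phi> = "\<lambda>w. log_potential \<mu> (affine_inv k w) + ereal (fs_potential k (affine_inv k w))"
    have MA: "MA_on UNIV ?\<phi> ?\<sigma>"
    proof -
      have "\<forall>U z \<rho>. holomorphic_chart U z \<and> local_potential U \<rho> \<longrightarrow>
        MA_on (z ` U) (\<lambda>w. log_potential \<mu> (the_inv_into U z w) + ereal (\<rho> (the_inv_into U z w)))
          (distr (restrict_space \<sigma> U) (restrict_space borel (z ` U)) z)"
        using assms(5) unfolding has_MA_omega_def by blast
      from this[rule_format, OF conjI[OF holomorphic_chart_affine[of k] local_potential_fs[of k]]]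
      show ?thesis unfolding affine_chart_image the_inv_affine_chart .
    qed
    have \<phi>: "?\<phi> z = ereal_integral \<mu> (\<lambda>p. log_ereal (chord k p z / norm (affine_lift k z))) + ereal (ln (norm (affine_lift k z)))" for z
      unfolding log_potential_def log_kernel_affine fs_potential_affine by simp
    have B: "affine_inv k -` A \<in> sets borel" using measurable_sets[OF measurable_affine_inv Ab, of k] by simp
    have "emeasure ?\<sigma> (affine_inv k -` A) = 0"
      by (rule C.MA_null[OF assms(1,4) \<phi> MA B FS_null_affine[OF A]])
    moreover have "emeasure ?\<sigma> (affine_inv k -` A) = emeasure \<sigma> (A \<inter> affine_dom k)"
    proof -
      have cong: "sets (restrict_space \<sigma> (affine_dom k)) = sets (restrict_space borel (affine_dom k))"
        by (rule sets_restrict_space_cong[OF sets_\<sigma>])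
      have "affine_chart k \<in> borel_measurable (restrict_space \<sigma> (affine_dom k))"
        unfolding measurable_cong_sets[OF cong refl]
        by (rule borel_measurable_continuous_on_restrict[OF continuous_affine_chart])
      then have m: "affine_chart k \<in> measurable (restrict_space \<sigma> (affine_dom k)) (restrict_space borel UNIV)"
        by (intro measurable_restrict_space2) simp_all
      have sp: "space (restrict_space \<sigma> (affine_dom k)) = affine_dom k"
        using sets_eq_imp_space_eq[OF sets_\<sigma>] by (simp add: space_restrict_space)
      have "emeasure ?\<sigma> (affine_inv k -` A) = emeasure (restrict_space \<sigma> (affine_dom k)) (affine_chart k -` (affine_inv k -` A) \<inter> affine_dom k)"
        using emeasure_distr[OF m, of "affine_inv k -` A"] B unfolding sp by simp
      also have "affine_chart k -` (affine_inv k -` A) \<inter> affine_dom k = A \<inter> affine_dom k"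
        by (auto simp: affine_inv_eq affine_lift_chart)
      also have "emeasure (restrict_space \<sigma> (affine_dom k)) (A \<inter> affine_dom k) = emeasure \<sigma> (A \<inter> affine_dom k)"
        using sets_eq_imp_space_eq[OF sets_\<sigma>] open_affine_dom[of k]
        by (intro emeasure_restrict_space) (auto simp: sets_\<sigma>)
      finally show ?thesis .
    qed
    ultimately show ?thesis by simp
  qed
  then have "A \<inter> affine_dom k \<in> null_sets \<sigma>" for k
    using Ab open_affine_dom[of k] by (simp add: null_sets_def sets_\<sigma>)
  then have "(\<Union>k\<in>UNIV. A \<inter> affine_dom k) \<in> null_sets \<sigma>"
    by (intro null_sets_UN') (simp_all add: countable_finite)
  moreover have "(\<Union>k\<in>UNIV. A \<inter> affine_dom k) = A"
  proof -
    have "\<exists>k. p \<in> affine_dom k" for p :: "'n cproj"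
      using rep_nonzero[of p] unfolding affine_dom_def by (auto simp: vec_eq_iff)
    then show ?thesis by blast
  qed
  ultimately show "A \<in> null_sets \<sigma>" by simp
qed

end
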